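(* Assume $\mathbb A$ is compact, and that Monotonicity, Growth bound and Score continuity (see context) hold, so that $\mathcal R,\mathfrak R,\mathcal R_\vartheta$ are well defined. Then the following hold. (a) If Integral bound holds, then $\mathcal R(\mathfrak P;U)\le\mathfrak R(\mathfrak P;U)$ for all $\mathfrak P\in\Pi^{N\times(T-1)}$ and $U\in B_b(\mathbb X^N)$. (b) Suppose Monotonicity and, in addition, that there is $\underline c>0$ such that for any $\boldsymbol\lambda\in\mathcal P(\mathbb A)^N$ and any $u\ge u'$ in $B_b(\mathbb X^N)$ (and all $t\in\{1,\dots,T-1\}$, $\mathbf x\in\mathbb X^N$), $$\mathring{\mathbf G}u-\mathring{\mathbf G}u'\ge\underline c\int_{\mathbb X^N}(u-u')\,d\mathring\xi^{\otimes N},\qquad \mathbf G^{\boldsymbol\lambda}_tu(\mathbf x)-\mathbf G^{\boldsymbol\lambda}_tu'(\mathbf x)\ge\underline c\int_{\mathbb X^N}(u(\mathbf y)-u'(\mathbf y))\Big[\bigotimes_{n=1}^NQ^{\lambda^n}_{t,x^n,\overline\delta_{\mathbf x}}\Big](d\mathbf y).$$ Then $\mathcal R(\mathfrak P;U)\ge(\underline c/\bar c)^{T-1}\,\mathfrak R(\mathfrak P;U)$. (c) Suppose Uniform tightness, Integral bound, Consistency, Kernel continuity, Score continuity and Symmetric continuity (for the profile $\widetilde{\mathfrak P}$ and the terminal costs $U,V$) hold. Then $$\big|\mathcal R_\vartheta(\widetilde{\mathfrak P};U)-\mathcal R(\widetilde{\mathfrak P};U)\big|\le\underline{\mathfrak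 E},$$ where $$\underline{\mathfrak E}=\sum_{r=1}^{T-1}\bar c^{\,r}\,\mathcal C_{T-r}(\|V\|_\infty)\big(3\zeta(\vartheta(\mathfrak e_r))+(3+T)\zeta(\mathfrak e_r)\big)+(3+T)\bar c^{\,T}\iota(\mathfrak e_T).$$
   Context: Spaces. $\mathbb X$ (states) and $\mathbb A$ (actions) are complete separable metric spaces. For a Polish space $\mathbb Y$, $\mathcal P(\mathbb Y)$ is the set of Borel probability measures with the weak topology and its Borel $\sigma$-algebra; $B_b(\mathbb Y)$ is the set of bounded Borel real functions. All maps are Borel measurable. For a finite signed measure $m$ on $\mathbb Y$, $\|m\|_{BL}=\sup_h\frac12\int h\,dm$ over $1$-Lipschitz $h:\mathbb Y\to[-1,1]$, and $\|m\|_{TV}=\sup_h\frac12\int h\,dm$ over Borel $h:\mathbb Y\to[-1,1]$. A subadditive modulus of continuity is a nondecreasing, subadditive $\beta:[0,\infty]\to[0,\infty]$ with $\lim_{\ell\to0+}\beta(\ell)=0$. Model. Integers $T\ge2$, $N\ge1$ are fixed. $P_t:\mathbb X\times\mathcal P(\mathbb X)\times\mathbb A\to\mathcal P(\mathbb X)$, written $P_{t,x,\xi,a}$, $t=1,\dots,T-1$, are transition kernels and $\mathring\xi\in\mathcal P(\mathbb X)$ is the initial law. $\overline\delta_{\mathbf x}=\frac1N\sum_n\delta_{x^n}$ for $\mathbf x=(x^1,\dots,x^N)$, and $Q^\lambda_{t,x,\xi}(B)=\int_{\mathbb A}P_{t,x,\xi,a}(B)\lambda(da)$ for $\lambda\in\mathcal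 P(\mathbb A)$. Policies. $\Pi$ and $\widetilde\Pi$ are the sets of maps $\mathbb X^N\to\mathcal P(\mathbb A)$ ($\mathbf x\mapsto\pi_{\mathbf x}$) and $\mathbb X\times\mathcal P(\mathbb X)\to\mathcal P(\mathbb A)$ ($(x,\xi)\mapsto\tilde\pi_{x,\xi}$); $\tilde\pi\in\widetilde\Pi$ used by player $n$ is viewed as the element $\mathbf x\mapsto\tilde\pi_{x^n,\overline\delta_{\mathbf x}}$ of $\Pi$. $\widetilde\Pi_\vartheta$ is the set of $\tilde\pi\in\widetilde\Pi$ with $\|\tilde\pi_{x,\xi}-\tilde\pi_{x,\xi'}\|_{BL}\le\vartheta(\|\xi-\xi'\|_{BL})$ for all $x,\xi,\xi'$. A profile is $\mathfrak P=(\mathfrak p^1,\dots,\mathfrak p^N)$ with $\mathfrak p^n=(\mathfrak p^n_1,\dots,\mathfrak p^n_{T-1})$; $\mathfrak P_t=(\mathfrak p^1_t,\dots,\mathfrak p^N_t)$. Transition operators (empty compositions are identities). $\mathbf T^{\boldsymbol\pi}_tf(\mathbf x)=\int f\,d\bigotimes_nQ^{\pi^n_{\mathbf x}}_{t,x^n,\overline\delta_{\mathbf x}}$ and $\mathbb T^{\mathfrak P}_tf=\int\mathbf T^{\mathfrak P_1}_1\circ\cdots\circ\mathbf T^{\mathfrak P_{t-1}}_{t-1}f\,d\mathring\xi^{\otimes N}$, $t=1,\dots,T$. For $\Xi=(\xi_1,\dots,\xi_{T-1})$ and $\tilde{\mathfrak p}\in\widetilde\Pi^{T-1}$: $\overline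 T^{\tilde\pi}_{t,\xi}h(x)=\int h\,dQ^{\tilde\pi_{x,\xi}}_{t,x,\xi}$, $\overline{\mathbb T}^{\tilde{\mathfrak p}}_{t,\Xi}h=\int\overline T^{\tilde{\mathfrak p}_1}_{1,\xi_1}\circ\cdots\circ\overline T^{\tilde{\mathfrak p}_{t-1}}_{t-1,\xi_{t-1}}h\,d\mathring\xi$, and $\overline{\mathbb Q}^{\tilde{\mathfrak p}}_{t,\Xi}$ is the probability $B\mapsto\overline{\mathbb T}^{\tilde{\mathfrak p}}_{t,\Xi}\mathbf 1_B$. Score operators. Given are $\mathbf G^{\boldsymbol\lambda}_t:B_b(\mathbb X^N)\to B_b(\mathbb X^N)$ and $\overline G^\lambda_{t,\xi}:B_b(\mathbb X)\to B_b(\mathbb X)$ for $t=1,\dots,T-1$, $\boldsymbol\lambda=(\lambda^1,\dots,\lambda^N)\in\mathcal P(\mathbb A)^N$, $\lambda\in\mathcal P(\mathbb A)$, $\xi\in\mathcal P(\mathbb X)$, and functionals $\mathring{\mathbf G}:B_b(\mathbb X^N)\to\mathbb R$, $\mathring{\overline G}:B_b(\mathbb X)\to\mathbb R$; $(\mathbf x,\boldsymbol\lambda)\mapsto\mathbf G^{\boldsymbol\lambda}_tu(\mathbf x)$ and $(x,\xi,\lambda)\mapsto\overline G^\lambda_{t,\xi}v(x)$ are Borel. Put $\mathbf S^{\boldsymbol\pi}_tu(\mathbf x)=\mathbf G_t^{(\pi^1_{\mathbf x},\dots,\pi^N_{\mathbf x})}u(\mathbf x)$, $\mathbf S^{*\boldsymbol\pi}_tu(\mathbf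 x)=\inf_{\lambda\in\mathcal P(\mathbb A)}\mathbf G_t^{(\lambda,\pi^2_{\mathbf x},\dots,\pi^N_{\mathbf x})}u(\mathbf x)$, $\mathcal S^{\mathfrak P}_{s,t}=\mathbf S^{\mathfrak P_s}_s\circ\cdots\circ\mathbf S^{\mathfrak P_{t-1}}_{t-1}$, $\mathcal S^{*\mathfrak P}_{s,t}=\mathbf S^{*\mathfrak P_s}_s\circ\cdots\circ\mathbf S^{*\mathfrak P_{t-1}}_{t-1}$, $\mathbb S^{\mathfrak P}_t=\mathring{\mathbf G}\circ\mathcal S^{\mathfrak P}_{1,t}$, $\mathbb S^{*\mathfrak P}_t=\mathring{\mathbf G}\circ\mathcal S^{*\mathfrak P}_{1,t}$. Exploitabilities (of player 1). $\mathcal R(\mathfrak P;U)=\mathbb S^{\mathfrak P}_TU-\mathbb S^{*\mathfrak P}_TU$; $\mathfrak R(\mathfrak P;U)=\sum_{t=1}^{T-1}\bar c^{\,t}\,\mathbb T^{\mathfrak P}_t\big(\mathbf S^{\mathfrak P_t}_t\circ\mathcal S^{*\mathfrak P}_{t+1,T}U-\mathcal S^{*\mathfrak P}_{t,T}U\big)$, where, here and throughout, $\bar c$ denotes the constant appearing in Integral bound below; $\mathcal R_\vartheta(\mathfrak P;U)=\mathbb S^{\mathfrak P}_TU-\inf_{\tilde{\mathfrak p}\in\widetilde\Pi_\vartheta^{T-1}}\mathbb S^{(\tilde{\mathfrak p},\mathfrak p^2,\dots,\mathfrak p^N)}_TU$. Assumptions (for all $t,\boldsymbol\lambda,\boldsymbol\lambda',\lambda,\lambda',\xi,\xi',\mathbf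 x,x$ and all bounded Borel $u,u',v,v'$). Monotonicity: $\mathring{\mathbf G},\mathring{\overline G},\mathbf G^{\boldsymbol\lambda}_t,\overline G^\lambda_{t,\xi}$ are nondecreasing. Growth bound: there are $c_0,c_1>0$ with $\|\mathbf G^{\boldsymbol\lambda}_tu\|_\infty\le c_0+c_1\|u\|_\infty$, $\|\overline G^\lambda_{t,\xi}v\|_\infty\le c_0+c_1\|v\|_\infty$. Integral bound: there is $\bar c>0$ with $|\mathring{\mathbf G}u-\mathring{\mathbf G}u'|\le\bar c\int|u-u'|d\mathring\xi^{\otimes N}$, $|\mathbf G^{\boldsymbol\lambda}_tu(\mathbf x)-\mathbf G^{\boldsymbol\lambda}_tu'(\mathbf x)|\le\bar c\int|u-u'|\,d\bigotimes_nQ^{\lambda^n}_{t,x^n,\overline\delta_{\mathbf x}}$, $|\mathring{\overline G}v-\mathring{\overline G}v'|\le\bar c\int|v-v'|d\mathring\xi$, $|\overline G^\lambda_{t,\xi}v(x)-\overline G^\lambda_{t,\xi}v'(x)|\le\bar c\int|v-v'|dQ^\lambda_{t,x,\xi}$. Consistency: if $u(\mathbf x)=v(x^1)$ for all $\mathbf x$, then $\mathring{\mathbf G}u=\mathring{\overline G}v$ and $\mathbf G^{\boldsymbol\lambda}_tu(\mathbf x)=\overline G^{\lambda^1}_{t,\overline\delta_{\mathbf x}}v(x^1)$. Score continuity: there is a subadditive modulus $\zeta$ (with the same $c_0,c_1$) such that $\|\mathbf G^{\boldsymbol\lambda}_tu-\mathbf G^{\boldsymbol\lambda'}_tu\|_\infty\le(c_0+c_1\|u\|_\infty)\zeta(\|\lambda^1-\lambda'^1\|_{BL})$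 for all $\boldsymbol\lambda,\boldsymbol\lambda'\in\mathcal P(\mathbb A)^N$, and $\|\overline G^\lambda_{t,\xi}v-\overline G^{\lambda'}_{t,\xi'}v\|_\infty\le(c_0+c_1\|v\|_\infty)(\zeta(\|\xi-\xi'\|_{BL})+\zeta(\|\lambda-\lambda'\|_{BL}))$. Uniform tightness: there is an increasing sequence $\mathfrak K=(K_i)_{i\ge1}$ of compact subsets of $\mathbb X$ with $\overline{\mathbb Q}^{\tilde{\mathfrak p}}_{t,\Xi}(K_i^c)\le i^{-1}$ for all $i\ge1$, $t\in\{1,\dots,T\}$, $\Xi\in\mathcal P(\mathbb X)^{T-1}$, $\tilde{\mathfrak p}\in\widetilde\Pi^{T-1}$. Kernel continuity: there is a subadditive modulus $\eta$ with $\|P_{t,x,\xi,a}-P_{t,x,\xi',a'}\|_{TV}\le\eta(d_{\mathbb A}(a,a'))+\eta(\|\xi-\xi'\|_{BL})$. Symmetric continuity: $\vartheta,\iota$ are subadditive moduli; $\widetilde{\mathfrak P}=(\tilde{\mathfrak p}^1,\dots,\tilde{\mathfrak p}^N)\in\widetilde\Pi_\vartheta^{N\times(T-1)}$; all players are subject to the same terminal cost $U\in B_b(\mathbb X^N)$, and there is $V\in B_b(\mathbb X\times\mathcal P(\mathbb X))$ with $U(\mathbf x)=V(x^1,\overline\delta_{\mathbf x})$ and $|V(x,\xi)-V(x,\xi')|\le\iota(\|\xi-\xi'\|_{BL})$. Error terms. For a metric space $A$, $\mathfrak N_j(A)$ is the least number of open sup-norm balls of radius $j^{-1}$ centred in $C_{BL}(A)=\{1\text{-Lipschitz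 }A\to[-1,1]\}$ covering $C_{BL}(A)$; $\mathfrak r_{\mathfrak K}(N)=\inf_{i,j\ge1}\{\frac12j^{-1}+i^{-1}+\sqrt\pi\,\mathfrak N_j(K_i)/\sqrt{2N}\}$. $\mathcal C_r(z)=c_0\sum_{k=1}^rc_1^{k-1}+c_1^rz$. $\mathfrak e_1=\mathfrak r_{\mathfrak K}(N)$ and, for $t=2,\dots,T$, $\mathfrak e_t=2\inf_{L>1+\eta(2/L)}\big\{\sum_{r=1}^{t-1}(L\vartheta(\mathfrak e_r)+\eta(\mathfrak e_r))+\eta(2/L)\big\}+\frac tN+\mathfrak r_{\mathfrak K}(N)$. *)

theory Defs
  imports "HOL-Probability.Probability"
begin

definition prob_measures :: "'a::topological_space measure set" where
  "prob_measures = {\<mu>. prob_space \<mu> \<and> sets \<mu> = sets borel}"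

text \<open>The coarsest topology on the Borel probability measures for which all integrals of bounded
  continuous functions are continuous, and its Borel sigma-algebra.\<close>

definition weak_topology :: "'a::topological_space measure topology" where
  "weak_topology = topology_generated_by
     {{\<mu> \<in> prob_measures. (\<integral>x. f x \<partial>\<mu>) \<in> W} | (f :: 'a \<Rightarrow> real) W.
        continuous_on UNIV f \<and> bounded (range f) \<and> open W}"

definition borel_prob :: "'a::topological_space measure measure" where
  "borel_prob = sigma prob_measures {W. openin weak_topology W}"

lemma topspace_weak_topology: "topspace weak_topology = prob_measures"
proof -
  have "\<exists>X. (\<exists>(f :: 'a \<Rightarrow> real) W. X = {\<mu> \<in> prob_measures. (\<integral>x. f x \<partial>\<mu>) \<in> W} \<and>
      continuous_on UNIV f \<and> bounded (range f) \<and> open W) \<and> \<mu> \<in> X"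
    if "\<mu> \<in> prob_measures" for \<mu> :: "'a measure"
    by (rule exI[of _ prob_measures], intro conjI exI[of _ "\<lambda>_. 0"] exI[of _ UNIV]) (use that in auto)
  then show ?thesis
    by (auto simp: weak_topology_def topology_generated_by_topspace)
qed

lemma space_borel_prob: "space borel_prob = prob_measures"
  unfolding borel_prob_def
  by (rule space_measure_of) (use openin_subset topspace_weak_topology in blast)

text \<open>The norms \<open>\<parallel>\<mu> - \<nu>\<parallel>\<close> (bounded Lipschitz and total variation) of the difference of two
  probability measures, both normalised with the factor 1/2.\<close>

definition bl_dist :: "'a::metric_space measure \<Rightarrow> 'a measure \<Rightarrow> real" where
  "bl_dist \<mu> \<nu> = (SUP h \<in> {h :: 'a \<Rightarrow> real. 1-lipschitz_on UNIV h \<and> range h \<subseteq> {-1..1}}.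
     1/2 * ((\<integral>x. h x \<partial>\<mu>) - (\<integral>x. h x \<partial>\<nu>)))"

definition tv_dist :: "'a::topological_space measure \<Rightarrow> 'a measure \<Rightarrow> real" where
  "tv_dist \<mu> \<nu> = (SUP h \<in> {h :: 'a \<Rightarrow> real. h \<in> borel_measurable borel \<and> range h \<subseteq> {-1..1}}.
     1/2 * ((\<integral>x. h x \<partial>\<mu>) - (\<integral>x. h x \<partial>\<nu>)))"

definition subadditive_modulus :: "(ennreal \<Rightarrow> ennreal) \<Rightarrow> bool" where
  "subadditive_modulus \<beta> \<longleftrightarrow>
     mono \<beta> \<and> (\<forall>a b. \<beta> (a + b) \<le> \<beta> a + \<beta> b) \<and> (\<beta> \<longlongrightarrow> 0) (at_right 0)"

text \<open>Bounded Borel functions on a measurable space. Functions on \<^term>\<open>space S\<close> are represented by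
  functions on the whole type; values outside \<^term>\<open>space S\<close> carry no information.\<close>

definition bounded_borel :: "'b measure \<Rightarrow> ('b \<Rightarrow> real) set" where
  "bounded_borel S = {f \<in> borel_measurable S. \<exists>C. \<forall>x\<in>space S. \<bar>f x\<bar> \<le> C}"

definition sup_norm :: "'b measure \<Rightarrow> ('b \<Rightarrow> real) \<Rightarrow> real" where
  "sup_norm S f = (SUP x\<in>space S. \<bar>f x\<bar>)"

text \<open>Players are numbered \<open>1, \<dots>, N\<close> and N-tuples are elements of \<open>Pi\<^sub>M {1..N}\<close>.
  The arguments of \<open>score\<close> are time, the tuple of action laws, the cost function and the state
  tuple; those of \<open>mf_score\<close> are time, population law, action law, cost function and state.\<close>

record ('x, 'a) game =
  players :: nat
  horizon :: nat
  trans_kernel :: "nat \<Rightarrow> 'x \<Rightarrow> 'x measure \<Rightarrow> 'a \<Rightarrow> 'x measure"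
  init_law :: "'x measure"
  init_score :: "((nat \<Rightarrow> 'x) \<Rightarrow> real) \<Rightarrow> real"
  score :: "nat \<Rightarrow> (nat \<Rightarrow> 'a measure) \<Rightarrow> ((nat \<Rightarrow> 'x) \<Rightarrow> real) \<Rightarrow> (nat \<Rightarrow> 'x) \<Rightarrow> real"
  init_mf_score :: "('x \<Rightarrow> real) \<Rightarrow> real"
  mf_score :: "nat \<Rightarrow> 'x measure \<Rightarrow> 'a measure \<Rightarrow> ('x \<Rightarrow> real) \<Rightarrow> 'x \<Rightarrow> real"

definition state_tuples :: "('x::polish_space, 'a::polish_space) game \<Rightarrow> (nat \<Rightarrow> 'x) measure" where
  "state_tuples M = Pi\<^sub>M {1..players M} (\<lambda>_. borel)"

definition action_laws :: "('x::polish_space, 'a::polish_space) game \<Rightarrow> (nat \<Rightarrow> 'a measure) measure" where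
  "action_laws M = Pi\<^sub>M {1..players M} (\<lambda>_. borel_prob)"

definition game_wf :: "('x::polish_space, 'a::polish_space) game \<Rightarrow> bool" where
  "game_wf M \<longleftrightarrow>
     2 \<le> horizon M \<and> 1 \<le> players M \<and> init_law M \<in> prob_measures \<and>
     (\<forall>t\<in>{1..<horizon M}.
        (\<lambda>(x, \<xi>, a). trans_kernel M t x \<xi> a) \<in> borel \<Otimes>\<^sub>M borel_prob \<Otimes>\<^sub>M borel \<rightarrow>\<^sub>M borel_prob \<and>
        (\<forall>u\<in>bounded_borel (state_tuples M).
           (\<forall>l\<in>space (action_laws M). score M t l u \<in> bounded_borel (state_tuples M)) \<and>
           (\<lambda>(x, l). score M t l u x) \<in> borel_measurable (state_tuples M \<Otimes>\<^sub>M action_laws M)) \<and>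
        (\<forall>v\<in>bounded_borel borel.
           (\<forall>\<xi>\<in>prob_measures. \<forall>l\<in>prob_measures. mf_score M t \<xi> l v \<in> bounded_borel borel) \<and>
           (\<lambda>(x, \<xi>, l). mf_score M t \<xi> l v x)
             \<in> borel_measurable (borel \<Otimes>\<^sub>M borel_prob \<Otimes>\<^sub>M borel_prob)))"

text \<open>The image of the uniform distribution on \<open>{1..N}\<close> under \<open>n \<mapsto> x n\<close>, that is, the
  average of the Dirac measures at \<open>x 1, \<dots>, x N\<close>.\<close>

definition empirical :: "('x::polish_space, 'a::polish_space) game \<Rightarrow> (nat \<Rightarrow> 'x) \<Rightarrow> 'x measure" where
  "empirical M x = distr (uniform_count_measure {1..players M}) borel x"

lemma emeasure_empirical:
  assumes "1 \<le> players M" "B \<in> sets borel"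
  shows "emeasure (empirical M x) B
    = ennreal (1 / players M * (\<Sum>n=1..players M. indicator B (x n)))"
proof -
  let ?I = "{1..players M}"
  have "emeasure (empirical M x) B = emeasure (uniform_count_measure ?I) (x -` B \<inter> ?I)"
    unfolding empirical_def
    by (subst emeasure_distr) (use assms in \<open>auto simp: space_uniform_count_measure\<close>)
  also have "\<dots> = ennreal (card (x -` B \<inter> ?I) / players M)"
    by (subst emeasure_uniform_count_measure) auto
  also have "real (card (x -` B \<inter> ?I)) = (\<Sum>n\<in>?I. indicator B (x n))"
  proof -
    have "(\<Sum>n\<in>?I. indicator B (x n)) = (\<Sum>n\<in>?I. indicator (x -` B) n :: real)"
      by (rule sum.cong) (auto simp: indicator_def)
    also have "\<dots> = real (card (?I \<inter> x -` B))"
      by (simp add: indicator_def sum.If_cases Int_def)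
    finally show ?thesis by (simp add: Int_commute)
  qed
  finally show ?thesis by simp
qed

text \<open>The mixture \<open>B \<mapsto> \<integral> P(B) \<lambda>(da)\<close>.\<close>

definition mixed_kernel ::
  "('x::polish_space, 'a::polish_space) game \<Rightarrow> nat \<Rightarrow> 'x \<Rightarrow> 'x measure \<Rightarrow> 'a measure \<Rightarrow> 'x measure" where
  "mixed_kernel M t x \<xi> l = l \<bind> (\<lambda>a. trans_kernel M t x \<xi> a)"

definition next_law ::
  "('x::polish_space, 'a::polish_space) game \<Rightarrow> nat \<Rightarrow> (nat \<Rightarrow> 'a measure) \<Rightarrow> (nat \<Rightarrow> 'x) \<Rightarrow> (nat \<Rightarrow> 'x) measure" where
  "next_law M t l x = Pi\<^sub>M {1..players M} (\<lambda>n. mixed_kernel M t (x n) (empirical M x) (l n))"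

definition init_tuple_law :: "('x::polish_space, 'a::polish_space) game \<Rightarrow> (nat \<Rightarrow> 'x) measure" where
  "init_tuple_law M = Pi\<^sub>M {1..players M} (\<lambda>_. init_law M)"

type_synonym ('x, 'a) policy = "(nat \<Rightarrow> 'x) \<Rightarrow> 'a measure"
type_synonym ('x, 'a) mf_policy = "'x \<Rightarrow> 'x measure \<Rightarrow> 'a measure"

definition policies :: "('x::polish_space, 'a::polish_space) game \<Rightarrow> ('x, 'a) policy set" where
  "policies M = state_tuples M \<rightarrow>\<^sub>M borel_prob"

definition mf_policies :: "('x::polish_space, 'a::polish_space) mf_policy set" where
  "mf_policies = {p. (\<lambda>(x, \<xi>). p x \<xi>) \<in> borel \<Otimes>\<^sub>M borel_prob \<rightarrow>\<^sub>M borel_prob}"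

definition mf_policies_mod ::
  "(ennreal \<Rightarrow> ennreal) \<Rightarrow> ('x::polish_space, 'a::polish_space) mf_policy set" where
  "mf_policies_mod \<theta> = {p \<in> mf_policies. \<forall>x. \<forall>\<xi>\<in>prob_measures. \<forall>\<xi>'\<in>prob_measures.
     ennreal (bl_dist (p x \<xi>) (p x \<xi>')) \<le> \<theta> (ennreal (bl_dist \<xi> \<xi>'))}"

definition as_policy ::
  "('x::polish_space, 'a::polish_space) game \<Rightarrow> nat \<Rightarrow> ('x, 'a) mf_policy \<Rightarrow> ('x, 'a) policy" where
  "as_policy M n p = (\<lambda>x. p (x n) (empirical M x))"

text \<open>In a profile \<open>\<PP>\<close>, the policy of player \<open>n\<close> at time \<open>t\<close> is \<open>\<PP> n t\<close>; only
  \<open>n \<in> {1..N}\<close> and \<open>t \<in> {1..<T}\<close> matter.\<close>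

definition profiles ::
  "('x::polish_space, 'a::polish_space) game \<Rightarrow> (nat \<Rightarrow> nat \<Rightarrow> ('x, 'a) policy) set" where
  "profiles M = {\<PP>. \<forall>n\<in>{1..players M}. \<forall>t\<in>{1..<horizon M}. \<PP> n t \<in> policies M}"

definition mf_profiles_mod ::
  "('x::polish_space, 'a::polish_space) game \<Rightarrow> (ennreal \<Rightarrow> ennreal) \<Rightarrow> (nat \<Rightarrow> nat \<Rightarrow> ('x, 'a) mf_policy) set" where
  "mf_profiles_mod M \<theta> =
     {\<PP>. \<forall>n\<in>{1..players M}. \<forall>t\<in>{1..<horizon M}. \<PP> n t \<in> mf_policies_mod \<theta>}"

definition as_profile ::
  "('x::polish_space, 'a::polish_space) game \<Rightarrow> (nat \<Rightarrow> nat \<Rightarrow> ('x, 'a) mf_policy) \<Rightarrow> nat \<Rightarrow> nat \<Rightarrow> ('x, 'a) policy" where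
  "as_profile M \<PP> = (\<lambda>n t. as_policy M n (\<PP> n t))"

text \<open>Compositions \<open>F s \<circ> \<dots> \<circ> F (t - 1)\<close> are written \<open>foldr F [s..<t]\<close>.\<close>

definition trans_step ::
  "('x::polish_space, 'a::polish_space) game \<Rightarrow> (nat \<Rightarrow> nat \<Rightarrow> ('x, 'a) policy) \<Rightarrow> nat
    \<Rightarrow> ((nat \<Rightarrow> 'x) \<Rightarrow> real) \<Rightarrow> (nat \<Rightarrow> 'x) \<Rightarrow> real" where
  "trans_step M \<PP> t f x = (\<integral>y. f y \<partial>(next_law M t (\<lambda>n. \<PP> n t x) x))"

definition trans_op ::
  "('x::polish_space, 'a::polish_space) game \<Rightarrow> (nat \<Rightarrow> nat \<Rightarrow> ('x, 'a) policy) \<Rightarrow> nat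
    \<Rightarrow> ((nat \<Rightarrow> 'x) \<Rightarrow> real) \<Rightarrow> real" where
  "trans_op M \<PP> t f = (\<integral>x. foldr (trans_step M \<PP>) [1..<t] f x \<partial>(init_tuple_law M))"

definition mf_trans_step ::
  "('x::polish_space, 'a::polish_space) game \<Rightarrow> (nat \<Rightarrow> ('x, 'a) mf_policy) \<Rightarrow> (nat \<Rightarrow> 'x measure) \<Rightarrow> nat
    \<Rightarrow> ('x \<Rightarrow> real) \<Rightarrow> 'x \<Rightarrow> real" where
  "mf_trans_step M p \<Xi> t h x = (\<integral>y. h y \<partial>(mixed_kernel M t x (\<Xi> t) (p t x (\<Xi> t))))"

definition mf_trans_op ::
  "('x::polish_space, 'a::polish_space) game \<Rightarrow> (nat \<Rightarrow> ('x, 'a) mf_policy) \<Rightarrow> (nat \<Rightarrow> 'x measure) \<Rightarrow> nat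
    \<Rightarrow> ('x \<Rightarrow> real) \<Rightarrow> real" where
  "mf_trans_op M p \<Xi> t h = (\<integral>x. foldr (mf_trans_step M p \<Xi>) [1..<t] h x \<partial>(init_law M))"

definition mf_prob ::
  "('x::polish_space, 'a::polish_space) game \<Rightarrow> (nat \<Rightarrow> ('x, 'a) mf_policy) \<Rightarrow> (nat \<Rightarrow> 'x measure) \<Rightarrow> nat
    \<Rightarrow> 'x set \<Rightarrow> real" where
  "mf_prob M p \<Xi> t B = mf_trans_op M p \<Xi> t (indicator B)"

definition score_step ::
  "('x::polish_space, 'a::polish_space) game \<Rightarrow> (nat \<Rightarrow> nat \<Rightarrow> ('x, 'a) policy) \<Rightarrow> nat
    \<Rightarrow> ((nat \<Rightarrow> 'x) \<Rightarrow> real) \<Rightarrow> (nat \<Rightarrow> 'x) \<Rightarrow> real" where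
  "score_step M \<PP> t u x = score M t (\<lambda>n\<in>{1..players M}. \<PP> n t x) u x"

definition opt_score_step ::
  "('x::polish_space, 'a::polish_space) game \<Rightarrow> (nat \<Rightarrow> nat \<Rightarrow> ('x, 'a) policy) \<Rightarrow> nat
    \<Rightarrow> ((nat \<Rightarrow> 'x) \<Rightarrow> real) \<Rightarrow> (nat \<Rightarrow> 'x) \<Rightarrow> real" where
  "opt_score_step M \<PP> t u x =
     (INF l\<in>prob_measures. score M t ((\<lambda>n\<in>{1..players M}. \<PP> n t x)(1 := l)) u x)"

definition score_op ::
  "('x::polish_space, 'a::polish_space) game \<Rightarrow> (nat \<Rightarrow> nat \<Rightarrow> ('x, 'a) policy) \<Rightarrow> nat
    \<Rightarrow> ((nat \<Rightarrow> 'x) \<Rightarrow> real) \<Rightarrow> real" where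
  "score_op M \<PP> t u = init_score M (foldr (score_step M \<PP>) [1..<t] u)"

definition opt_score_op ::
  "('x::polish_space, 'a::polish_space) game \<Rightarrow> (nat \<Rightarrow> nat \<Rightarrow> ('x, 'a) policy) \<Rightarrow> nat
    \<Rightarrow> ((nat \<Rightarrow> 'x) \<Rightarrow> real) \<Rightarrow> real" where
  "opt_score_op M \<PP> t u = init_score M (foldr (opt_score_step M \<PP>) [1..<t] u)"

definition exploitability ::
  "('x::polish_space, 'a::polish_space) game \<Rightarrow> (nat \<Rightarrow> nat \<Rightarrow> ('x, 'a) policy)
    \<Rightarrow> ((nat \<Rightarrow> 'x) \<Rightarrow> real) \<Rightarrow> real" where
  "exploitability M \<PP> U = score_op M \<PP> (horizon M) U - opt_score_op M \<PP> (horizon M) U"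

definition stepwise_exploitability ::
  "('x::polish_space, 'a::polish_space) game \<Rightarrow> real \<Rightarrow> (nat \<Rightarrow> nat \<Rightarrow> ('x, 'a) policy)
    \<Rightarrow> ((nat \<Rightarrow> 'x) \<Rightarrow> real) \<Rightarrow> real" where
  "stepwise_exploitability M cbar \<PP> U =
     (\<Sum>t = 1..horizon M - 1. cbar ^ t * trans_op M \<PP> t
        (\<lambda>x. score_step M \<PP> t (foldr (opt_score_step M \<PP>) [t + 1..<horizon M] U) x
           - foldr (opt_score_step M \<PP>) [t..<horizon M] U x))"

definition restricted_exploitability ::
  "('x::polish_space, 'a::polish_space) game \<Rightarrow> (ennreal \<Rightarrow> ennreal) \<Rightarrow> (nat \<Rightarrow> nat \<Rightarrow> ('x, 'a) policy)
    \<Rightarrow> ((nat \<Rightarrow> 'x) \<Rightarrow> real) \<Rightarrow> real" where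
  "restricted_exploitability M \<theta> \<PP> U = score_op M \<PP> (horizon M) U
     - (INF p \<in> {p. \<forall>t\<in>{1..<horizon M}. p t \<in> mf_policies_mod \<theta>}.
          score_op M (\<PP>(1 := \<lambda>t. as_policy M 1 (p t))) (horizon M) U)"

definition monotonicity :: "('x::polish_space, 'a::polish_space) game \<Rightarrow> bool" where
  "monotonicity M \<longleftrightarrow>
     (\<forall>u\<in>bounded_borel (state_tuples M). \<forall>u'\<in>bounded_borel (state_tuples M).
        (\<forall>x\<in>space (state_tuples M). u x \<le> u' x) \<longrightarrow>
          init_score M u \<le> init_score M u' \<and>
          (\<forall>t\<in>{1..<horizon M}. \<forall>l\<in>space (action_laws M). \<forall>x\<in>space (state_tuples M).
             score M t l u x \<le> score M t l u' x)) \<and>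
     (\<forall>v\<in>bounded_borel borel. \<forall>v'\<in>bounded_borel borel.
        (\<forall>x. v x \<le> v' x) \<longrightarrow>
          init_mf_score M v \<le> init_mf_score M v' \<and>
          (\<forall>t\<in>{1..<horizon M}. \<forall>\<xi>\<in>prob_measures. \<forall>l\<in>prob_measures. \<forall>x.
             mf_score M t \<xi> l v x \<le> mf_score M t \<xi> l v' x))"

definition growth_bound :: "('x::polish_space, 'a::polish_space) game \<Rightarrow> real \<Rightarrow> real \<Rightarrow> bool" where
  "growth_bound M c0 c1 \<longleftrightarrow> 0 < c0 \<and> 0 < c1 \<and>
     (\<forall>t\<in>{1..<horizon M}.
        (\<forall>l\<in>space (action_laws M). \<forall>u\<in>bounded_borel (state_tuples M).
           sup_norm (state_tuples M) (score M t l u) \<le> c0 + c1 * sup_norm (state_tuples M) u) \<and>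
        (\<forall>\<xi>\<in>prob_measures. \<forall>l\<in>prob_measures. \<forall>v\<in>bounded_borel borel.
           sup_norm borel (mf_score M t \<xi> l v) \<le> c0 + c1 * sup_norm borel v))"

definition integral_bound :: "('x::polish_space, 'a::polish_space) game \<Rightarrow> real \<Rightarrow> bool" where
  "integral_bound M cbar \<longleftrightarrow> 0 < cbar \<and>
     (\<forall>u\<in>bounded_borel (state_tuples M). \<forall>u'\<in>bounded_borel (state_tuples M).
        \<bar>init_score M u - init_score M u'\<bar> \<le> cbar * (\<integral>y. \<bar>u y - u' y\<bar> \<partial>(init_tuple_law M)) \<and>
        (\<forall>t\<in>{1..<horizon M}. \<forall>l\<in>space (action_laws M). \<forall>x\<in>space (state_tuples M).
           \<bar>score M t l u x - score M t l u' x\<bar>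
             \<le> cbar * (\<integral>y. \<bar>u y - u' y\<bar> \<partial>(next_law M t l x)))) \<and>
     (\<forall>v\<in>bounded_borel borel. \<forall>v'\<in>bounded_borel borel.
        \<bar>init_mf_score M v - init_mf_score M v'\<bar> \<le> cbar * (\<integral>y. \<bar>v y - v' y\<bar> \<partial>(init_law M)) \<and>
        (\<forall>t\<in>{1..<horizon M}. \<forall>\<xi>\<in>prob_measures. \<forall>l\<in>prob_measures. \<forall>x.
           \<bar>mf_score M t \<xi> l v x - mf_score M t \<xi> l v' x\<bar>
             \<le> cbar * (\<integral>y. \<bar>v y - v' y\<bar> \<partial>(mixed_kernel M t x \<xi> l))))"

definition lower_integral_bound :: "('x::polish_space, 'a::polish_space) game \<Rightarrow> real \<Rightarrow> bool" where
  "lower_integral_bound M c \<longleftrightarrow> 0 < c \<and>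
     (\<forall>u\<in>bounded_borel (state_tuples M). \<forall>u'\<in>bounded_borel (state_tuples M).
        (\<forall>x\<in>space (state_tuples M). u' x \<le> u x) \<longrightarrow>
          init_score M u - init_score M u' \<ge> c * (\<integral>y. u y - u' y \<partial>(init_tuple_law M)) \<and>
          (\<forall>t\<in>{1..<horizon M}. \<forall>l\<in>space (action_laws M). \<forall>x\<in>space (state_tuples M).
             score M t l u x - score M t l u' x \<ge> c * (\<integral>y. u y - u' y \<partial>(next_law M t l x))))"

definition consistency :: "('x::polish_space, 'a::polish_space) game \<Rightarrow> bool" where
  "consistency M \<longleftrightarrow>
     (\<forall>u\<in>bounded_borel (state_tuples M). \<forall>v\<in>bounded_borel borel.
        (\<forall>x\<in>space (state_tuples M). u x = v (x 1)) \<longrightarrow>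
          init_score M u = init_mf_score M v \<and>
          (\<forall>t\<in>{1..<horizon M}. \<forall>l\<in>space (action_laws M). \<forall>x\<in>space (state_tuples M).
             score M t l u x = mf_score M t (empirical M x) (l 1) v (x 1)))"

definition score_continuity ::
  "('x::polish_space, 'a::polish_space) game \<Rightarrow> real \<Rightarrow> real \<Rightarrow> (ennreal \<Rightarrow> ennreal) \<Rightarrow> bool" where
  "score_continuity M c0 c1 \<zeta> \<longleftrightarrow> subadditive_modulus \<zeta> \<and>
     (\<forall>t\<in>{1..<horizon M}.
        (\<forall>l\<in>space (action_laws M). \<forall>l'\<in>space (action_laws M). \<forall>u\<in>bounded_borel (state_tuples M).
           ennreal (sup_norm (state_tuples M) (\<lambda>x. score M t l u x - score M t l' u x))
             \<le> ennreal (c0 + c1 * sup_norm (state_tuples M) u) * \<zeta> (ennreal (bl_dist (l 1) (l' 1)))) \<and>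
        (\<forall>\<xi>\<in>prob_measures. \<forall>\<xi>'\<in>prob_measures. \<forall>l\<in>prob_measures. \<forall>l'\<in>prob_measures.
           \<forall>v\<in>bounded_borel borel.
           ennreal (sup_norm borel (\<lambda>x. mf_score M t \<xi> l v x - mf_score M t \<xi>' l' v x))
             \<le> ennreal (c0 + c1 * sup_norm borel v)
                * (\<zeta> (ennreal (bl_dist \<xi> \<xi>')) + \<zeta> (ennreal (bl_dist l l')))))"

definition uniform_tightness ::
  "('x::polish_space, 'a::polish_space) game \<Rightarrow> (nat \<Rightarrow> 'x set) \<Rightarrow> bool" where
  "uniform_tightness M K \<longleftrightarrow>
     (\<forall>i\<ge>1. compact (K i) \<and> K i \<subseteq> K (Suc i)) \<and>
     (\<forall>i\<ge>1. \<forall>t\<in>{1..horizon M}. \<forall>\<Xi> p.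
        (\<forall>s\<in>{1..<horizon M}. \<Xi> s \<in> prob_measures \<and> p s \<in> mf_policies) \<longrightarrow>
          mf_prob M p \<Xi> t (- K i) \<le> 1 / real i)"

definition kernel_continuity ::
  "('x::polish_space, 'a::polish_space) game \<Rightarrow> (ennreal \<Rightarrow> ennreal) \<Rightarrow> bool" where
  "kernel_continuity M \<eta> \<longleftrightarrow> subadditive_modulus \<eta> \<and>
     (\<forall>t\<in>{1..<horizon M}. \<forall>x. \<forall>\<xi>\<in>prob_measures. \<forall>\<xi>'\<in>prob_measures. \<forall>a a'.
        ennreal (tv_dist (trans_kernel M t x \<xi> a) (trans_kernel M t x \<xi>' a'))
          \<le> \<eta> (ennreal (dist a a')) + \<eta> (ennreal (bl_dist \<xi> \<xi>')))"

definition symmetric_continuity ::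
  "('x::polish_space, 'a::polish_space) game \<Rightarrow> (ennreal \<Rightarrow> ennreal) \<Rightarrow> (ennreal \<Rightarrow> ennreal)
    \<Rightarrow> (nat \<Rightarrow> nat \<Rightarrow> ('x, 'a) mf_policy) \<Rightarrow> ((nat \<Rightarrow> 'x) \<Rightarrow> real) \<Rightarrow> ('x \<times> 'x measure \<Rightarrow> real) \<Rightarrow> bool" where
  "symmetric_continuity M \<theta> \<iota> \<PP> U V \<longleftrightarrow>
     subadditive_modulus \<theta> \<and> subadditive_modulus \<iota> \<and> \<PP> \<in> mf_profiles_mod M \<theta> \<and>
     U \<in> bounded_borel (state_tuples M) \<and> V \<in> bounded_borel (borel \<Otimes>\<^sub>M borel_prob) \<and>
     (\<forall>x\<in>space (state_tuples M). U x = V (x 1, empirical M x)) \<and>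
     (\<forall>x. \<forall>\<xi>\<in>prob_measures. \<forall>\<xi>'\<in>prob_measures.
        ennreal \<bar>V (x, \<xi>) - V (x, \<xi>')\<bar> \<le> \<iota> (ennreal (bl_dist \<xi> \<xi>')))"

definition C_BL :: "'a::metric_space set \<Rightarrow> ('a \<Rightarrow> real) set" where
  "C_BL A = {h \<in> A \<rightarrow>\<^sub>E {-1..1}. 1-lipschitz_on A h}"

text \<open>The value is \<open>\<infinity>\<close> if there is no finite cover (which does not happen for compact \<open>A\<close>).\<close>

definition covering_number :: "nat \<Rightarrow> 'a::metric_space set \<Rightarrow> ennreal" where
  "covering_number j A =
     (INF F \<in> {F. finite F \<and> F \<subseteq> C_BL A \<and>
        (\<forall>h\<in>C_BL A. \<exists>g\<in>F. (SUP x\<in>A. ennreal \<bar>h x - g x\<bar>) < ennreal (1 / real j))}.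
      of_nat (card F))"

definition emp_rate :: "(nat \<Rightarrow> 'x::metric_space set) \<Rightarrow> nat \<Rightarrow> ennreal" where
  "emp_rate K N = (INF i\<in>{1..}. INF j\<in>{1..}.
     ennreal (1/2 * (1 / real j)) + ennreal (1 / real i)
       + ennreal (sqrt pi) * covering_number j (K i) / ennreal (sqrt (2 * real N)))"

definition cost_bound :: "real \<Rightarrow> real \<Rightarrow> nat \<Rightarrow> real \<Rightarrow> real" where
  "cost_bound c0 c1 r z = c0 * (\<Sum>k = 1..r. c1 ^ (k - 1)) + c1 ^ r * z"

text \<open>The sequence starts at \<open>t = 1\<close>; the value at 0 is not used.\<close>

function err ::
  "(ennreal \<Rightarrow> ennreal) \<Rightarrow> (ennreal \<Rightarrow> ennreal) \<Rightarrow> (nat \<Rightarrow> 'x::metric_space set) \<Rightarrow> nat \<Rightarrow> nat \<Rightarrow> ennreal" where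
  "err \<eta> \<theta> K N t =
     (if t \<le> 1 then emp_rate K N
      else 2 * (INF L \<in> {L::real. 0 < L \<and> 1 + \<eta> (ennreal (2 / L)) < ennreal L}.
               (\<Sum>r = 1..<t. ennreal L * \<theta> (err \<eta> \<theta> K N r) + \<eta> (err \<eta> \<theta> K N r))
                 + \<eta> (ennreal (2 / L)))
           + of_nat t / of_nat N + emp_rate K N)"
  by pat_completeness auto
termination
  by (relation "Wellfounded.measure (\<lambda>(_, _, _, _, t). t)") auto

declare err.simps [simp del]

definition total_error ::
  "('x::polish_space, 'a::polish_space) game \<Rightarrow> real \<Rightarrow> real \<Rightarrow> real \<Rightarrow> (ennreal \<Rightarrow> ennreal)
    \<Rightarrow> (ennreal \<Rightarrow> ennreal) \<Rightarrow> (ennreal \<Rightarrow> ennreal) \<Rightarrow> (ennreal \<Rightarrow> ennreal) \<Rightarrow> (nat \<Rightarrow> 'x set)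
    \<Rightarrow> ('x \<times> 'x measure \<Rightarrow> real) \<Rightarrow> ennreal" where
  "total_error M c0 c1 cbar \<zeta> \<eta> \<theta> \<iota> K V =
     (let N = players M; T = horizon M; e = err \<eta> \<theta> K N in
       (\<Sum>r = 1..T - 1.
          ennreal (cbar ^ r * cost_bound c0 c1 (T - r) (sup_norm (borel \<Otimes>\<^sub>M borel_prob) V))
            * (3 * \<zeta> (\<theta> (e r)) + (3 + of_nat T) * \<zeta> (e r)))
       + (3 + of_nat T) * ennreal (cbar ^ T) * \<iota> (e T))"

end

theory Submission
  imports Defs
begin

text \<open>
  The first two claims compare the exploitability with its stepwise version. Let player 1 follow the profile
  before time \<open>t\<close> and respond optimally from then on. The scores of these hybrid strategies interpolate between
  the optimal score and the score of the profile, so the exploitability is a telescoping sum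
  (\<open>exploitability_telescope\<close>). Each increment is a difference of two ordered functions of the state at time
  \<open>t\<close>, evaluated by \<open>t - 1\<close> score operators and the initial score; on ordered functions each of these acts, up to a
  factor between \<open>clow\<close> and \<open>cbar\<close>, like an integration against the transition kernel or the initial law
  (\<open>score_op_compare\<close>). The lower bound loses the ratio of the two constants at most \<open>T - 1\<close> times.

  For the third claim let \<open>\<xi>\<^sub>t\<close> be the mean field flow: the average over the players of the laws of independent
  single-player chains whose population law is \<open>\<xi>\<^sub>t\<close> itself. Freeze the population law to this flow. A nearly
  optimal policy of a single player in the frozen control problem depends on the own state only, so it satisfies
  every modulus condition and is allowed as a restricted deviation. The score that it achieves in the game is not
  much larger than the frozen value (\<open>upper_value\<close>), and the optimal score in the game is not much smaller
  (\<open>lower_value\<close>). Since restricting the deviations can only raise the infimum, the two exploitabilities are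
  close. Both comparisons lose \<open>\<zeta>\<close> of the distance \<open>Z\<^sub>t\<close> between the empirical measure and \<open>\<xi>\<^sub>t\<close> at each time
  and \<open>\<iota>\<close> of it at the end, averaged over the chain in which the players other than the first follow the given
  policies.

  What remains is that twice the mean of \<open>\<beta> Z\<^sub>t\<close> is at most \<open>(3 + T) * \<beta> e\<^sub>t\<close> for every subadditive modulus
  \<open>\<beta>\<close> and every policy of player 1 (\<open>propagation_of_chaos\<close>). A finite cover of the test functions on a compact
  set reduces \<open>Z\<^sub>t\<close> to finitely many averages. Each test function is pulled back along the mean field chains; from
  one time to the next the averages of the pulled-back functions change by a fluctuation, which is of order
  \<open>1 / sqrt N\<close> by conditional independence (\<open>PiM_max_deviation\<close>), and by a bias, which is at most \<open>1 / N\<close> for the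
  deviating player plus a modulus of the current distance for the others (\<open>bias_average\<close>). This gives a recursion
  for the means of \<open>Z\<^sub>t\<close>. From a mean one passes to a modulus by \<open>\<beta> z \<le> (1 + z / m) * \<beta> m\<close>.

  The constants need some care, because a ball of radius \<open>1 / j\<close> contributes \<open>1 / j\<close> to the distance, which is
  twice its share in \<open>e\<^sub>t\<close>. For \<open>T \<ge> 3\<close> it is enough that the mean of \<open>Z\<^sub>t\<close> is at most \<open>(1 + T) / 2\<close> times
  \<open>e\<^sub>t\<close> (\<open>chaos_long\<close>). For \<open>T = 2\<close> the estimate \<open>Z\<^sub>t \<le> 2 * e\<^sub>t\<close>, which costs only a factor 2, holds except for large
  fluctuations, and these are paid for by second moments (\<open>chaos_two\<close>).
\<close>

section \<open>Markov kernels and laws on Polish spaces\<close>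

lemma prob_measures_eq: "prob_measures = space (prob_algebra (borel::'a::topological_space measure))"
  by (auto simp: prob_measures_def space_prob_algebra)

lemma prob_measuresD:
  assumes "\<mu> \<in> prob_measures"
  shows "prob_space \<mu>" "sets \<mu> = sets borel" "space \<mu> = UNIV"
proof -
  show "prob_space \<mu>" and *: "sets \<mu> = sets borel" using assms by (auto simp: prob_measures_def)
  show "space \<mu> = UNIV" using sets_eq_imp_space_eq[OF *] by simp
qed

lemma prob_algebraD:
  assumes "\<mu> \<in> space (prob_algebra S)"
  shows "prob_space \<mu>" "sets \<mu> = sets S" "space \<mu> = space S"
  using assms by (auto simp: space_prob_algebra dest: sets_eq_imp_space_eq)

lemma kernelD:
  assumes "K \<in> S \<rightarrow>\<^sub>M prob_algebra R" "x \<in> space S"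
  shows "prob_space (K x)" "sets (K x) = sets R" "space (K x) = space R"
  using measurable_space[OF assms] by (auto dest: prob_algebraD)

lemma bounded_integrable:
  fixes f :: "'b \<Rightarrow> real"
  assumes "prob_space \<mu>" "sets \<mu> = sets S" "f \<in> borel_measurable S" "\<And>x. x \<in> space S \<Longrightarrow> \<bar>f x\<bar> \<le> C"
  shows "integrable \<mu> f"
proof -
  interpret prob_space \<mu> by fact
  have sp: "space \<mu> = space S" using assms(2) by (rule sets_eq_imp_space_eq)
  show ?thesis
    by (rule integrable_const_bound[of _ C])
       (use assms sp in \<open>auto cong: measurable_cong_sets\<close>)
qed

lemma integral_bounds:
  fixes f :: "'b \<Rightarrow> real"
  assumes "prob_space \<mu>" "sets \<mu> = sets S" "f \<in> borel_measurable S" "\<And>x. x \<in> space S \<Longrightarrow> \<bar>f x\<bar> \<le> C"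
  shows "\<bar>\<integral>x. f x \<partial>\<mu>\<bar> \<le> C"
proof -
  interpret prob_space \<mu> by fact
  have sp: "space \<mu> = space S" using assms(2) by (rule sets_eq_imp_space_eq)
  have i: "integrable \<mu> f" by (rule bounded_integrable[OF assms])
  have "\<bar>\<integral>x. f x \<partial>\<mu>\<bar> \<le> (\<integral>x. \<bar>f x\<bar> \<partial>\<mu>)" by (rule integral_abs_bound)
  also have "\<dots> \<le> (\<integral>x. C \<partial>\<mu>)"
    by (rule integral_mono) (use i assms(4) sp in auto)
  also have "\<dots> = C" by (simp add: prob_space)
  finally show ?thesis .
qed

lemma integral_bind_kernel:
  fixes f :: "'b \<Rightarrow> real"
  assumes mu: "\<mu> \<in> space (prob_algebra S)" and K: "K \<in> S \<rightarrow>\<^sub>M prob_algebra R"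
    and f: "f \<in> borel_measurable R" and C: "\<And>x. x \<in> space R \<Longrightarrow> \<bar>f x\<bar> \<le> C"
  shows "(\<integral>y. f y \<partial>(\<mu> \<bind> K)) = (\<integral>x. (\<integral>y. f y \<partial>K x) \<partial>\<mu>)"
proof -
  note mu' = prob_algebraD[OF mu]
  have K': "K \<in> \<mu> \<rightarrow>\<^sub>M subprob_algebra R"
    using measurable_prob_algebraD[OF K] mu'(2) by (simp cong: measurable_cong_sets)
  interpret prob_space \<mu> by (rule mu')
  have "AE x in \<mu>. emeasure (K x) (space (K x)) \<le> ennreal 1"
    using kernelD(1)[OF K] mu'(3) by (intro AE_I2) (simp add: prob_space.emeasure_space_1)
  then show ?thesis
    by (intro integral_bind[where K=R and B=C and B'=1] f K' C finite_measure_axioms) auto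
qed

lemma nn_integral_bind_kernel:
  assumes mu: "\<mu> \<in> space (prob_algebra S)" and K: "K \<in> S \<rightarrow>\<^sub>M prob_algebra R"
    and f: "f \<in> borel_measurable R"
  shows "(\<integral>\<^sup>+y. f y \<partial>(\<mu> \<bind> K)) = (\<integral>\<^sup>+x. (\<integral>\<^sup>+y. f y \<partial>K x) \<partial>\<mu>)"
proof -
  have K': "K \<in> \<mu> \<rightarrow>\<^sub>M subprob_algebra R"
    using measurable_prob_algebraD[OF K] prob_algebraD[OF mu] by (simp cong: measurable_cong_sets)
  show ?thesis by (rule nn_integral_bind[OF f K'])
qed

lemma bind_in_prob_algebra:
  assumes "\<mu> \<in> space (prob_algebra S)" "K \<in> S \<rightarrow>\<^sub>M prob_algebra R"
  shows "\<mu> \<bind> K \<in> space (prob_algebra R)"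
  using prob_space_bind'[OF assms] sets_bind'[OF assms] by (simp add: space_prob_algebra)

lemma measurable_integral_kernel:
  fixes f :: "'b \<Rightarrow> real"
  assumes "K \<in> S \<rightarrow>\<^sub>M prob_algebra R" "f \<in> borel_measurable R"
  shows "(\<lambda>x. \<integral>y. f y \<partial>K x) \<in> borel_measurable S"
  using measurable_compose[OF measurable_prob_algebraD[OF assms(1)] integral_measurable_subprob_algebra[OF assms(2)]] .

lemma measurable_nn_integral_kernel:
  assumes "K \<in> S \<rightarrow>\<^sub>M prob_algebra R" "f \<in> borel_measurable R"
  shows "(\<lambda>x. \<integral>\<^sup>+y. f y \<partial>K x) \<in> borel_measurable S"
  using measurable_compose[OF measurable_prob_algebraD[OF assms(1)] nn_integral_measurable_subprob_algebra[OF assms(2)]] .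

lemma PiM_in_prob_algebra:
  assumes "finite I" "\<And>i. i \<in> I \<Longrightarrow> \<nu> i \<in> space (prob_algebra (R i))"
  shows "Pi\<^sub>M I \<nu> \<in> space (prob_algebra (Pi\<^sub>M I R))"
    "\<And>A. (\<And>i. i \<in> I \<Longrightarrow> A i \<in> sets (R i)) \<Longrightarrow> emeasure (Pi\<^sub>M I \<nu>) (Pi\<^sub>E I A) = (\<Prod>i\<in>I. emeasure (\<nu> i) (A i))"
proof -
  \<comment> \<open>Product spaces ask for a probability measure at every index; Dirac measures fill the indices outside \<open>I\<close>.\<close>
  define \<nu>' where "\<nu>' i = (if i \<in> I then \<nu> i else return (count_space UNIV) undefined)" for i
  have ps: "prob_space (\<nu>' i)" for i
    using assms(2) by (auto simp: \<nu>'_def space_prob_algebra intro!: prob_space_return)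
  interpret product_prob_space \<nu>' I by (rule product_prob_spaceI) (rule ps)
  interpret finite_product_prob_space \<nu>' I by standard fact
  have eq: "Pi\<^sub>M I \<nu> = Pi\<^sub>M I \<nu>'" by (rule PiM_cong) (auto simp: \<nu>'_def)
  have s: "sets (Pi\<^sub>M I \<nu>) = sets (Pi\<^sub>M I R)"
    by (rule sets_PiM_cong) (use assms(2) in \<open>auto simp: space_prob_algebra\<close>)
  show "Pi\<^sub>M I \<nu> \<in> space (prob_algebra (Pi\<^sub>M I R))"
    using s prob_space_axioms by (simp add: space_prob_algebra eq)
  fix A assume "\<And>i. i \<in> I \<Longrightarrow> A i \<in> sets (R i)"
  then have "emeasure (Pi\<^sub>M I \<nu>') (Pi\<^sub>E I A) = (\<Prod>i\<in>I. emeasure (\<nu>' i) (A i))"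
    using assms(2) by (intro emeasure_PiM[OF assms(1)]) (auto simp: \<nu>'_def space_prob_algebra)
  also have "\<dots> = (\<Prod>i\<in>I. emeasure (\<nu> i) (A i))" by (rule prod.cong) (auto simp: \<nu>'_def)
  finally show "emeasure (Pi\<^sub>M I \<nu>) (Pi\<^sub>E I A) = (\<Prod>i\<in>I. emeasure (\<nu> i) (A i))"
    by (simp add: eq)
qed

text \<open>Boxes generate the product sigma-algebra and are stable under intersection, and the mass of a box is a
  finite product of measurable functions of the parameter.\<close>

lemma measurable_PiM_kernel:
  assumes I: "finite I" and K: "\<And>i. i \<in> I \<Longrightarrow> K i \<in> S \<rightarrow>\<^sub>M prob_algebra (R i)"
  shows "(\<lambda>x. Pi\<^sub>M I (\<lambda>i. K i x)) \<in> S \<rightarrow>\<^sub>M prob_algebra (Pi\<^sub>M I R)"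
proof (rule measurable_prob_algebra_generated)
  show "sets (Pi\<^sub>M I R) = sigma_sets (\<Pi>\<^sub>E i\<in>I. space (R i)) (prod_algebra I R)"
    by (rule sets_PiM)
  show "Int_stable (prod_algebra I R)" by (rule Int_stable_prod_algebra)
  show "prod_algebra I R \<subseteq> Pow (\<Pi>\<^sub>E i\<in>I. space (R i))" by (rule prod_algebra_sets_into_space)
  fix x assume x: "x \<in> space S"
  have 1: "K i x \<in> space (prob_algebra (R i))" if "i \<in> I" for i
    using measurable_space[OF K[OF that] x] .
  note P = PiM_in_prob_algebra(1)[where \<nu> = "\<lambda>i. K i x", OF I 1]
  show "prob_space (Pi\<^sub>M I (\<lambda>i. K i x))" "sets (Pi\<^sub>M I (\<lambda>i. K i x)) = sets (Pi\<^sub>M I R)"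
    using P by (auto simp: space_prob_algebra)
next
  fix A assume "A \<in> prod_algebra I R"
  then obtain E where A: "A = Pi\<^sub>E I E" and E: "\<And>i. i \<in> I \<Longrightarrow> E i \<in> sets (R i)"
    unfolding prod_algebra_eq_finite[OF I] by (auto simp: Pi_iff)
  have "(\<lambda>x. \<Prod>i\<in>I. emeasure (K i x) (E i)) \<in> borel_measurable S"
  proof (rule borel_measurable_prod_ennreal)
    fix i assume i: "i \<in> I"
    show "(\<lambda>x. emeasure (K i x) (E i)) \<in> borel_measurable S"
      using measurable_compose[OF measurable_prob_algebraD[OF K[OF i]] measurable_emeasure_subprob_algebra[OF E[OF i]]] .
  qed
  also have "?this \<longleftrightarrow> (\<lambda>x. emeasure (Pi\<^sub>M I (\<lambda>i. K i x)) A) \<in> borel_measurable S"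
    unfolding A
    by (rule measurable_cong, subst PiM_in_prob_algebra(2)[where R=R])
       (use I E measurable_space[OF K] in auto)
  finally show "(\<lambda>x. emeasure (Pi\<^sub>M I (\<lambda>i. K i x)) A) \<in> borel_measurable S" .
qed

text \<open>The indicator of a closed set is a pointwise limit of bounded continuous functions, whose integrals are
  weakly continuous by definition; closed sets generate the Borel sets. Hence kernels that are measurable for
  the weak topology are Markov kernels in the usual sense.\<close>

lemma borel_prob_to_prob_algebra:
  "(\<lambda>\<mu>. \<mu>) \<in> (borel_prob :: 'a::metric_space measure measure) \<rightarrow>\<^sub>M prob_algebra borel"
proof (rule measurable_prob_algebra_generated)
  show "sets (borel :: 'a measure) = sigma_sets UNIV (Collect closed)"
    by (subst borel_eq_closed) (simp add: sets_measure_of)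
  show "Int_stable (Collect closed :: 'a set set)" by (auto simp: Int_stable_def)
  fix \<mu> :: "'a measure" assume "\<mu> \<in> space borel_prob"
  then show "prob_space \<mu>" "sets \<mu> = sets borel" by (auto simp: space_borel_prob prob_measures_def)
next
  fix A :: "'a set" assume "A \<in> Collect closed"
  then have cl: "closed A" by simp
  show "(\<lambda>\<mu>. emeasure \<mu> A) \<in> borel_measurable borel_prob"
  proof (cases "A = {}")
    case False
    define f where "f n x = max 0 (1 - real n * infdist x A)" for n x
    have f_cont: "continuous_on UNIV (f n)" for n
      unfolding f_def by (intro continuous_intros)
    have f_bd: "0 \<le> f n x" "f n x \<le> 1" for n x
      by (auto simp: f_def infdist_nonneg)
    have f_lim: "(\<lambda>n. f n x) \<longlonglongrightarrow> indicator A x" for x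
    proof (cases "x \<in> A")
      case True then show ?thesis by (simp add: f_def)
    next
      case F: False
      then have pos: "infdist x A > 0"
        using cl False by (simp add: infdist_pos_not_in_closed)
      obtain n0 :: nat where n0: "1 / infdist x A < n0" using reals_Archimedean2 by blast
      have "f n x = 0" if "n \<ge> n0" for n
      proof -
        have "1 / infdist x A < real n" using n0 that by linarith
        then show ?thesis using pos by (simp add: f_def field_simps)
      qed
      then have "\<forall>\<^sub>F n in sequentially. f n x = 0" by (auto simp: eventually_sequentially)
      then show ?thesis using F by (simp add: tendsto_eventually)
    qed
    have m: "(\<lambda>\<mu>. \<integral>x. f n x \<partial>\<mu>) \<in> borel_measurable borel_prob" for n
    proof (rule borel_measurableI)
      fix W :: "real set" assume "open W"
      have "openin weak_topology {\<mu> \<in> prob_measures. (\<integral>x. f n x \<partial>\<mu>) \<in> W}"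
        unfolding weak_topology_def
        apply (rule topology_generated_by_Basis)
        using f_cont[of n] \<open>open W\<close> f_bd
        by (auto intro!: exI[of _ "f n"] exI[of _ W] boundedI[of _ 1])
      then have "{\<mu> \<in> prob_measures. (\<integral>x. f n x \<partial>\<mu>) \<in> W} \<in> sets borel_prob"
        unfolding borel_prob_def
        by (subst sets_measure_of) (use openin_subset topspace_weak_topology in \<open>auto\<close>)
      then show "(\<lambda>\<mu>. \<integral>x. f n x \<partial>\<mu>) -` W \<inter> space borel_prob \<in> sets borel_prob"
        by (simp add: space_borel_prob vimage_def Int_def conj_commute)
    qed
    have "(\<lambda>\<mu>. measure \<mu> A) \<in> borel_measurable borel_prob"
    proof (rule borel_measurable_LIMSEQ_real[OF _ m])
      fix \<mu> :: "'a measure" assume "\<mu> \<in> space borel_prob"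
      then have mu: "\<mu> \<in> prob_measures" by (simp add: space_borel_prob)
      interpret prob_space \<mu> by (rule prob_measuresD[OF mu])
      have [simp]: "sets \<mu> = sets borel" by (rule prob_measuresD[OF mu])
      have "(\<lambda>n. \<integral>x. f n x \<partial>\<mu>) \<longlonglongrightarrow> (\<integral>x. indicator A x \<partial>\<mu>)"
        by (rule integral_dominated_convergence[where w="\<lambda>_. 1"])
           (use f_lim f_bd cl borel_measurable_continuous_onI[OF f_cont] in \<open>auto cong: measurable_cong_sets\<close>)
      then show "(\<lambda>n. \<integral>x. f n x \<partial>\<mu>) \<longlonglongrightarrow> measure \<mu> A"
        using cl by simp
    qed
    then have "(\<lambda>\<mu>. ennreal (measure \<mu> A)) \<in> borel_measurable borel_prob" by simp
    also have "?this \<longleftrightarrow> ?thesis"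
      by (rule measurable_cong)
         (auto simp: space_borel_prob prob_measures_def intro!: finite_measure.emeasure_eq_measure[symmetric] prob_space.finite_measure)
    finally show ?thesis .
  qed simp
qed auto

lemma borel_prob_kernel:
  "K \<in> S \<rightarrow>\<^sub>M borel_prob \<Longrightarrow> K \<in> S \<rightarrow>\<^sub>M prob_algebra (borel :: 'a::metric_space measure)"
  using measurable_compose[OF _ borel_prob_to_prob_algebra] by blast

text \<open>A tuple over \<open>I\<close> is a function on all indices, with a fixed default value off \<open>I\<close>. On the space of all
  sequences the product sigma-algebra is the Borel one, so functions of tuples inherit measurability from
  continuity.\<close>

lemma PiM_to_borel:
  "(\<lambda>x. x) \<in> Pi\<^sub>M I (\<lambda>_. borel) \<rightarrow>\<^sub>M (borel :: (nat \<Rightarrow> 'x::polish_space) measure)"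
proof -
  have "(\<lambda>x. x) \<in> Pi\<^sub>M I (\<lambda>_. borel) \<rightarrow>\<^sub>M Pi\<^sub>M UNIV (\<lambda>_. borel :: 'x measure)"
  proof (rule measurable_PiM_single')
    fix i show "(\<lambda>x. x i) \<in> Pi\<^sub>M I (\<lambda>_. borel) \<rightarrow>\<^sub>M (borel :: 'x measure)"
    proof (cases "i \<in> I")
      case False
      then have "(\<lambda>x. x i) \<in> Pi\<^sub>M I (\<lambda>_. borel) \<rightarrow>\<^sub>M (borel :: 'x measure) \<longleftrightarrow>
         (\<lambda>x :: nat \<Rightarrow> 'x. undefined) \<in> Pi\<^sub>M I (\<lambda>_. borel :: 'x measure) \<rightarrow>\<^sub>M (borel :: 'x measure)"
        by (intro measurable_cong) (auto simp: space_PiM PiE_def extensional_def)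
      then show ?thesis by simp
    qed simp
  qed auto
  then show ?thesis by (subst measurable_cong_sets[OF refl sets_PiM_equal_borel[symmetric]])
qed

section \<open>Moduli of continuity\<close>

lemma modulusD:
  assumes "subadditive_modulus \<beta>"
  shows "\<And>a b. a \<le> b \<Longrightarrow> \<beta> a \<le> \<beta> b" "\<And>a b. \<beta> (a + b) \<le> \<beta> a + \<beta> b"
  using assms by (auto simp: subadditive_modulus_def mono_def)

lemma modulus_small:
  assumes \<beta>: "subadditive_modulus \<beta>" and e: "0 < e"
  obtains \<delta> :: real where "0 < \<delta>" "\<beta> (ennreal \<delta>) < e"
proof -
  have "(\<beta> \<longlongrightarrow> 0) (at_right 0)" using \<beta> by (simp add: subadditive_modulus_def)
  then have "\<forall>\<^sub>F x in at_right 0. \<beta> x < e" using e by (rule order_tendstoD)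
  then obtain b :: ennreal where b: "0 < b" "\<And>y. 0 < y \<Longrightarrow> y < b \<Longrightarrow> \<beta> y < e"
    using eventually_at_right[of "0::ennreal" 1] by auto
  obtain c where c: "0 < c" "c < b" using dense[OF b(1)] by auto
  then have "c \<noteq> \<top>" using less_le_trans[OF c(2) top_greatest] by simp
  then have "c = ennreal (enn2real c)" by (simp add: less_top)
  moreover have "0 < enn2real c" using c(1) \<open>c \<noteq> \<top>\<close> by (simp add: enn2real_positive_iff less_top)
  ultimately show ?thesis using that[of "enn2real c"] b(2)[OF c] by simp
qed

lemma modulus_0:
  assumes \<beta>: "subadditive_modulus \<beta>" shows "\<beta> 0 = 0"
proof (rule ccontr)
  assume "\<beta> 0 \<noteq> 0"
  then have "0 < \<beta> 0" by (simp add: zero_less_iff_neq_zero)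
  then obtain \<delta> :: real where "\<beta> (ennreal \<delta>) < \<beta> 0" using modulus_small[OF \<beta>] by blast
  then show False using modulusD(1)[OF \<beta>, of 0 "ennreal \<delta>"] by simp
qed

lemma modulusI:
  assumes "\<And>a b. a \<le> b \<Longrightarrow> \<beta> a \<le> \<beta> b" "\<And>a b. \<beta> (a + b) \<le> \<beta> a + \<beta> b"
    and "\<And>e::real. 0 < e \<Longrightarrow> \<exists>\<delta>::real. 0 < \<delta> \<and> \<beta> (ennreal \<delta>) < ennreal e"
  shows "subadditive_modulus \<beta>"
  unfolding subadditive_modulus_def
proof (intro conjI allI)
  show "mono \<beta>" using assms(1) by (simp add: mono_def)
  show "(\<beta> \<longlongrightarrow> 0) (at_right 0)"
  proof (rule order_tendstoI)
    fix a :: ennreal assume "a < 0" then show "\<forall>\<^sub>F x in at_right 0. a < \<beta> x" by simp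
  next
    fix a :: ennreal assume "0 < a"
    then obtain e :: real where e: "0 < e" "ennreal e \<le> a"
    proof (cases a)
      case (real r)
      then show ?thesis using that[of r] \<open>0 < a\<close> by simp
    next
      case top
      then show ?thesis using that[of 1] by simp
    qed
    obtain \<delta> :: real where \<delta>: "0 < \<delta>" "\<beta> (ennreal \<delta>) < ennreal e" using assms(3)[OF e(1)] by blast
    show "\<forall>\<^sub>F x in at_right 0. \<beta> x < a"
      unfolding eventually_at_right[OF zero_less_one]
    proof (intro exI[of _ "ennreal \<delta>"] conjI allI impI)
      show "0 < ennreal \<delta>" using \<delta> by simp
      fix y :: ennreal assume "0 < y" "y < ennreal \<delta>"
      then have "\<beta> y \<le> \<beta> (ennreal \<delta>)" by (intro assms(1)) simp
      then show "\<beta> y < a" using \<delta>(2) e(2) by (meson le_less_trans less_le_trans)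
    qed
  qed
qed (use assms in auto)

lemma modulus_id: "subadditive_modulus (\<lambda>z. z)"
  by (rule modulusI) (auto intro!: exI[of _ "_ / 2"] ennreal_lessI)

lemma modulus_comp:
  assumes "subadditive_modulus \<beta>" "subadditive_modulus \<gamma>"
  shows "subadditive_modulus (\<lambda>z. \<beta> (\<gamma> z))"
proof (rule modulusI)
  note b = modulusD[OF assms(1)] and g = modulusD[OF assms(2)]
  show "a \<le> c \<Longrightarrow> \<beta> (\<gamma> a) \<le> \<beta> (\<gamma> c)" for a c using b(1) g(1) by blast
  show "\<beta> (\<gamma> (a + c)) \<le> \<beta> (\<gamma> a) + \<beta> (\<gamma> c)" for a c
    using order_trans[OF b(1)[OF g(2)] b(2)] .
  fix e :: real assume "0 < e"
  then obtain d :: real where d: "0 < d" "\<beta> (ennreal d) < ennreal e"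
    using modulus_small[OF assms(1), of "ennreal e"] by auto
  obtain d' :: real where d': "0 < d'" "\<gamma> (ennreal d') < ennreal d"
    using modulus_small[OF assms(2), of "ennreal d"] d(1) by auto
  show "\<exists>\<delta>::real. 0 < \<delta> \<and> \<beta> (\<gamma> (ennreal \<delta>)) < ennreal e"
    using d' d b(1)[OF less_imp_le[OF d'(2)]] by (intro exI[of _ d']) auto
qed

lemma modulus_add:
  assumes "subadditive_modulus \<beta>" "subadditive_modulus \<gamma>"
  shows "subadditive_modulus (\<lambda>z. \<beta> z + \<gamma> z)"
proof (rule modulusI)
  note b = modulusD[OF assms(1)] and g = modulusD[OF assms(2)]
  show "a \<le> c \<Longrightarrow> \<beta> a + \<gamma> a \<le> \<beta> c + \<gamma> c" for a c using b(1) g(1) by (intro add_mono)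
  show "\<beta> (a + c) + \<gamma> (a + c) \<le> (\<beta> a + \<gamma> a) + (\<beta> c + \<gamma> c)" for a c
    using add_mono[OF b(2)[of a c] g(2)[of a c]] by (simp add: ac_simps)
  fix e :: real assume "0 < e"
  then have e2: "0 < ennreal (e/2)" by simp
  obtain d :: real where d: "0 < d" "\<beta> (ennreal d) < ennreal (e/2)"
    using modulus_small[OF assms(1) e2] by auto
  obtain d' :: real where d': "0 < d'" "\<gamma> (ennreal d') < ennreal (e/2)"
    using modulus_small[OF assms(2) e2] by auto
  have "\<beta> (ennreal (min d d')) + \<gamma> (ennreal (min d d')) < ennreal (e/2) + ennreal (e/2)"
    using d d' b(1)[of "ennreal (min d d')" "ennreal d"] g(1)[of "ennreal (min d d')" "ennreal d'"]
    by (intro add_strict_mono) (auto simp: ennreal_leI intro: le_less_trans)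
  also have "\<dots> = ennreal e" using \<open>0 < e\<close> by (simp flip: ennreal_plus)
  finally show "\<exists>\<delta>::real. 0 < \<delta> \<and> \<beta> (ennreal \<delta>) + \<gamma> (ennreal \<delta>) < ennreal e"
    using d d' by (intro exI[of _ "min d d'"]) auto
qed

lemma modulus_cmult:
  assumes "subadditive_modulus \<beta>"
  shows "subadditive_modulus (\<lambda>z. ennreal L * \<beta> z)"
proof (cases "0 < L")
  case L: True
  note b = modulusD[OF assms(1)]
  show ?thesis
  proof (rule modulusI)
    show "a \<le> c \<Longrightarrow> ennreal L * \<beta> a \<le> ennreal L * \<beta> c" for a c using b(1) by (intro mult_left_mono) auto
    show "ennreal L * \<beta> (a + c) \<le> ennreal L * \<beta> a + ennreal L * \<beta> c" for a c
      using b(2)[of a c] by (simp flip: distrib_left add: mult_left_mono)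
    fix e :: real assume "0 < e"
    then obtain d :: real where d: "0 < d" "\<beta> (ennreal d) < ennreal (e / L)"
      using modulus_small[OF assms(1), of "ennreal (e/L)"] L by auto
    have "ennreal L * \<beta> (ennreal d) < ennreal L * ennreal (e / L)"
      using d L by (intro ennreal_mult_strict_left_mono) auto
    also have "\<dots> = ennreal e" using L \<open>0 < e\<close> by (simp flip: ennreal_mult)
    finally show "\<exists>\<delta>::real. 0 < \<delta> \<and> ennreal L * \<beta> (ennreal \<delta>) < ennreal e"
      using d by blast
  qed
next
  case False
  then have "ennreal L = 0" by (simp add: ennreal_neg)
  then show ?thesis by (intro modulusI) (auto intro: exI[of _ 1])
qed

lemma modulus_of_nat:
  assumes \<beta>: "subadditive_modulus \<beta>" shows "\<beta> (of_nat k * m) \<le> of_nat k * \<beta> m"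
proof (induction k)
  case (Suc k)
  have "\<beta> (of_nat (Suc k) * m) = \<beta> (m + of_nat k * m)" by (simp add: distrib_right)
  also have "\<dots> \<le> \<beta> m + \<beta> (of_nat k * m)" by (rule modulusD(2)[OF \<beta>])
  also have "\<dots> \<le> \<beta> m + of_nat k * \<beta> m" by (intro add_left_mono Suc)
  also have "\<dots> = of_nat (Suc k) * \<beta> m" by (simp add: distrib_right)
  finally show ?case .
qed (simp add: modulus_0[OF \<beta>])

lemma modulus_scale_nat:
  assumes \<beta>: "subadditive_modulus \<beta>" and "z \<le> of_nat k * m"
  shows "\<beta> z \<le> of_nat k * \<beta> m"
  using order_trans[OF modulusD(1)[OF \<beta> assms(2)] modulus_of_nat[OF \<beta>]] .

text \<open>Rounding the factor up to an integer costs at most 1.\<close>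

lemma modulus_scale:
  assumes \<beta>: "subadditive_modulus \<beta>" and z: "z \<le> ennreal a * m" and a: "0 \<le> a"
  shows "\<beta> z \<le> ennreal (a + 1) * \<beta> m"
proof -
  define k where "k = nat \<lceil>a\<rceil>"
  have k: "a \<le> real k" "real k \<le> a + 1" using a unfolding k_def by linarith+
  have "ennreal a \<le> of_nat k" using k(1) by (metis ennreal_leI ennreal_of_nat_eq_real_of_nat)
  then have "z \<le> of_nat k * m" using z by (meson order_trans mult_right_mono zero_le)
  from modulus_scale_nat[OF \<beta> this] have "\<beta> z \<le> of_nat k * \<beta> m" .
  also have "\<dots> \<le> ennreal (a + 1) * \<beta> m"
    using k(2) by (intro mult_right_mono) (auto simp: ennreal_of_nat_eq_real_of_nat ennreal_leI)
  finally show ?thesis .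
qed

text \<open>Up to the factor 2 nothing is lost to rounding, and beyond it \<open>w + 1 \<le> 2 + w\<^sup>2 / 4\<close> because
  \<open>(w - 2)\<^sup>2 \<ge> 0\<close>. A random factor whose second moment is small therefore costs little more than 2.\<close>

lemma modulus_scale_max2:
  assumes \<beta>: "subadditive_modulus \<beta>" and z: "z \<le> ennreal (max 2 w) * m" and q: "w\<^sup>2 \<le> q"
  shows "\<beta> z \<le> ennreal (2 + q / 4) * \<beta> m"
proof (cases "w \<le> 2")
  case True
  then have "z \<le> of_nat 2 * m" using z by (cases "w = 2") (auto simp: max_def ennreal_numeral)
  from modulus_scale_nat[OF \<beta> this] have "\<beta> z \<le> ennreal 2 * \<beta> m" by (simp add: ennreal_numeral)
  also have "\<dots> \<le> ennreal (2 + q / 4) * \<beta> m"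
  proof -
    have "0 \<le> q" using q order_trans[OF zero_le_power2] by blast
    then show ?thesis by (intro mult_right_mono ennreal_leI) auto
  qed
  finally show ?thesis .
next
  case False
  then have "z \<le> ennreal w * m" using z by (simp add: max_def)
  from modulus_scale[OF \<beta> this] False have "\<beta> z \<le> ennreal (w + 1) * \<beta> m" by simp
  also have "\<dots> \<le> ennreal (2 + q / 4) * \<beta> m"
  proof -
    have "0 \<le> (w - 2)\<^sup>2" by simp
    then have "w + 1 \<le> 2 + q / 4" using q by (simp add: power2_eq_square algebra_simps)
    then show ?thesis by (intro mult_right_mono ennreal_leI) auto
  qed
  finally show ?thesis .
qed

text \<open>A subadditive modulus is right-continuous, as its value at \<open>A + \<delta>\<close> exceeds that at \<open>A\<close> by at most its
  value at \<open>\<delta>\<close>. This is how the infima in the error terms are reached without being attained.\<close>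

lemma modulus_limit:
  assumes \<beta>: "subadditive_modulus \<beta>" and \<gamma>: "subadditive_modulus \<gamma>"
    and le: "\<And>\<delta>::real. 0 < \<delta> \<Longrightarrow> y \<le> ennreal c * \<beta> (A + \<gamma> (ennreal \<delta>))"
  shows "y \<le> ennreal c * \<beta> A"
proof (rule ennreal_le_epsilon)
  fix e :: real assume e: "0 < e"
  have m: "subadditive_modulus (\<lambda>z. ennreal c * \<beta> (\<gamma> z))"
    by (rule modulus_cmult[OF modulus_comp[OF \<beta> \<gamma>]])
  obtain \<delta> :: real where d: "0 < \<delta>" "ennreal c * \<beta> (\<gamma> (ennreal \<delta>)) < ennreal e"
    using modulus_small[OF m, of "ennreal e"] e by auto
  have "y \<le> ennreal c * \<beta> (A + \<gamma> (ennreal \<delta>))" by (rule le[OF d(1)])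
  also have "\<dots> \<le> ennreal c * (\<beta> A + \<beta> (\<gamma> (ennreal \<delta>)))"
    by (intro mult_left_mono modulusD(2)[OF \<beta>]) auto
  also have "\<dots> \<le> ennreal c * \<beta> A + ennreal e"
    using d(2) by (simp add: distrib_left add_left_mono less_imp_le)
  finally show "y \<le> ennreal c * \<beta> A + ennreal e" .
qed

lemma ennreal_near_Inf:
  fixes S :: "ennreal set"
  assumes "S \<noteq> {}" "0 < (\<delta>::real)"
  shows "\<exists>s\<in>S. s \<le> Inf S + ennreal \<delta>"
proof (cases "Inf S = \<top>")
  case True
  obtain s where "s \<in> S" using assms(1) by blast
  moreover have "s \<le> Inf S + ennreal \<delta>" by (subst True) simp
  ultimately show ?thesis by blast
next
  case False
  then have "Inf S < Inf S + ennreal \<delta>"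
    using assms(2) by (cases "Inf S") (auto simp flip: ennreal_plus intro!: ennreal_lessI)
  then show ?thesis by (auto simp: Inf_less_iff intro: less_imp_le)
qed

text \<open>The superlevel sets of a monotone function are upwards closed, hence rays.\<close>

lemma borel_measurable_mono_ennreal:
  fixes f :: "ennreal \<Rightarrow> ennreal"
  assumes "\<And>a b. a \<le> b \<Longrightarrow> f a \<le> f b"
  shows "f \<in> borel_measurable borel"
proof (rule borel_measurableI_greater)
  fix y
  define U where "U = {x. y < f x}"
  have up: "b \<in> U" if "a \<in> U" "a \<le> b" for a b using assms[OF that(2)] that(1) by (auto simp: U_def)
  have "{Inf U<..} \<subseteq> U" using up by (auto simp: Inf_less_iff intro: less_imp_le)
  moreover have "U \<subseteq> {Inf U..}" by (auto intro: Inf_lower)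
  ultimately have "U = {Inf U<..} \<or> U = {Inf U..}" by (force simp: less_le)
  then have "U \<in> sets borel" by (metis greaterThan_borel atLeast_borel)
  then show "{x \<in> space borel. y < f x} \<in> sets borel" by (simp add: U_def)
qed

lemma modulus_measurable:
  assumes "subadditive_modulus \<beta>" shows "\<beta> \<in> borel_measurable borel"
  using modulusD(1)[OF assms] by (rule borel_measurable_mono_ennreal)

section \<open>Distances between laws\<close>

lemma lipschitz1_measurable:
  fixes h :: "'x::metric_space \<Rightarrow> real"
  shows "C-lipschitz_on UNIV h \<Longrightarrow> h \<in> borel_measurable borel"
  by (intro borel_measurable_continuous_onI lipschitz_on_continuous_on)

lemma prob_bounds:
  fixes f :: "'x::topological_space \<Rightarrow> real"
  assumes "\<mu> \<in> prob_measures" "f \<in> borel_measurable borel" "\<And>x. \<bar>f x\<bar> \<le> C"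
  shows "\<bar>\<integral>x. f x \<partial>\<mu>\<bar> \<le> C" "integrable \<mu> f"
  using integral_bounds[OF prob_measuresD(1,2)[OF assms(1)] assms(2)]
    bounded_integrable[OF prob_measuresD(1,2)[OF assms(1)] assms(2)] assms(3) by blast+

text \<open>The suprema that define the two distances are finite, since their test functions are bounded by 1.\<close>

lemma dist_SUP_ge:
  assumes \<mu>: "\<mu> \<in> prob_measures" and \<nu>: "\<nu> \<in> prob_measures"
    and H: "\<And>h. h \<in> H \<Longrightarrow> h \<in> borel_measurable borel \<and> range h \<subseteq> {-1..1::real}" and h: "h \<in> H"
  shows "1/2 * ((\<integral>x. h x \<partial>\<mu>) - (\<integral>x. h x \<partial>\<nu>)) \<le> (SUP h\<in>H. 1/2 * ((\<integral>x. h x \<partial>\<mu>) - (\<integral>x. h x \<partial>\<nu>)))"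
proof (rule cSUP_upper[OF h])
  have "1/2 * ((\<integral>x. h x \<partial>\<mu>) - (\<integral>x. h x \<partial>\<nu>)) \<le> 1" if "h \<in> H" for h
  proof -
    have "\<bar>h x\<bar> \<le> 1" for x using H[OF that] by (auto simp: image_subset_iff abs_le_iff minus_le_iff)
    then have "\<bar>\<integral>x. h x \<partial>\<mu>\<bar> \<le> 1" "\<bar>\<integral>x. h x \<partial>\<nu>\<bar> \<le> 1" using prob_bounds(1) H[OF that] \<mu> \<nu> by blast+
    then have "(\<integral>x. h x \<partial>\<mu>) - (\<integral>x. h x \<partial>\<nu>) \<le> 2" by linarith
    then show ?thesis by simp
  qed
  then show "bdd_above ((\<lambda>h. 1/2 * ((\<integral>x. h x \<partial>\<mu>) - (\<integral>x. h x \<partial>\<nu>))) ` H)" by (rule bdd_aboveI2)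
qed

lemma bl_dist_ge:
  assumes "\<mu> \<in> prob_measures" "\<nu> \<in> prob_measures" "1-lipschitz_on UNIV h" "\<And>x. \<bar>h x\<bar> \<le> 1"
  shows "1/2 * ((\<integral>x. h x \<partial>\<mu>) - (\<integral>x. h x \<partial>\<nu>)) \<le> bl_dist \<mu> \<nu>"
  unfolding bl_dist_def
  by (rule dist_SUP_ge) (use assms lipschitz1_measurable in \<open>auto simp: image_subset_iff abs_le_iff minus_le_iff\<close>)

lemma bl_dist_le:
  assumes "\<And>h. 1-lipschitz_on UNIV h \<Longrightarrow> (\<And>x. \<bar>h x\<bar> \<le> 1) \<Longrightarrow> h \<in> borel_measurable borel \<Longrightarrow>
    1/2 * ((\<integral>x. h x \<partial>\<mu>) - (\<integral>x. h x \<partial>\<nu>)) \<le> c"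
  shows "bl_dist \<mu> \<nu> \<le> c"
  unfolding bl_dist_def
proof (rule cSUP_least)
  have "(\<lambda>_. 0) \<in> {h :: 'a \<Rightarrow> real. 1-lipschitz_on UNIV h \<and> range h \<subseteq> {-1..1}}"
    by (auto simp: lipschitz_on_def)
  then show "{h :: 'a \<Rightarrow> real. 1-lipschitz_on UNIV h \<and> range h \<subseteq> {-1..1}} \<noteq> {}" by blast
next
  fix h :: "'a \<Rightarrow> real" assume "h \<in> {h. 1-lipschitz_on UNIV h \<and> range h \<subseteq> {-1..1}}"
  then show "1/2 * ((\<integral>x. h x \<partial>\<mu>) - (\<integral>x. h x \<partial>\<nu>)) \<le> c"
    by (intro assms lipschitz1_measurable) (auto simp: image_subset_iff abs_le_iff minus_le_iff)
qed

lemma bl_dist_nonneg: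
  assumes "\<mu> \<in> prob_measures" "\<nu> \<in> prob_measures" shows "0 \<le> bl_dist \<mu> \<nu>"
  using bl_dist_ge[OF assms, of "\<lambda>_. 0"] by (simp add: lipschitz_on_def)

lemma bl_dist_self: "\<mu> \<in> prob_measures \<Longrightarrow> bl_dist \<mu> \<mu> = 0"
  using bl_dist_le[of \<mu> \<mu> 0] bl_dist_nonneg[of \<mu> \<mu>] by simp

lemma bl_dist_triangle:
  assumes "\<mu> \<in> prob_measures" "\<nu> \<in> prob_measures" "\<xi> \<in> prob_measures"
  shows "bl_dist \<mu> \<xi> \<le> bl_dist \<mu> \<nu> + bl_dist \<nu> \<xi>"
proof (rule bl_dist_le)
  fix h :: "'a \<Rightarrow> real" assume h: "1-lipschitz_on UNIV h" "\<And>x. \<bar>h x\<bar> \<le> 1"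
  from bl_dist_ge[OF assms(1,2) h] bl_dist_ge[OF assms(2,3) h]
  show "1/2 * ((\<integral>x. h x \<partial>\<mu>) - (\<integral>x. h x \<partial>\<xi>)) \<le> bl_dist \<mu> \<nu> + bl_dist \<nu> \<xi>" by (simp add: field_simps)
qed

lemma tv_dist_ge:
  assumes "\<mu> \<in> prob_measures" "\<nu> \<in> prob_measures" "h \<in> borel_measurable borel" "\<And>x. \<bar>h x\<bar> \<le> 1"
  shows "(\<integral>x. h x \<partial>\<mu>) - (\<integral>x. h x \<partial>\<nu>) \<le> 2 * tv_dist \<mu> \<nu>"
proof -
  have "1/2 * ((\<integral>x. h x \<partial>\<mu>) - (\<integral>x. h x \<partial>\<nu>)) \<le> tv_dist \<mu> \<nu>"
    unfolding tv_dist_def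
    by (rule dist_SUP_ge) (use assms in \<open>auto simp: image_subset_iff abs_le_iff minus_le_iff\<close>)
  then show ?thesis by simp
qed

text \<open>The largest \<open>L\<close>-Lipschitz minorant \<open>g\<close> of \<open>f\<close> lies within \<open>2 * \<omega>\<close> of \<open>f\<close>, and \<open>g / L\<close> is a
  bounded Lipschitz test function. As \<open>g \<le> f\<close>, only the integral against \<open>\<mu>\<close> pays for the replacement.\<close>

lemma bl_dist_modulus:
  fixes f :: "'a::metric_space \<Rightarrow> real"
  assumes \<mu>: "\<mu> \<in> prob_measures" and \<nu>: "\<nu> \<in> prob_measures"
    and f: "f \<in> borel_measurable borel" "\<And>a. \<bar>f a\<bar> \<le> 1" and L: "1 < L"
    and \<omega>: "\<And>a b. dist a b \<le> 2 / L \<Longrightarrow> f a - f b \<le> 2 * \<omega>" and \<omega>0: "0 \<le> \<omega>"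
  shows "(\<integral>a. f a \<partial>\<mu>) - (\<integral>a. f a \<partial>\<nu>) \<le> 2 * (L * bl_dist \<mu> \<nu> + \<omega>)"
proof -
  define g where "g a = (INF b. f b + L * dist a b)" for a
  have low: "-1 \<le> f b + L * dist a b" for a b
    using f(2)[of b] L by (smt (verit) mult_nonneg_nonneg zero_le_dist)
  have bdd: "bdd_below (range (\<lambda>b. f b + L * dist a b))" for a
    by (rule bdd_belowI2[of _ "-1"]) (use low in auto)
  have gf: "g a \<le> f a" for a
    using cINF_lower[OF bdd, of a a] by (simp add: g_def)
  have g1: "\<bar>g a\<bar> \<le> 1" for a
  proof -
    have "-1 \<le> g a" unfolding g_def by (rule cINF_greatest) (use low in auto)
    then show ?thesis using gf[of a] f(2)[of a] by linarith
  qed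
  have fg: "f a - 2 * \<omega> \<le> g a" for a
    unfolding g_def
  proof (rule cINF_greatest)
    fix b
    show "f a - 2 * \<omega> \<le> f b + L * dist a b"
    proof (cases "dist a b \<le> 2 / L")
      case True
      then show ?thesis using \<omega>[OF True] L by (smt (verit) mult_nonneg_nonneg zero_le_dist)
    next
      case False
      \<comment> \<open>Beyond the distance \<open>2 / L\<close> the slope term exceeds the oscillation of \<open>f\<close>.\<close>
      then have "2 \<le> L * dist a b" using L by (simp add: field_simps)
      then show ?thesis using f(2)[of a] f(2)[of b] \<omega>0 by linarith
    qed
  qed simp
  have gl: "g a - g a' \<le> L * dist a a'" for a a'
  proof -
    have "g a - L * dist a a' \<le> g a'"
      unfolding g_def[of a']
    proof (rule cINF_greatest)
      fix b
      have "g a \<le> f b + L * dist a b" unfolding g_def by (rule cINF_lower[OF bdd]) simp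
      also have "\<dots> \<le> f b + L * (dist a a' + dist a' b)"
        using L by (intro add_left_mono mult_left_mono dist_triangle) auto
      finally show "g a - L * dist a a' \<le> f b + L * dist a' b" by (simp add: algebra_simps)
    qed simp
    then show ?thesis by simp
  qed
  have lip: "1-lipschitz_on UNIV (\<lambda>a. g a / L)"
  proof (rule lipschitz_onI)
    fix x y
    have "\<bar>g x - g y\<bar> \<le> L * dist x y" using gl[of x y] gl[of y x] by (simp add: dist_commute abs_le_iff)
    moreover have "\<bar>g x / L - g y / L\<bar> = \<bar>g x - g y\<bar> / L" using L by (simp add: diff_divide_distrib[symmetric])
    ultimately show "dist (g x / L) (g y / L) \<le> 1 * dist x y" using L by (simp add: dist_real_def field_simps)
  qed simp
  have gm: "g \<in> borel_measurable borel"
    using borel_measurable_times[OF borel_measurable_const[of L] lipschitz1_measurable[OF lip]] L by simp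
  have "\<bar>g a / L\<bar> \<le> 1" for a using g1[of a] L by (simp add: field_simps)
  from bl_dist_ge[OF \<mu> \<nu> lip this]
  have 1: "(\<integral>a. g a \<partial>\<mu>) - (\<integral>a. g a \<partial>\<nu>) \<le> 2 * (L * bl_dist \<mu> \<nu>)"
    using L by (simp add: field_simps)
  note i = prob_bounds(2)[OF \<mu>] prob_bounds(2)[OF \<nu>]
  interpret \<mu>: prob_space \<mu> by (rule prob_measuresD[OF \<mu>])
  note fi = i(1)[OF f] i(2)[OF f] and ig = i(1)[OF gm g1] i(2)[OF gm g1]
  have "(\<integral>a. f a \<partial>\<mu>) \<le> (\<integral>a. g a + 2 * \<omega> \<partial>\<mu>)"
    by (rule integral_mono) (use fg fi ig in \<open>auto simp: algebra_simps\<close>)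
  also have "\<dots> = (\<integral>a. g a \<partial>\<mu>) + 2 * \<omega>"
    using ig by (simp add: \<mu>.prob_space)
  finally have 2: "(\<integral>a. f a \<partial>\<mu>) \<le> (\<integral>a. g a \<partial>\<mu>) + 2 * \<omega>" .
  have "(\<integral>a. g a \<partial>\<nu>) \<le> (\<integral>a. f a \<partial>\<nu>)"
    by (rule integral_mono) (use gf fi ig in auto)
  with 1 2 show ?thesis by simp
qed

section \<open>The controlled Markov chain of the players\<close>

lemma bounded_borelD:
  assumes "f \<in> bounded_borel S"
  shows "f \<in> borel_measurable S" "\<And>x. x \<in> space S \<Longrightarrow> \<bar>f x\<bar> \<le> sup_norm S f"
proof -
  show "f \<in> borel_measurable S" using assms by (simp add: bounded_borel_def)
  obtain C where C: "\<And>x. x \<in> space S \<Longrightarrow> \<bar>f x\<bar> \<le> C" using assms by (auto simp: bounded_borel_def)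
  show "\<bar>f x\<bar> \<le> sup_norm S f" if "x \<in> space S" for x
    unfolding sup_norm_def by (rule cSUP_upper[OF that]) (use C in \<open>auto intro!: bdd_aboveI2\<close>)
qed

lemma bounded_borelI:
  "f \<in> borel_measurable S \<Longrightarrow> (\<And>x. x \<in> space S \<Longrightarrow> \<bar>f x\<bar> \<le> C) \<Longrightarrow> f \<in> bounded_borel S"
  by (auto simp: bounded_borel_def)

lemma sup_norm_le:
  assumes "\<And>x. x \<in> space S \<Longrightarrow> \<bar>f x\<bar> \<le> C" "space S \<noteq> {}" shows "sup_norm S f \<le> C"
  unfolding sup_norm_def by (rule cSUP_least) (use assms in auto)

lemma bounded_borel_diff:
  assumes f: "f \<in> bounded_borel S" and g: "g \<in> bounded_borel S"
  shows "(\<lambda>x. f x - g x) \<in> bounded_borel S"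
proof (rule bounded_borelI[where C = "sup_norm S f + sup_norm S g"])
  show "(\<lambda>x. f x - g x) \<in> borel_measurable S" using f g by (intro borel_measurable_diff bounded_borelD(1))
  show "\<bar>f x - g x\<bar> \<le> sup_norm S f + sup_norm S g" if "x \<in> space S" for x
    using bounded_borelD(2)[OF f that] bounded_borelD(2)[OF g that] by linarith
qed

lemma bounded_borel_integrable:
  assumes "f \<in> bounded_borel S" "\<mu> \<in> space (prob_algebra S)"
  shows "integrable \<mu> f"
  using bounded_integrable[OF prob_algebraD(1,2)[OF assms(2)]] bounded_borelD[OF assms(1)] by blast

lemma bounded_borel_kernel:
  assumes f: "f \<in> bounded_borel R" and K: "K \<in> S \<rightarrow>\<^sub>M prob_algebra R"
  shows "(\<lambda>x. \<integral>y. f y \<partial>K x) \<in> bounded_borel S"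
proof (rule bounded_borelI[where C = "sup_norm R f"])
  show "(\<lambda>x. \<integral>y. f y \<partial>K x) \<in> borel_measurable S"
    by (rule measurable_integral_kernel[OF K bounded_borelD(1)[OF f]])
  show "\<bar>\<integral>y. f y \<partial>K x\<bar> \<le> sup_norm R f" if "x \<in> space S" for x
    by (rule integral_bounds[OF kernelD(1,2)[OF K that] bounded_borelD[OF f]])
qed

text \<open>The law of the joint state of all players at time \<open>t \<ge> 1\<close>. Time starts at 1; the value at 0 only makes the
  recursion total.\<close>

fun state_law ::
  "('x::polish_space, 'a::polish_space) game \<Rightarrow> (nat \<Rightarrow> nat \<Rightarrow> ('x, 'a) policy) \<Rightarrow> nat \<Rightarrow> (nat \<Rightarrow> 'x) measure" where
  "state_law M \<PP> 0 = init_tuple_law M"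
| "state_law M \<PP> (Suc t) = (if t = 0 then init_tuple_law M
     else state_law M \<PP> t \<bind> (\<lambda>x. next_law M t (\<lambda>n. \<PP> n t x) x))"

locale game_model =
  fixes M :: "('x::polish_space, 'a::polish_space) game"
  assumes wf: "game_wf M"
begin

abbreviation "N \<equiv> players M"
abbreviation "T \<equiv> horizon M"
abbreviation "ST \<equiv> state_tuples M"

lemma N1: "1 \<le> N" and T2: "2 \<le> T" and init_law: "init_law M \<in> prob_measures"
  using wf by (auto simp: game_wf_def)

lemma component_measurable: "n \<in> {1..N} \<Longrightarrow> (\<lambda>x. x n) \<in> ST \<rightarrow>\<^sub>M borel"
  by (simp add: state_tuples_def)

lemma empirical_prob: "empirical M x \<in> prob_measures"
proof -
  have "prob_space (uniform_count_measure {1..N})"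
    using N1 by (intro prob_space_uniform_count_measure) auto
  moreover have "x \<in> uniform_count_measure {1..N} \<rightarrow>\<^sub>M borel" by simp
  ultimately show ?thesis
    unfolding empirical_def prob_measures_def by (auto intro: prob_space.prob_space_distr)
qed

lemma integral_empirical:
  fixes f :: "'x \<Rightarrow> real"
  assumes "f \<in> borel_measurable borel"
  shows "(\<integral>y. f y \<partial>empirical M x) = (\<Sum>n=1..N. f (x n)) / N"
proof -
  have "(\<integral>y. f y \<partial>empirical M x) = (\<integral>n. f (x n) \<partial>uniform_count_measure {1..N})"
    unfolding empirical_def by (rule integral_distr) (use assms in auto)
  also have "\<dots> = (\<Sum>n=1..N. f (x n)) / N"
    by (subst integral_uniform_count_measure) auto
  finally show ?thesis .
qed

lemma continuous_on_average:
  fixes f :: "'x \<Rightarrow> real"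
  assumes "continuous_on UNIV f"
  shows "continuous_on UNIV (\<lambda>x. (\<Sum>n=1..N. f (x n)) / N)"
proof (intro continuous_on_divide continuous_on_sum)
  fix n show "continuous_on UNIV (\<lambda>x. f (x n))"
    by (rule continuous_on_compose2[OF assms continuous_on_product_coordinates]) auto
qed (use N1 in auto)

text \<open>The integral of a continuous function against the empirical measure is an average of continuous functions
  of the coordinates, so the empirical measure depends continuously on the tuple.\<close>

lemma empirical_measurable: "empirical M \<in> ST \<rightarrow>\<^sub>M borel_prob"
  unfolding borel_prob_def
proof (rule measurable_measure_of)
  show "{W. openin weak_topology W} \<subseteq> Pow (prob_measures :: 'x measure set)"
    using openin_subset topspace_weak_topology by blast
  show "empirical M \<in> space ST \<rightarrow> prob_measures" using empirical_prob by auto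
  have "continuous_map euclidean weak_topology (empirical M)"
    unfolding weak_topology_def
  proof (rule continuous_on_generated_topo)
    fix U :: "'x measure set"
    assume "U \<in> {{\<mu> \<in> prob_measures. (\<integral>x. f x \<partial>\<mu>) \<in> W} | (f :: 'x \<Rightarrow> real) W.
        continuous_on UNIV f \<and> bounded (range f) \<and> open W}"
    then obtain f :: "'x \<Rightarrow> real" and W where U: "U = {\<mu> \<in> prob_measures. (\<integral>x. f x \<partial>\<mu>) \<in> W}"
      and f: "continuous_on UNIV f" and W: "open W" by blast
    have "empirical M -` U = (\<lambda>x. (\<Sum>n=1..N. f (x n)) / N) -` W"
      using integral_empirical[OF borel_measurable_continuous_onI[OF f]] empirical_prob by (auto simp: U)
    then show "openin euclidean (empirical M -` U \<inter> topspace euclidean)"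
      using open_vimage[OF W continuous_on_average[OF f]] by simp
  next
    have "openin weak_topology (topspace weak_topology :: 'x measure set)" by (rule openin_topspace)
    then have "topspace (weak_topology :: 'x measure topology) = prob_measures" by (simp add: topspace_weak_topology)
    then show "empirical M ` topspace euclidean \<subseteq> \<Union> {{\<mu> \<in> prob_measures. (\<integral>x. f x \<partial>\<mu>) \<in> W} | (f :: 'x \<Rightarrow> real) W.
        continuous_on UNIV f \<and> bounded (range f) \<and> open W}"
      unfolding weak_topology_def topology_generated_by_topspace using empirical_prob by auto
  qed
  then have *: "openin euclidean (empirical M -` W)" if "openin weak_topology W" for W
    using openin_continuous_map_preimage[OF _ that, of euclidean "empirical M"] by (simp add: vimage_def)
  fix W assume "W \<in> {W. openin (weak_topology :: 'x measure topology) W}"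
  then have op: "open (empirical M -` W)" using * by simp
  from measurable_sets[OF PiM_to_borel[of "{1..N}"] borel_open[OF op]]
  show "empirical M -` W \<inter> space ST \<in> sets ST" by (simp add: state_tuples_def)
qed

text \<open>The distance is continuous in the tuple: displacing the points moves the empirical measure by at most the
  average displacement.\<close>

lemma bl_empirical_measurable:
  assumes xi: "\<xi> \<in> prob_measures"
  shows "(\<lambda>x. bl_dist (empirical M x) \<xi>) \<in> borel_measurable ST"
proof -
  let ?d = "\<lambda>x y :: nat \<Rightarrow> 'x. (\<Sum>n=1..N. dist (x n) (y n)) / N"
  have le: "bl_dist (empirical M x) (empirical M y) \<le> ?d x y" for x y
  proof (rule bl_dist_le)
    fix h :: "'x \<Rightarrow> real"
    assume h: "1-lipschitz_on UNIV h" and hm: "h \<in> borel_measurable borel"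
    have "(\<Sum>n=1..N. h (x n)) - (\<Sum>n=1..N. h (y n)) \<le> (\<Sum>n=1..N. dist (x n) (y n))"
      unfolding sum_subtractf[symmetric]
    proof (rule sum_mono)
      fix n show "h (x n) - h (y n) \<le> dist (x n) (y n)"
        using lipschitz_onD[OF h, of "x n" "y n"] by (simp add: dist_real_def)
    qed
    then have "(\<integral>z. h z \<partial>empirical M x) - (\<integral>z. h z \<partial>empirical M y) \<le> ?d x y"
      unfolding integral_empirical[OF hm] by (simp add: diff_divide_distrib[symmetric] divide_right_mono)
    moreover have "0 \<le> ?d x y" by (intro divide_nonneg_nonneg sum_nonneg) auto
    moreover have "1/2 * a \<le> b" if "a \<le> b" "0 \<le> b" for a b :: real using that by simp
    ultimately show "1/2 * ((\<integral>z. h z \<partial>empirical M x) - (\<integral>z. h z \<partial>empirical M y)) \<le> ?d x y" by blast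
  qed
  have diff: "\<bar>bl_dist (empirical M x) \<xi> - bl_dist (empirical M y) \<xi>\<bar> \<le> ?d x y" for x y
    using bl_dist_triangle[of "empirical M x" "empirical M y" \<xi>] bl_dist_triangle[of "empirical M y" "empirical M x" \<xi>]
      le[of x y] le[of y x] empirical_prob xi by (auto simp: dist_commute)
  have "continuous_on UNIV (\<lambda>x. bl_dist (empirical M x) \<xi>)"
    unfolding continuous_on_def
  proof (intro ballI)
    fix y
    have "((\<lambda>x. ?d x y) \<longlongrightarrow> ?d y y) (at y)"
    proof -
      have "continuous_on UNIV (\<lambda>x. ?d x y)"
        by (intro continuous_on_divide continuous_on_sum continuous_on_dist continuous_on_product_coordinates) (use N1 in auto)
      then show ?thesis unfolding continuous_on_def by blast
    qed
    then have "((\<lambda>x. ?d x y) \<longlongrightarrow> 0) (at y)" by simp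
    then have "((\<lambda>x. bl_dist (empirical M x) \<xi> - bl_dist (empirical M y) \<xi>) \<longlongrightarrow> 0) (at y)"
      by (rule Lim_null_comparison[rotated]) (use diff in auto)
    then show "((\<lambda>x. bl_dist (empirical M x) \<xi>) \<longlongrightarrow> bl_dist (empirical M y) \<xi>) (at y)"
      by (simp add: Lim_null[symmetric])
  qed
  from measurable_compose[OF PiM_to_borel borel_measurable_continuous_onI[OF this]]
  show ?thesis by (simp add: state_tuples_def)
qed

lemma mixed_kernel_measurable:
  assumes t: "t \<in> {1..<T}" and f: "f \<in> S \<rightarrow>\<^sub>M borel" and g: "g \<in> S \<rightarrow>\<^sub>M borel_prob" and h: "h \<in> S \<rightarrow>\<^sub>M borel_prob"
  shows "(\<lambda>z. mixed_kernel M t (f z) (g z) (h z)) \<in> S \<rightarrow>\<^sub>M prob_algebra borel"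
  unfolding mixed_kernel_def
proof (rule measurable_bind_prob_space2[OF borel_prob_kernel[OF h]])
  have P: "(\<lambda>(x, \<xi>, a). trans_kernel M t x \<xi> a) \<in> borel \<Otimes>\<^sub>M borel_prob \<Otimes>\<^sub>M borel \<rightarrow>\<^sub>M borel_prob"
    using wf t by (simp add: game_wf_def)
  have "(\<lambda>(z, a). (f z, g z, a)) \<in> S \<Otimes>\<^sub>M borel \<rightarrow>\<^sub>M borel \<Otimes>\<^sub>M borel_prob \<Otimes>\<^sub>M borel"
    using f g by measurable
  from measurable_compose[OF this P]
  show "(\<lambda>(z, a). trans_kernel M t (f z) (g z) a) \<in> S \<Otimes>\<^sub>M borel \<rightarrow>\<^sub>M prob_algebra borel"
    by (intro borel_prob_kernel) (simp add: case_prod_beta)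
qed

lemma trans_kernel_measurable:
  assumes t: "t \<in> {1..<T}" and xi: "\<xi> \<in> prob_measures"
  shows "(\<lambda>a. trans_kernel M t x \<xi> a) \<in> borel \<rightarrow>\<^sub>M prob_algebra borel"
proof -
  have P: "(\<lambda>(x, \<xi>, a). trans_kernel M t x \<xi> a) \<in> borel \<Otimes>\<^sub>M borel_prob \<Otimes>\<^sub>M borel \<rightarrow>\<^sub>M borel_prob"
    using wf t by (simp add: game_wf_def)
  have "(\<lambda>a. (x, \<xi>, a)) \<in> borel \<rightarrow>\<^sub>M borel \<Otimes>\<^sub>M borel_prob \<Otimes>\<^sub>M borel"
    using xi by (intro measurable_Pair measurable_const) (auto simp: space_borel_prob)
  from measurable_compose[OF this P] show ?thesis by (intro borel_prob_kernel) simp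
qed

lemma mixed_kernel_prob:
  assumes "t \<in> {1..<T}" "\<xi> \<in> prob_measures" "l \<in> prob_measures"
  shows "mixed_kernel M t x \<xi> l \<in> prob_measures"
  using measurable_space[OF mixed_kernel_measurable[OF assms(1), of "\<lambda>_. x" "count_space UNIV" "\<lambda>_. \<xi>" "\<lambda>_. l"], of undefined]
    assms by (simp add: prob_measures_eq space_borel_prob)

lemma integral_mixed_kernel:
  fixes f :: "'x \<Rightarrow> real"
  assumes "t \<in> {1..<T}" "\<xi> \<in> prob_measures" "l \<in> prob_measures" "f \<in> borel_measurable borel" "\<And>y. \<bar>f y\<bar> \<le> C"
  shows "(\<integral>y. f y \<partial>mixed_kernel M t x \<xi> l) = (\<integral>a. (\<integral>y. f y \<partial>trans_kernel M t x \<xi> a) \<partial>l)"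
  unfolding mixed_kernel_def
  by (rule integral_bind_kernel[OF _ trans_kernel_measurable]) (use assms in \<open>auto simp: prob_measures_eq\<close>)

lemma next_law_cong: "(\<And>n. n \<in> {1..N} \<Longrightarrow> l n = l' n) \<Longrightarrow> next_law M t l x = next_law M t l' x"
  unfolding next_law_def by (rule PiM_cong) auto

lemma next_law_measurable:
  assumes t: "t \<in> {1..<T}" and p: "\<And>n. n \<in> {1..N} \<Longrightarrow> p n \<in> policies M"
  shows "(\<lambda>x. next_law M t (\<lambda>n. p n x) x) \<in> ST \<rightarrow>\<^sub>M prob_algebra ST"
proof -
  have "(\<lambda>x. Pi\<^sub>M {1..N} (\<lambda>n. mixed_kernel M t (x n) (empirical M x) (p n x)))
    \<in> ST \<rightarrow>\<^sub>M prob_algebra (Pi\<^sub>M {1..N} (\<lambda>_. borel))"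
  proof (rule measurable_PiM_kernel)
    fix n assume n: "n \<in> {1..N}"
    show "(\<lambda>x. mixed_kernel M t (x n) (empirical M x) (p n x)) \<in> ST \<rightarrow>\<^sub>M prob_algebra borel"
      by (rule mixed_kernel_measurable[OF t component_measurable[OF n] empirical_measurable])
         (use p[OF n] in \<open>simp add: policies_def\<close>)
  qed simp
  then show ?thesis by (simp add: next_law_def state_tuples_def)
qed

lemma profile_kernel:
  assumes "t \<in> {1..<T}" "\<PP> \<in> profiles M"
  shows "(\<lambda>x. next_law M t (\<lambda>n. \<PP> n t x) x) \<in> ST \<rightarrow>\<^sub>M prob_algebra ST"
  by (rule next_law_measurable) (use assms in \<open>auto simp: profiles_def\<close>)

lemma init_tuple_law: "init_tuple_law M \<in> space (prob_algebra ST)"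
  unfolding init_tuple_law_def state_tuples_def
  by (rule PiM_in_prob_algebra(1)) (use init_law in \<open>auto simp: prob_measures_eq\<close>)

lemma state_law_prob:
  assumes \<PP>: "\<PP> \<in> profiles M"
  shows "t \<le> T \<Longrightarrow> state_law M \<PP> t \<in> space (prob_algebra ST)"
proof (induction t)
  case (Suc t)
  show ?case
  proof (cases "t = 0")
    case False
    then have "t \<in> {1..<T}" using Suc.prems by auto
    from bind_in_prob_algebra[OF _ profile_kernel[OF this \<PP>]] Suc False show ?thesis by simp
  qed (simp add: init_tuple_law)
qed (simp add: init_tuple_law)

lemma trans_step_bounded:
  assumes "t \<in> {1..<T}" "\<PP> \<in> profiles M" "f \<in> bounded_borel ST"
  shows "trans_step M \<PP> t f \<in> bounded_borel ST"
  using bounded_borel_kernel[OF assms(3) profile_kernel[OF assms(1,2)]] by (simp add: trans_step_def[abs_def])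

lemma integral_state_law_Suc:
  assumes t: "t \<in> {1..<T}" and \<PP>: "\<PP> \<in> profiles M" and f: "f \<in> bounded_borel ST"
  shows "(\<integral>x. f x \<partial>state_law M \<PP> (Suc t)) = (\<integral>x. trans_step M \<PP> t f x \<partial>state_law M \<PP> t)"
proof -
  have "state_law M \<PP> t \<in> space (prob_algebra ST)" using t by (intro state_law_prob[OF \<PP>]) simp
  from integral_bind_kernel[OF this profile_kernel[OF t \<PP>] bounded_borelD[OF f]] t
  show ?thesis by (simp add: trans_step_def)
qed

lemma nn_integral_state_law_Suc:
  assumes t: "t \<in> {1..<T}" and \<PP>: "\<PP> \<in> profiles M" and f: "f \<in> borel_measurable ST"
  shows "(\<integral>\<^sup>+x. f x \<partial>state_law M \<PP> (Suc t)) = (\<integral>\<^sup>+x. (\<integral>\<^sup>+y. f y \<partial>next_law M t (\<lambda>n. \<PP> n t x) x) \<partial>state_law M \<PP> t)"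
proof -
  have "state_law M \<PP> t \<in> space (prob_algebra ST)" using t by (intro state_law_prob[OF \<PP>]) simp
  from nn_integral_bind_kernel[OF this profile_kernel[OF t \<PP>] f] t
  show ?thesis by simp
qed

text \<open>The operators compose the transition kernels backwards, the laws compose them forwards.\<close>

lemma trans_op_state_law:
  assumes \<PP>: "\<PP> \<in> profiles M"
  shows "t \<in> {1..T} \<Longrightarrow> f \<in> bounded_borel ST \<Longrightarrow> trans_op M \<PP> t f = (\<integral>x. f x \<partial>state_law M \<PP> t)"
proof (induction t arbitrary: f)
  case (Suc t)
  show ?case
  proof (cases "t = 0")
    case False
    then have t: "t \<in> {1..<T}" using Suc.prems by auto
    have "trans_op M \<PP> (Suc t) f = trans_op M \<PP> t (trans_step M \<PP> t f)"
      using t by (simp add: trans_op_def)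
    also have "\<dots> = (\<integral>x. trans_step M \<PP> t f x \<partial>state_law M \<PP> t)"
      using t Suc.prems by (intro Suc.IH trans_step_bounded[OF t \<PP>]) auto
    also have "\<dots> = (\<integral>x. f x \<partial>state_law M \<PP> (Suc t))"
      using integral_state_law_Suc[OF t \<PP> Suc.prems(2)] by simp
    finally show ?thesis .
  qed (simp add: trans_op_def)
qed simp

end

section \<open>Separability of the laws on a compact space\<close>

text \<open>On each piece a Lipschitz function is nearly constant, so its integral is nearly determined by the masses of
  the pieces.\<close>

lemma bl_dist_partition:
  fixes \<mu> \<nu> :: "'a::metric_space measure" and m :: nat
  assumes \<mu>: "\<mu> \<in> prob_measures" and \<nu>: "\<nu> \<in> prob_measures"
    and B: "\<And>k. k < m \<Longrightarrow> B k \<in> sets borel" and part: "\<And>a. \<exists>!k. k < m \<and> a \<in> B k"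
    and s: "\<And>k a. k < m \<Longrightarrow> a \<in> B k \<Longrightarrow> dist a (s k) \<le> e"
    and close: "\<And>k. k < m \<Longrightarrow> \<bar>measure \<mu> (B k) - measure \<nu> (B k)\<bar> \<le> e / m"
    and e: "0 \<le> e"
  shows "bl_dist \<mu> \<nu> \<le> 2 * e"
proof (rule bl_dist_le)
  fix h :: "'a \<Rightarrow> real"
  assume h: "1-lipschitz_on UNIV h" "\<And>x. \<bar>h x\<bar> \<le> 1" and hm: "h \<in> borel_measurable borel"
  define g where "g a = (\<Sum>k<m. h (s k) * indicator (B k) a)" for a
  have gval: "g a = h (s k)" if "k < m" "a \<in> B k" for a k
  proof -
    have "g a = (\<Sum>j<m. if j = k then h (s k) else 0)"
      unfolding g_def by (rule sum.cong) (use part[of a] that in \<open>auto simp: indicator_def\<close>)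
    also have "\<dots> = h (s k)" using that by (subst sum.delta) auto
    finally show ?thesis .
  qed
  have close_g: "\<bar>h a - g a\<bar> \<le> e" for a
  proof -
    obtain k where k: "k < m" "a \<in> B k" using part[of a] by blast
    have "\<bar>h a - h (s k)\<bar> \<le> dist a (s k)" using lipschitz_onD[OF h(1), of a "s k"] by (simp add: dist_real_def)
    then show ?thesis using gval[OF k] s[OF k] by simp
  qed
  have gm: "g \<in> borel_measurable borel" unfolding g_def using B by (intro borel_measurable_sum) auto
  have g1: "\<bar>g a\<bar> \<le> 1 + e" for a using close_g[of a] h(2)[of a] by linarith
  have diff: "\<bar>(\<integral>a. h a \<partial>\<kappa>) - (\<integral>a. g a \<partial>\<kappa>)\<bar> \<le> e"
    and int: "(\<integral>a. g a \<partial>\<kappa>) = (\<Sum>k<m. h (s k) * measure \<kappa> (B k))" if \<kappa>: "\<kappa> \<in> prob_measures" for \<kappa>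
  proof -
    note i = prob_bounds(2)[OF \<kappa> hm h(2)] prob_bounds(2)[OF \<kappa> gm g1]
    have "\<bar>\<integral>a. h a - g a \<partial>\<kappa>\<bar> \<le> e" by (rule prob_bounds(1)[OF \<kappa>]) (use hm gm close_g in auto)
    then show "\<bar>(\<integral>a. h a \<partial>\<kappa>) - (\<integral>a. g a \<partial>\<kappa>)\<bar> \<le> e" using i by simp
    interpret prob_space \<kappa> by (rule prob_measuresD[OF \<kappa>])
    have st[simp]: "sets \<kappa> = sets borel" "space \<kappa> = UNIV" using prob_measuresD[OF \<kappa>] by auto
    show "(\<integral>a. g a \<partial>\<kappa>) = (\<Sum>k<m. h (s k) * measure \<kappa> (B k))"
      unfolding g_def
      by (subst Bochner_Integration.integral_sum)
         (use B in \<open>auto simp: emeasure_eq_measure intro!: integrable_mult_right\<close>)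
  qed
  have "(\<integral>a. g a \<partial>\<mu>) - (\<integral>a. g a \<partial>\<nu>) = (\<Sum>k<m. h (s k) * (measure \<mu> (B k) - measure \<nu> (B k)))"
    by (simp add: int[OF \<mu>] int[OF \<nu>] sum_subtractf right_diff_distrib)
  also have "\<dots> \<le> (\<Sum>k<m. e / m)"
  proof (rule sum_mono)
    fix k assume "k \<in> {..<m}"
    then have "\<bar>h (s k) * (measure \<mu> (B k) - measure \<nu> (B k))\<bar> \<le> 1 * (e / m)"
      unfolding abs_mult by (intro mult_mono h(2) close) auto
    then show "h (s k) * (measure \<mu> (B k) - measure \<nu> (B k)) \<le> e / m" by simp
  qed
  also have "\<dots> \<le> e" using e by simp
  finally have "(\<integral>a. g a \<partial>\<mu>) - (\<integral>a. g a \<partial>\<nu>) \<le> e" .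
  then have "(\<integral>a. h a \<partial>\<mu>) - (\<integral>a. h a \<partial>\<nu>) \<le> 3 * e" using diff[OF \<mu>] diff[OF \<nu>] by linarith
  then show "1/2 * ((\<integral>a. h a \<partial>\<mu>) - (\<integral>a. h a \<partial>\<nu>)) \<le> 2 * e" using e by simp
qed

text \<open>Compactness gives a finite partition into small pieces. Rounding the masses of the pieces sorts the laws
  into countably many cells of small diameter, and a representative of each cell is kept.\<close>

lemma bl_separable:
  assumes "compact (UNIV :: 'a::metric_space set)"
  obtains d :: "nat \<Rightarrow> 'a::metric_space measure"
  where "\<And>i. d i \<in> prob_measures" "\<And>l e. l \<in> prob_measures \<Longrightarrow> 0 < e \<Longrightarrow> \<exists>i. bl_dist l (d i) < e"
proof -
  have ex: "\<exists>\<Phi> :: 'a measure \<Rightarrow> nat list. \<forall>\<mu>\<in>prob_measures. \<forall>\<nu>\<in>prob_measures. \<Phi> \<mu> = \<Phi> \<nu> \<longrightarrow> bl_dist \<mu> \<nu> \<le> 2 * e"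
    if e: "0 < e" for e :: real
  proof -
    obtain C where "C \<subseteq> (UNIV :: 'a set)" and C: "finite C" "UNIV \<subseteq> (\<Union>c\<in>C. ball c e)"
      by (rule compactE_image[OF assms, of "UNIV :: 'a set" "\<lambda>c. ball c e"]) (use e in auto)
    obtain s and m where s: "C = s ` {..<m::nat}" using C(1) unfolding finite_conv_nat_seg_image lessThan_def by blast
    define B where "B k = ball (s k) e - (\<Union>j<k. ball (s j) e)" for k
    have Bm: "B k \<in> sets borel" for k unfolding B_def by (intro sets.Diff borel_open open_UN) auto
    have part: "\<exists>!k. k < m \<and> a \<in> B k" for a
    proof -
      have "a \<in> (\<Union>c\<in>C. ball c e)" using C(2) by blast
      then obtain i where i: "i < m" "a \<in> ball (s i) e" by (auto simp: s)
      define k where "k = (LEAST k. a \<in> ball (s k) e)"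
      have k: "a \<in> ball (s k) e" unfolding k_def by (rule LeastI[of "\<lambda>k. a \<in> ball (s k) e"]) (rule i(2))
      have "k \<le> i" unfolding k_def by (rule Least_le) (rule i(2))
      then have km: "k < m" using i(1) by simp
      have k_min: "a \<notin> ball (s j) e" if "j < k" for j using not_less_Least[OF that[unfolded k_def]] .
      note k = k k_min km
      show ?thesis
      proof (rule ex1I[of _ k])
        show "k < m \<and> a \<in> B k" using k by (auto simp: B_def)
        fix j assume "j < m \<and> a \<in> B j"
        then show "j = k" using k by (cases j k rule: linorder_cases) (auto simp: B_def)
      qed
    qed
    define \<Phi> where "\<Phi> \<mu> = map (\<lambda>k. nat \<lfloor>measure \<mu> (B k) * (m / e)\<rfloor>) [0..<m]" for \<mu> :: "'a measure"
    have "bl_dist \<mu> \<nu> \<le> 2 * e" if "\<mu> \<in> prob_measures" "\<nu> \<in> prob_measures" "\<Phi> \<mu> = \<Phi> \<nu>" for \<mu> \<nu>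
    proof (rule bl_dist_partition[of _ _ m B s])
      fix k assume k: "k < m"
      define x y where "x = measure \<mu> (B k) * (m / e)" and "y = measure \<nu> (B k) * (m / e)"
      have me: "0 < m / e" using k e by simp
      have "nat \<lfloor>x\<rfloor> = nat \<lfloor>y\<rfloor>" using that(3) k by (auto simp: \<Phi>_def x_def y_def)
      moreover have "0 \<le> x" "0 \<le> y"
        unfolding x_def y_def by (rule mult_nonneg_nonneg[OF measure_nonneg less_imp_le[OF me]])+
      ultimately have "\<lfloor>x\<rfloor> = \<lfloor>y\<rfloor>" by (simp add: eq_nat_nat_iff)
      then have "\<bar>x - y\<bar> \<le> 1" by linarith
      moreover have "x - y = (measure \<mu> (B k) - measure \<nu> (B k)) * (m / e)"
        by (simp add: x_def y_def left_diff_distrib diff_divide_distrib)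
      ultimately have "\<bar>measure \<mu> (B k) - measure \<nu> (B k)\<bar> * (m / e) \<le> 1"
        using me e by (simp add: abs_mult)
      then show "\<bar>measure \<mu> (B k) - measure \<nu> (B k)\<bar> \<le> e / m" using k e by (simp add: field_simps)
    qed (use that Bm part e in \<open>auto simp: B_def dist_commute less_imp_le\<close>)
    then show ?thesis by blast
  qed
  then obtain \<Phi> :: "real \<Rightarrow> 'a measure \<Rightarrow> nat list" where
    \<Phi>: "\<And>e \<mu> \<nu>. 0 < e \<Longrightarrow> \<mu> \<in> prob_measures \<Longrightarrow> \<nu> \<in> prob_measures \<Longrightarrow> \<Phi> e \<mu> = \<Phi> e \<nu> \<Longrightarrow> bl_dist \<mu> \<nu> \<le> 2 * e"
    by metis
  define l0 :: "'a measure" where "l0 = return borel undefined"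
  have l0: "l0 \<in> prob_measures" by (auto simp: l0_def prob_measures_def intro!: prob_space_return)
  define rep where "rep = (\<lambda>(n::nat, c). if \<exists>\<nu>\<in>prob_measures. \<Phi> (1 / Suc n) \<nu> = c
     then SOME \<nu>. \<nu> \<in> prob_measures \<and> \<Phi> (1 / Suc n) \<nu> = c else l0)"
  have rep: "rep nc \<in> prob_measures" for nc
    unfolding rep_def using l0 by (auto split: prod.split intro: someI2_ex)
  show ?thesis
  proof (rule that[of "\<lambda>i. rep (from_nat i)"])
    show "rep (from_nat i) \<in> prob_measures" for i by (rule rep)
    fix l :: "'a measure" and e :: real assume l: "l \<in> prob_measures" and e: "0 < e"
    obtain n :: nat where "2 / e < n" using reals_Archimedean2 by blast
    then have n: "2 * (1 / Suc n) < e" using e by (simp add: field_simps)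
    define c where "c = \<Phi> (1 / Suc n) l"
    have "rep (n, c) \<in> prob_measures \<and> \<Phi> (1 / Suc n) (rep (n, c)) = c"
      unfolding rep_def using l by (auto simp: c_def intro: someI2_ex)
    then have "bl_dist l (rep (n, c)) \<le> 2 * (1 / Suc n)" using l by (intro \<Phi>) (auto simp: c_def)
    then show "\<exists>i. bl_dist l (rep (from_nat i)) < e" using n by (intro exI[of _ "to_nat (n, c)"]) simp
  qed
qed

section \<open>Measurable infima and selectors\<close>

text \<open>The objective is uniformly continuous in the law, so a dense sequence reaches the infimum.\<close>

lemma INF_dense:
  fixes \<phi> :: "'a::metric_space measure \<Rightarrow> real" and d :: "nat \<Rightarrow> 'a measure"
  assumes d: "\<And>i. d i \<in> prob_measures"
    and dense: "\<And>l e. l \<in> prob_measures \<Longrightarrow> 0 < e \<Longrightarrow> \<exists>i. bl_dist l (d i) < e"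
    and \<zeta>: "subadditive_modulus \<zeta>"
    and cont: "\<And>l l'. l \<in> prob_measures \<Longrightarrow> l' \<in> prob_measures \<Longrightarrow>
      ennreal \<bar>\<phi> l - \<phi> l'\<bar> \<le> ennreal C * \<zeta> (ennreal (bl_dist l l'))"
    and bdd: "\<And>l. l \<in> prob_measures \<Longrightarrow> \<bar>\<phi> l\<bar> \<le> B"
  shows "(INF l\<in>prob_measures. \<phi> l) = (INF i. \<phi> (d i))"
proof (rule antisym)
  have bd: "bdd_below (\<phi> ` prob_measures)" by (rule bdd_belowI2[of _ "-B"]) (use bdd in force)
  have bd': "bdd_below (range (\<lambda>i. \<phi> (d i)))" by (rule bdd_belowI2[of _ "-B"]) (use bdd[OF d] in \<open>auto simp: abs_le_iff minus_le_iff\<close>)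
  show "(INF l\<in>prob_measures. \<phi> l) \<le> (INF i. \<phi> (d i))"
    by (rule cINF_greatest) (use d in \<open>auto intro: cINF_lower[OF bd]\<close>)
  show "(INF i. \<phi> (d i)) \<le> (INF l\<in>prob_measures. \<phi> l)"
  proof (rule cINF_greatest)
    fix l :: "'a measure" assume l: "l \<in> prob_measures"
    show "(INF i. \<phi> (d i)) \<le> \<phi> l"
    proof (rule field_le_epsilon)
      fix e :: real assume e: "0 < e"
      obtain \<delta> :: real where \<delta>: "0 < \<delta>" "ennreal C * \<zeta> (ennreal \<delta>) < ennreal e"
        using modulus_small[OF modulus_cmult[OF \<zeta>], of "ennreal e" C] e by auto
      obtain i where i: "bl_dist l (d i) < \<delta>" using dense[OF l \<delta>(1)] by blast
      have "ennreal \<bar>\<phi> l - \<phi> (d i)\<bar> \<le> ennreal C * \<zeta> (ennreal (bl_dist l (d i)))" by (rule cont[OF l d])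
      also have "\<dots> \<le> ennreal C * \<zeta> (ennreal \<delta>)"
        using i by (intro mult_left_mono modulusD(1)[OF \<zeta>] ennreal_leI) auto
      also have "\<dots> < ennreal e" by (rule \<delta>)
      finally have "\<bar>\<phi> l - \<phi> (d i)\<bar> < e" by (simp add: ennreal_less_iff)
      moreover have "(INF i. \<phi> (d i)) \<le> \<phi> (d i)" by (rule cINF_lower[OF bd']) simp
      ultimately show "(INF i. \<phi> (d i)) \<le> \<phi> l + e" by linarith
    qed
  qed (use d in auto)
qed

text \<open>For countably many objectives, the first index that is optimal up to \<open>e\<close> is a measurable choice.\<close>

lemma INF_countable:
  fixes f :: "nat \<Rightarrow> 'z \<Rightarrow> real"
  assumes f: "\<And>i. f i \<in> borel_measurable S" and B: "\<And>i x. x \<in> space S \<Longrightarrow> \<bar>f i x\<bar> \<le> B"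
  shows "(\<lambda>x. INF i. f i x) \<in> borel_measurable S"
    and "\<And>x. x \<in> space S \<Longrightarrow> \<bar>INF i. f i x\<bar> \<le> B"
    and "0 < e \<Longrightarrow> \<exists>k \<in> S \<rightarrow>\<^sub>M count_space UNIV. \<forall>x\<in>space S. f (k x) x \<le> (INF i. f i x) + e"
proof -
  have bd: "bdd_below (range (\<lambda>i. f i x))" if "x \<in> space S" for x
    by (rule bdd_belowI2[of _ "-B"]) (use B[OF that] in \<open>auto simp: abs_le_iff minus_le_iff\<close>)
  show m: "(\<lambda>x. INF i. f i x) \<in> borel_measurable S"
    by (rule borel_measurable_cINF) (use f bd in auto)
  show "\<bar>INF i. f i x\<bar> \<le> B" if x: "x \<in> space S" for x
  proof -
    have "- B \<le> (INF i. f i x)" by (rule cINF_greatest) (use B[OF x] in \<open>auto simp: abs_le_iff minus_le_iff\<close>)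
    moreover have "(INF i. f i x) \<le> f 0 x" by (rule cINF_lower[OF bd[OF x]]) simp
    ultimately show ?thesis using B[OF x, of 0] by linarith
  qed
  assume e: "0 < e"
  define k where "k x = (LEAST i. f i x \<le> (INF i. f i x) + e)" for x
  have "k \<in> S \<rightarrow>\<^sub>M count_space UNIV"
    unfolding k_def using f m by measurable
  moreover have "f (k x) x \<le> (INF i. f i x) + e" if x: "x \<in> space S" for x
  proof -
    have "\<exists>i. f i x < (INF i. f i x) + e"
      using cINF_less_iff[OF _ bd[OF x], of "(INF i. f i x) + e"] e by auto
    then have "\<exists>i. f i x \<le> (INF i. f i x) + e" by (auto intro: less_imp_le)
    from LeastI_ex[OF this] show ?thesis by (simp add: k_def)
  qed
  ultimately show "\<exists>k \<in> S \<rightarrow>\<^sub>M count_space UNIV. \<forall>x\<in>space S. f (k x) x \<le> (INF i. f i x) + e" by blast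
qed

section \<open>Score operators\<close>

locale score_model = game_model M for M :: "('x::polish_space, 'a::polish_space) game" +
  fixes c0 c1 :: real and \<zeta> :: "ennreal \<Rightarrow> ennreal"
  assumes compactA: "compact (UNIV :: 'a set)"
    and monoM: "monotonicity M"
    and growth: "growth_bound M c0 c1"
    and score_cont: "score_continuity M c0 c1 \<zeta>"
begin

lemma c_pos: "0 < c0" "0 < c1"
  using growth by (auto simp: growth_bound_def)

lemma \<zeta>_modulus: "subadditive_modulus \<zeta>"
  using score_cont by (simp add: score_continuity_def)

definition tuple :: "(nat \<Rightarrow> nat \<Rightarrow> ('x, 'a) policy) \<Rightarrow> nat \<Rightarrow> (nat \<Rightarrow> 'x) \<Rightarrow> nat \<Rightarrow> 'a measure" where
  "tuple \<PP> t x = (\<lambda>n\<in>{1..N}. \<PP> n t x)"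

lemma space_action_laws: "space (action_laws M) = ({1..N} \<rightarrow>\<^sub>E prob_measures)"
  by (auto simp: action_laws_def space_PiM space_borel_prob)

lemma profileD:
  assumes "\<PP> \<in> profiles M" "n \<in> {1..N}" "t \<in> {1..<T}"
  shows "\<PP> n t \<in> ST \<rightarrow>\<^sub>M borel_prob" "\<And>x. x \<in> space ST \<Longrightarrow> \<PP> n t x \<in> prob_measures"
proof -
  show *: "\<PP> n t \<in> ST \<rightarrow>\<^sub>M borel_prob" using assms by (auto simp: profiles_def policies_def)
  show "x \<in> space ST \<Longrightarrow> \<PP> n t x \<in> prob_measures" for x
    using measurable_space[OF *] by (simp add: space_borel_prob)
qed

lemma tuple_in:
  assumes "\<PP> \<in> profiles M" "t \<in> {1..<T}" "x \<in> space ST"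
  shows "tuple \<PP> t x \<in> space (action_laws M)"
  using profileD(2)[OF assms(1) _ assms(2,3)] by (auto simp: space_action_laws tuple_def)

lemma tuple_upd_in:
  assumes "\<PP> \<in> profiles M" "t \<in> {1..<T}" "x \<in> space ST" "l \<in> prob_measures"
  shows "(tuple \<PP> t x)(1 := l) \<in> space (action_laws M)"
  using tuple_in[OF assms(1-3)] assms(4) N1 by (auto simp: space_action_laws PiE_def extensional_def)

lemma tuple_measurable:
  assumes \<PP>: "\<And>n. n \<in> {1..N} \<Longrightarrow> \<PP> n t \<in> ST \<rightarrow>\<^sub>M borel_prob"
  shows "tuple \<PP> t \<in> ST \<rightarrow>\<^sub>M action_laws M"
  unfolding tuple_def action_laws_def by (rule measurable_restrict) (use \<PP> in auto)

lemma score_bounded: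
  assumes "t \<in> {1..<T}" "u \<in> bounded_borel ST" "l \<in> space (action_laws M)"
  shows "score M t l u \<in> bounded_borel ST"
  using wf assms by (auto simp: game_wf_def)

lemma score_abs:
  assumes t: "t \<in> {1..<T}" and u: "u \<in> bounded_borel ST" and l: "l \<in> space (action_laws M)" and x: "x \<in> space ST"
  shows "\<bar>score M t l u x\<bar> \<le> c0 + c1 * sup_norm ST u"
proof -
  have "sup_norm ST (score M t l u) \<le> c0 + c1 * sup_norm ST u"
    using growth t u l by (auto simp: growth_bound_def)
  with bounded_borelD(2)[OF score_bounded[OF t u l] x] show ?thesis by linarith
qed

lemma score_comp_measurable:
  assumes t: "t \<in> {1..<T}" and u: "u \<in> bounded_borel ST" and l: "l \<in> ST \<rightarrow>\<^sub>M action_laws M"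
  shows "(\<lambda>x. score M t (l x) u x) \<in> borel_measurable ST"
proof -
  have "(\<lambda>(x, l). score M t l u x) \<in> borel_measurable (ST \<Otimes>\<^sub>M action_laws M)"
    using wf t u by (auto simp: game_wf_def)
  from measurable_compose[OF measurable_Pair[OF measurable_ident l] this] show ?thesis by simp
qed

lemma score_step_eq: "score_step M \<PP> t u x = score M t (tuple \<PP> t x) u x"
  by (simp add: score_step_def tuple_def)

lemma opt_score_step_eq:
  "opt_score_step M \<PP> t u x = (INF l\<in>prob_measures. score M t ((tuple \<PP> t x)(1 := l)) u x)"
  by (simp add: opt_score_step_def tuple_def)

lemma score_step_bounded:
  assumes \<PP>: "\<PP> \<in> profiles M" and t: "t \<in> {1..<T}" and u: "u \<in> bounded_borel ST"
  shows "score_step M \<PP> t u \<in> bounded_borel ST"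
proof (rule bounded_borelI)
  show "score_step M \<PP> t u \<in> borel_measurable ST"
    unfolding score_step_eq[abs_def]
    by (rule score_comp_measurable[OF t u tuple_measurable]) (use profileD(1)[OF \<PP> _ t] in auto)
  show "\<bar>score_step M \<PP> t u x\<bar> \<le> c0 + c1 * sup_norm ST u" if "x \<in> space ST" for x
    unfolding score_step_eq by (rule score_abs[OF t u tuple_in[OF \<PP> t that] that])
qed

lemma score_lipschitz:
  assumes t: "t \<in> {1..<T}" and u: "u \<in> bounded_borel ST"
    and l: "l \<in> space (action_laws M)" "l' \<in> space (action_laws M)" and x: "x \<in> space ST"
  shows "ennreal \<bar>score M t l u x - score M t l' u x\<bar>
    \<le> ennreal (c0 + c1 * sup_norm ST u) * \<zeta> (ennreal (bl_dist (l 1) (l' 1)))"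
proof -
  have "(\<lambda>x. score M t l u x - score M t l' u x) \<in> bounded_borel ST"
    by (intro bounded_borel_diff score_bounded t u l)
  from bounded_borelD(2)[OF this x]
  have "ennreal \<bar>score M t l u x - score M t l' u x\<bar> \<le> ennreal (sup_norm ST (\<lambda>x. score M t l u x - score M t l' u x))"
    by (rule ennreal_leI)
  also have "\<dots> \<le> ennreal (c0 + c1 * sup_norm ST u) * \<zeta> (ennreal (bl_dist (l 1) (l' 1)))"
    using score_cont t u l by (auto simp: score_continuity_def)
  finally show ?thesis .
qed

lemma dense_laws:
  obtains d :: "nat \<Rightarrow> 'a measure"
  where "\<And>i. d i \<in> prob_measures" "\<And>l e. l \<in> prob_measures \<Longrightarrow> 0 < e \<Longrightarrow> \<exists>i. bl_dist l (d i) < e"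
  using bl_separable[OF compactA] by blast

lemma countable_selector:
  assumes "\<And>i::nat. d i \<in> (prob_measures :: 'a measure set)" "k \<in> S \<rightarrow>\<^sub>M count_space UNIV"
  shows "(\<lambda>x. d (k x)) \<in> S \<rightarrow>\<^sub>M borel_prob"
proof -
  have "d \<in> count_space UNIV \<rightarrow>\<^sub>M borel_prob" using assms(1) by (auto simp: space_borel_prob)
  from measurable_compose[OF assms(2) this] show ?thesis .
qed

text \<open>By score continuity the infimum over all action laws is one over a dense sequence. This makes the optimal
  step Borel and yields Borel policies of player 1 that are optimal up to \<open>e\<close>.\<close>

lemma opt_score_step_selector:
  assumes \<PP>: "\<PP> \<in> profiles M" and t: "t \<in> {1..<T}" and u: "u \<in> bounded_borel ST"
  shows "opt_score_step M \<PP> t u \<in> bounded_borel ST"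
    and "\<And>l x. l \<in> prob_measures \<Longrightarrow> x \<in> space ST \<Longrightarrow> opt_score_step M \<PP> t u x \<le> score M t ((tuple \<PP> t x)(1 := l)) u x"
    and "0 < e \<Longrightarrow> \<exists>\<pi>\<in>policies M. \<forall>x\<in>space ST.
      score M t ((tuple \<PP> t x)(1 := \<pi> x)) u x \<le> opt_score_step M \<PP> t u x + e"
proof -
  obtain d :: "nat \<Rightarrow> 'a measure" where d: "\<And>i. d i \<in> prob_measures"
    and dense: "\<And>l e. l \<in> prob_measures \<Longrightarrow> 0 < e \<Longrightarrow> \<exists>i. bl_dist l (d i) < e" by (rule dense_laws) blast
  let ?f = "\<lambda>i x. score M t ((tuple \<PP> t x)(1 := d i)) u x"
  let ?B = "c0 + c1 * sup_norm ST u"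
  have eq: "opt_score_step M \<PP> t u x = (INF i. ?f i x)" if x: "x \<in> space ST" for x
    unfolding opt_score_step_eq
  proof (rule INF_dense[OF d dense \<zeta>_modulus])
    fix l l' :: "'a measure" assume "l \<in> prob_measures" "l' \<in> prob_measures"
    from score_lipschitz[OF t u tuple_upd_in[OF \<PP> t x this(1)] tuple_upd_in[OF \<PP> t x this(2)] x]
    show "ennreal \<bar>score M t ((tuple \<PP> t x)(1 := l)) u x - score M t ((tuple \<PP> t x)(1 := l')) u x\<bar>
      \<le> ennreal ?B * \<zeta> (ennreal (bl_dist l l'))" by simp
  qed (use score_abs[OF t u tuple_upd_in[OF \<PP> t x] x] in auto)
  have m: "?f i \<in> borel_measurable ST" for i
  proof -
    have "(tuple \<PP> t x)(1 := d i) = tuple (\<PP>(1 := \<lambda>_ _. d i)) t x" for x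
      using N1 by (auto simp: tuple_def fun_eq_iff)
    moreover have "tuple (\<PP>(1 := \<lambda>_ _. d i)) t \<in> ST \<rightarrow>\<^sub>M action_laws M"
      by (rule tuple_measurable) (use profileD(1)[OF \<PP> _ t] d in \<open>auto simp: space_borel_prob\<close>)
    ultimately show ?thesis using score_comp_measurable[OF t u, of "tuple (\<PP>(1 := \<lambda>_ _. d i)) t"] by simp
  qed
  have b: "\<bar>?f i x\<bar> \<le> ?B" if "x \<in> space ST" for i x
    by (rule score_abs[OF t u tuple_upd_in[OF \<PP> t that d] that])
  have C: "(\<lambda>x. INF i. ?f i x) \<in> borel_measurable ST" "\<And>x. x \<in> space ST \<Longrightarrow> \<bar>INF i. ?f i x\<bar> \<le> ?B"
    "\<And>e. 0 < e \<Longrightarrow> \<exists>k \<in> ST \<rightarrow>\<^sub>M count_space UNIV. \<forall>x\<in>space ST. ?f (k x) x \<le> (INF i. ?f i x) + e"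
    by (rule INF_countable[where f = ?f and B = ?B]; use m b in blast)+
  show bb: "opt_score_step M \<PP> t u \<in> bounded_borel ST"
  proof (rule bounded_borelI)
    show "opt_score_step M \<PP> t u \<in> borel_measurable ST"
      using C(1) by (rule measurable_cong[THEN iffD2, rotated]) (use eq in auto)
    show "\<bar>opt_score_step M \<PP> t u x\<bar> \<le> ?B" if "x \<in> space ST" for x using C(2)[OF that] eq[OF that] by simp
  qed
  show "opt_score_step M \<PP> t u x \<le> score M t ((tuple \<PP> t x)(1 := l)) u x"
    if l: "l \<in> prob_measures" and x: "x \<in> space ST" for l x
    unfolding opt_score_step_eq
  proof (rule cINF_lower[OF _ l])
    show "bdd_below ((\<lambda>l. score M t ((tuple \<PP> t x)(1 := l)) u x) ` prob_measures)"
      by (rule bdd_belowI2[of _ "- ?B"])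
         (use score_abs[OF t u tuple_upd_in[OF \<PP> t x] x] in \<open>auto simp: abs_le_iff minus_le_iff\<close>)
  qed
  assume "0 < e"
  then obtain k where k: "k \<in> ST \<rightarrow>\<^sub>M count_space UNIV" "\<And>x. x \<in> space ST \<Longrightarrow> ?f (k x) x \<le> (INF i. ?f i x) + e"
    using C(3)[of e] by blast
  show "\<exists>\<pi>\<in>policies M. \<forall>x\<in>space ST. score M t ((tuple \<PP> t x)(1 := \<pi> x)) u x \<le> opt_score_step M \<PP> t u x + e"
    by (rule bexI[of _ "\<lambda>x. d (k x)"]) (use k eq countable_selector[OF d k(1)] in \<open>auto simp: policies_def\<close>)
qed

lemma opt_le_score_step:
  assumes \<PP>: "\<PP> \<in> profiles M" and t: "t \<in> {1..<T}" and u: "u \<in> bounded_borel ST" and x: "x \<in> space ST"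
  shows "opt_score_step M \<PP> t u x \<le> score_step M \<PP> t u x"
proof -
  have "(tuple \<PP> t x)(1 := \<PP> 1 t x) = tuple \<PP> t x" using N1 by (auto simp: tuple_def)
  then show ?thesis
    using opt_score_step_selector(2)[OF \<PP> t u profileD(2)[OF \<PP> _ t x, of 1] x] N1 by (simp add: score_step_eq)
qed

lemma score_mono:
  assumes "u \<in> bounded_borel ST" "u' \<in> bounded_borel ST" "\<And>x. x \<in> space ST \<Longrightarrow> u x \<le> u' x"
  shows "init_score M u \<le> init_score M u'"
    and "t \<in> {1..<T} \<Longrightarrow> l \<in> space (action_laws M) \<Longrightarrow> x \<in> space ST \<Longrightarrow> score M t l u x \<le> score M t l u' x"
  using monoM assms by (auto simp: monotonicity_def)

text \<open>Player 1 is optimised over, so only the policies of the others matter.\<close>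

lemma opt_score_step_cong:
  assumes "\<And>n. n \<in> {2..N} \<Longrightarrow> \<PP> n t x = \<QQ> n t x"
  shows "opt_score_step M \<PP> t u x = opt_score_step M \<QQ> t u x"
proof -
  have "(tuple \<PP> t x)(1 := l) = (tuple \<QQ> t x)(1 := l)" for l
  proof
    fix n
    have "n = 1 \<or> n \<in> {2..N} \<or> n \<notin> {1..N}" by auto
    then show "((tuple \<PP> t x)(1 := l)) n = ((tuple \<QQ> t x)(1 := l)) n" using assms by (auto simp: tuple_def)
  qed
  then show ?thesis by (simp add: opt_score_step_eq)
qed

lemma foldr_upt_step: "s < t \<Longrightarrow> foldr f [s..<t] u = f s (foldr f [Suc s..<t] u)"
  by (simp add: upt_rec)

lemma foldr_bounded:
  assumes step: "\<And>t u. t \<in> {1..<T} \<Longrightarrow> u \<in> bounded_borel ST \<Longrightarrow> F t u \<in> bounded_borel ST"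
    and U: "U \<in> bounded_borel ST" and st: "1 \<le> s" "s \<le> t" "t \<le> T"
  shows "foldr F [s..<t] U \<in> bounded_borel ST"
  using st(2,1)
proof (induction rule: inc_induct)
  case base then show ?case using U by simp
next
  case (step n)
  then have "foldr F [Suc n..<t] U \<in> bounded_borel ST" by auto
  then have "F n (foldr F [Suc n..<t] U) \<in> bounded_borel ST" using step st by (intro assms(1)) auto
  then show ?case using step by (simp add: foldr_upt_step)
qed

lemma score_foldr_bounded:
  assumes "\<PP> \<in> profiles M" "U \<in> bounded_borel ST" "1 \<le> s" "s \<le> t" "t \<le> T"
  shows "foldr (score_step M \<PP>) [s..<t] U \<in> bounded_borel ST" "foldr (opt_score_step M \<PP>) [s..<t] U \<in> bounded_borel ST"
  by (rule foldr_bounded; use assms score_step_bounded opt_score_step_selector(1) in blast)+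

lemma init_score_foldr_Suc: "1 \<le> t \<Longrightarrow> score_op M \<PP> (Suc t) u = score_op M \<PP> t (score_step M \<PP> t u)"
  by (simp add: score_op_def)

lemma score_op_mono:
  assumes \<PP>: "\<PP> \<in> profiles M"
  shows "\<lbrakk>t \<in> {1..T}; u \<in> bounded_borel ST; u' \<in> bounded_borel ST; \<And>x. x \<in> space ST \<Longrightarrow> u x \<le> u' x\<rbrakk>
    \<Longrightarrow> score_op M \<PP> t u \<le> score_op M \<PP> t u'"
proof (induction t arbitrary: u u')
  case (Suc t)
  show ?case
  proof (cases "t = 0")
    case False
    then have t: "t \<in> {1..<T}" using Suc.prems by auto
    have "score_step M \<PP> t u x \<le> score_step M \<PP> t u' x" if "x \<in> space ST" for x
      unfolding score_step_eq using that Suc.prems t by (intro score_mono(2) tuple_in[OF \<PP> t]) auto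
    then have "score_op M \<PP> t (score_step M \<PP> t u) \<le> score_op M \<PP> t (score_step M \<PP> t u')"
      using t Suc.prems by (intro Suc.IH score_step_bounded[OF \<PP> t]) auto
    then show ?thesis using t by (simp add: init_score_foldr_Suc)
  qed (use Suc.prems score_mono(1) in \<open>auto simp: score_op_def\<close>)
qed simp

section \<open>Total and stepwise exploitability\<close>

text \<open>The score of a player 1 who follows \<open>\<PP>\<close> before time \<open>t\<close> and responds optimally from then on. At
  \<open>t = T\<close> this is the score of the profile and at \<open>t = 1\<close> the optimal one, so the exploitability is the
  sum of the increments.\<close>

definition hybrid :: "(nat \<Rightarrow> nat \<Rightarrow> ('x, 'a) policy) \<Rightarrow> ((nat \<Rightarrow> 'x) \<Rightarrow> real) \<Rightarrow> nat \<Rightarrow> real" where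
  "hybrid \<PP> U t = score_op M \<PP> t (foldr (opt_score_step M \<PP>) [t..<T] U)"

lemma exploitability_telescope:
  "exploitability M \<PP> U = (\<Sum>t=1..T-1. hybrid \<PP> U (Suc t) - hybrid \<PP> U t)"
proof -
  have "(\<Sum>t=1..T-1. hybrid \<PP> U (Suc t) - hybrid \<PP> U t) = hybrid \<PP> U (Suc (T-1)) - hybrid \<PP> U 1"
    using T2 by (intro sum_Suc_diff) simp
  also have "\<dots> = exploitability M \<PP> U"
    using T2 by (simp add: hybrid_def exploitability_def opt_score_op_def score_op_def)
  finally show ?thesis by simp
qed

lemma hybrid_diff:
  assumes t: "t \<in> {1..<T}"
  shows "hybrid \<PP> U (Suc t) - hybrid \<PP> U t
    = score_op M \<PP> t (score_step M \<PP> t (foldr (opt_score_step M \<PP>) [t+1..<T] U))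
      - score_op M \<PP> t (foldr (opt_score_step M \<PP>) [t..<T] U)"
  using t by (simp add: hybrid_def init_score_foldr_Suc)

text \<open>The increment at time \<open>t\<close> compares two functions of the state at that time, of which the first is the larger;
  their difference is the integrand of the stepwise exploitability.\<close>

lemma gap:
  assumes \<PP>: "\<PP> \<in> profiles M" and U: "U \<in> bounded_borel ST" and t: "t \<in> {1..<T}"
  defines "u \<equiv> score_step M \<PP> t (foldr (opt_score_step M \<PP>) [t+1..<T] U)"
    and "u' \<equiv> foldr (opt_score_step M \<PP>) [t..<T] U"
  shows "u \<in> bounded_borel ST" "u' \<in> bounded_borel ST" "\<And>x. x \<in> space ST \<Longrightarrow> u' x \<le> u x"
    "trans_op M \<PP> t (\<lambda>x. u x - u' x) = (\<integral>x. u x - u' x \<partial>state_law M \<PP> t)"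
    "0 \<le> (\<integral>x. u x - u' x \<partial>state_law M \<PP> t)"
proof -
  have b: "foldr (opt_score_step M \<PP>) [t+1..<T] U \<in> bounded_borel ST"
    using t by (intro score_foldr_bounded(2)[OF \<PP> U]) auto
  show u: "u \<in> bounded_borel ST" unfolding u_def by (rule score_step_bounded[OF \<PP> t b])
  show u': "u' \<in> bounded_borel ST" unfolding u'_def using t by (intro score_foldr_bounded(2)[OF \<PP> U]) auto
  show le: "u' x \<le> u x" if "x \<in> space ST" for x
    using opt_le_score_step[OF \<PP> t b that] t by (simp add: u_def u'_def foldr_upt_step)
  show "trans_op M \<PP> t (\<lambda>x. u x - u' x) = (\<integral>x. u x - u' x \<partial>state_law M \<PP> t)"
    by (rule trans_op_state_law[OF \<PP>]) (use t u u' in \<open>auto intro: bounded_borel_diff\<close>)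
  have "state_law M \<PP> t \<in> space (prob_algebra ST)" using t by (intro state_law_prob[OF \<PP>]) simp
  then show "0 \<le> (\<integral>x. u x - u' x \<partial>state_law M \<PP> t)"
    using le prob_algebraD(3) by (intro Bochner_Integration.integral_nonneg_AE AE_I2) fastforce
qed

text \<open>Peeling off one score step turns a difference at time \<open>t + 1\<close> into one at time \<open>t\<close>, with a factor \<open>c\<close>
  and an integration against the transition kernel. The sign \<open>\<sigma>\<close> covers upper bounds (\<open>\<sigma> = 1\<close>) and lower
  bounds (\<open>\<sigma> = -1\<close>) at once.\<close>

lemma score_op_compare:
  fixes \<sigma> c :: real
  assumes \<PP>: "\<PP> \<in> profiles M" and c: "0 < c"
    and init: "\<And>u u'. \<lbrakk>u \<in> bounded_borel ST; u' \<in> bounded_borel ST; \<And>x. x \<in> space ST \<Longrightarrow> u' x \<le> u x\<rbrakk> \<Longrightarrow>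
      \<sigma> * (init_score M u - init_score M u') \<le> \<sigma> * (c * (\<integral>y. u y - u' y \<partial>init_tuple_law M))"
    and step: "\<And>t l x u u'. \<lbrakk>t \<in> {1..<T}; l \<in> space (action_laws M); x \<in> space ST; u \<in> bounded_borel ST; u' \<in> bounded_borel ST;
      \<And>x. x \<in> space ST \<Longrightarrow> u' x \<le> u x; sets (next_law M t l x) = sets ST\<rbrakk> \<Longrightarrow>
      \<sigma> * (score M t l u x - score M t l u' x) \<le> \<sigma> * (c * (\<integral>y. u y - u' y \<partial>next_law M t l x))"
  shows "\<lbrakk>t \<in> {1..T}; u \<in> bounded_borel ST; u' \<in> bounded_borel ST; \<And>x. x \<in> space ST \<Longrightarrow> u' x \<le> u x\<rbrakk> \<Longrightarrow>
    \<sigma> * (score_op M \<PP> t u - score_op M \<PP> t u') \<le> \<sigma> * (c ^ t * (\<integral>x. u x - u' x \<partial>state_law M \<PP> t))"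
proof (induction t arbitrary: u u')
  case (Suc t)
  show ?case
  proof (cases "t = 0")
    case True
    then show ?thesis using init[OF Suc.prems(2-4)] by (simp add: score_op_def)
  next
    case False
    then have t: "t \<in> {1..<T}" using Suc.prems by auto
    note K = profile_kernel[OF t \<PP>] and s = score_step_bounded[OF \<PP> t] and d = bounded_borel_diff[OF Suc.prems(2,3)]
    have pt: "state_law M \<PP> t \<in> space (prob_algebra ST)" using t by (intro state_law_prob[OF \<PP>]) simp
    let ?S = "\<lambda>x. score_step M \<PP> t u x - score_step M \<PP> t u' x"
    let ?I = "\<lambda>x. c * trans_step M \<PP> t (\<lambda>x. u x - u' x) x"
    have le: "\<sigma> * ?S x \<le> \<sigma> * ?I x" if x: "x \<in> space ST" for x
    proof -
      have eq: "next_law M t (tuple \<PP> t x) x = next_law M t (\<lambda>n. \<PP> n t x) x"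
        by (rule next_law_cong) (simp add: tuple_def)
      show ?thesis
        using step[OF t tuple_in[OF \<PP> t x] x Suc.prems(2-4)] kernelD(2)[OF K x]
        by (simp add: score_step_eq trans_step_def eq)
    qed
    have ii: "integrable (state_law M \<PP> t) ?S" "integrable (state_law M \<PP> t) ?I"
      by (intro integrable_mult_right bounded_borel_integrable[OF _ pt] bounded_borel_diff s trans_step_bounded[OF t \<PP> d] Suc.prems)+
    have "\<sigma> * (score_op M \<PP> (Suc t) u - score_op M \<PP> (Suc t) u') \<le> \<sigma> * (c ^ t * (\<integral>x. ?S x \<partial>state_law M \<PP> t))"
    proof -
      have "score_step M \<PP> t u' x \<le> score_step M \<PP> t u x" if "x \<in> space ST" for x
        unfolding score_step_eq using that Suc.prems t by (intro score_mono(2) tuple_in[OF \<PP> t]) auto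
      then show ?thesis
        using t Suc.prems init_score_foldr_Suc[of t] by (auto intro!: Suc.IH s)
    qed
    also have "\<dots> = c ^ t * (\<integral>x. \<sigma> * ?S x \<partial>state_law M \<PP> t)" by simp
    also have "\<dots> \<le> c ^ t * (\<integral>x. \<sigma> * ?I x \<partial>state_law M \<PP> t)"
    proof (rule mult_left_mono[OF integral_mono])
      show "integrable (state_law M \<PP> t) (\<lambda>x. \<sigma> * ?S x)" "integrable (state_law M \<PP> t) (\<lambda>x. \<sigma> * ?I x)"
        by (intro integrable_mult_right ii)+
      fix x assume "x \<in> space (state_law M \<PP> t)"
      then show "\<sigma> * ?S x \<le> \<sigma> * ?I x" using prob_algebraD(3)[OF pt] by (intro le) (simp only:)
    qed (use c in simp)
    also have "\<dots> = \<sigma> * (c ^ Suc t * (\<integral>x. u x - u' x \<partial>state_law M \<PP> (Suc t)))"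
      unfolding integral_state_law_Suc[OF t \<PP> d] by simp
    finally show ?thesis .
  qed
qed simp

lemma score_op_upper:
  assumes \<PP>: "\<PP> \<in> profiles M" and ib: "integral_bound M cbar" and t: "t \<in> {1..T}"
    and u: "u \<in> bounded_borel ST" "u' \<in> bounded_borel ST" "\<And>x. x \<in> space ST \<Longrightarrow> u' x \<le> u x"
  shows "score_op M \<PP> t u - score_op M \<PP> t u' \<le> cbar ^ t * (\<integral>x. u x - u' x \<partial>state_law M \<PP> t)"
proof -
  have abs: "(\<integral>y. \<bar>w y - w' y\<bar> \<partial>\<mu>) = (\<integral>y. w y - w' y \<partial>\<mu>)"
    if "sets \<mu> = sets ST" "\<forall>x\<in>space ST. w' x \<le> w x" for \<mu> and w w' :: "(nat \<Rightarrow> 'x) \<Rightarrow> real"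
    using that sets_eq_imp_space_eq[OF that(1)] by (intro Bochner_Integration.integral_cong) auto
  have "1 * (score_op M \<PP> t u - score_op M \<PP> t u') \<le> 1 * (cbar ^ t * (\<integral>x. u x - u' x \<partial>state_law M \<PP> t))"
  proof (rule score_op_compare[OF \<PP> _ _ _ t u])
    show "0 < cbar" using ib by (simp add: integral_bound_def)
    fix w w' assume w: "w \<in> bounded_borel ST" "w' \<in> bounded_borel ST" "\<And>x. x \<in> space ST \<Longrightarrow> w' x \<le> w x"
    then have w3: "\<forall>x\<in>space ST. w' x \<le> w x" by blast
    have "\<bar>init_score M w - init_score M w'\<bar> \<le> cbar * (\<integral>y. \<bar>w y - w' y\<bar> \<partial>init_tuple_law M)"
      using ib w(1,2) unfolding integral_bound_def by blast
    then show "1 * (init_score M w - init_score M w') \<le> 1 * (cbar * (\<integral>y. w y - w' y \<partial>init_tuple_law M))"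
      unfolding abs[OF prob_algebraD(2)[OF init_tuple_law] w3] by (simp add: abs_le_iff)
    fix t l x assume tlx: "t \<in> {1..<T}" "l \<in> space (action_laws M)" "x \<in> space ST" and st: "sets (next_law M t l x) = sets ST"
    have "\<bar>score M t l w x - score M t l w' x\<bar> \<le> cbar * (\<integral>y. \<bar>w y - w' y\<bar> \<partial>next_law M t l x)"
      using ib w(1,2) tlx unfolding integral_bound_def by blast
    then show "1 * (score M t l w x - score M t l w' x) \<le> 1 * (cbar * (\<integral>y. w y - w' y \<partial>next_law M t l x))"
      unfolding abs[OF st w3] by (simp add: abs_le_iff)
  qed
  then show ?thesis by simp
qed

lemma score_op_lower:
  assumes \<PP>: "\<PP> \<in> profiles M" and lb: "lower_integral_bound M c" and t: "t \<in> {1..T}"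
    and u: "u \<in> bounded_borel ST" "u' \<in> bounded_borel ST" "\<And>x. x \<in> space ST \<Longrightarrow> u' x \<le> u x"
  shows "c ^ t * (\<integral>x. u x - u' x \<partial>state_law M \<PP> t) \<le> score_op M \<PP> t u - score_op M \<PP> t u'"
proof -
  have "- 1 * (score_op M \<PP> t u - score_op M \<PP> t u') \<le> - 1 * (c ^ t * (\<integral>x. u x - u' x \<partial>state_law M \<PP> t))"
  proof (rule score_op_compare[OF \<PP> _ _ _ t u])
    show "0 < c" using lb by (simp add: lower_integral_bound_def)
    fix w w' assume w: "w \<in> bounded_borel ST" "w' \<in> bounded_borel ST" "\<And>x. x \<in> space ST \<Longrightarrow> w' x \<le> w x"
    then have *: "\<forall>x\<in>space ST. w' x \<le> w x" by blast
    have "c * (\<integral>y. w y - w' y \<partial>init_tuple_law M) \<le> init_score M w - init_score M w'"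
      using lb w(1,2) * unfolding lower_integral_bound_def by blast
    then show "- 1 * (init_score M w - init_score M w') \<le> - 1 * (c * (\<integral>y. w y - w' y \<partial>init_tuple_law M))" by (simp add: algebra_simps)
    fix t l x assume tlx: "t \<in> {1..<T}" "l \<in> space (action_laws M)" "x \<in> space ST"
    have "c * (\<integral>y. w y - w' y \<partial>next_law M t l x) \<le> score M t l w x - score M t l w' x"
      using lb w(1,2) * tlx unfolding lower_integral_bound_def by blast
    then show "- 1 * (score M t l w x - score M t l w' x) \<le> - 1 * (c * (\<integral>y. w y - w' y \<partial>next_law M t l x))" by (simp add: algebra_simps)
  qed
  then show ?thesis by simp
qed

lemma exploitability_le_stepwise:
  assumes ib: "integral_bound M cbar" and \<PP>: "\<PP> \<in> profiles M" and U: "U \<in> bounded_borel ST"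
  shows "exploitability M \<PP> U \<le> stepwise_exploitability M cbar \<PP> U"
  unfolding exploitability_telescope stepwise_exploitability_def
proof (rule sum_mono)
  fix t assume "t \<in> {1..T-1}"
  then have t: "t \<in> {1..<T}" "t \<in> {1..T}" by auto
  note g = gap[OF \<PP> U t(1)]
  show "hybrid \<PP> U (Suc t) - hybrid \<PP> U t \<le> cbar ^ t * trans_op M \<PP> t
    (\<lambda>x. score_step M \<PP> t (foldr (opt_score_step M \<PP>) [t + 1..<T] U) x - foldr (opt_score_step M \<PP>) [t..<T] U x)"
    unfolding hybrid_diff[OF t(1)] g(4) by (rule score_op_upper[OF \<PP> ib t(2) g(1-3)])
qed

lemma exploitability_ge_stepwise:
  assumes ib: "integral_bound M cbar" and lb: "lower_integral_bound M clow"
    and \<PP>: "\<PP> \<in> profiles M" and U: "U \<in> bounded_borel ST"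
  shows "(clow / cbar) ^ (T - 1) * stepwise_exploitability M cbar \<PP> U \<le> exploitability M \<PP> U"
proof -
  have c: "0 < cbar" "0 < clow" using ib lb by (auto simp: integral_bound_def lower_integral_bound_def)
  \<comment> \<open>Both bounds applied to the constants 1 and 0 show \<open>clow \<le> cbar\<close>.\<close>
  have ratio: "clow / cbar \<le> 1"
  proof -
    have b: "(\<lambda>_. 1) \<in> bounded_borel ST" "(\<lambda>_. 0) \<in> bounded_borel ST"
      by (rule bounded_borelI[where C=1]; simp)+
    interpret prob_space "init_tuple_law M" by (rule prob_algebraD(1)[OF init_tuple_law])
    have "clow * (\<integral>y. 1 - 0 \<partial>init_tuple_law M) \<le> init_score M (\<lambda>_. 1) - init_score M (\<lambda>_. 0)"
    proof -
      have *: "clow * (\<integral>y. u y - u' y \<partial>init_tuple_law M) \<le> init_score M u - init_score M u'"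
        if "u \<in> bounded_borel ST" "u' \<in> bounded_borel ST" "\<forall>x\<in>space ST. u' x \<le> u x" for u u'
        using lb that unfolding lower_integral_bound_def by blast
      show ?thesis using *[OF b] by simp
    qed
    also have "\<dots> \<le> \<bar>init_score M (\<lambda>_. 1) - init_score M (\<lambda>_. 0)\<bar>" by simp
    also have "\<dots> \<le> cbar * (\<integral>y. \<bar>1 - 0\<bar> \<partial>init_tuple_law M)"
      using ib b unfolding integral_bound_def by blast
    finally show ?thesis using c by (simp add: prob_space)
  qed
  show ?thesis
    unfolding exploitability_telescope stepwise_exploitability_def sum_distrib_left
  proof (rule sum_mono)
    fix t assume t': "t \<in> {1..T-1}"
    then have t: "t \<in> {1..<T}" "t \<in> {1..T}" by auto
    note g = gap[OF \<PP> U t(1)]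
    let ?I = "\<integral>x. score_step M \<PP> t (foldr (opt_score_step M \<PP>) [t + 1..<T] U) x
      - foldr (opt_score_step M \<PP>) [t..<T] U x \<partial>state_law M \<PP> t"
    have "(clow / cbar) ^ (T - 1) * (cbar ^ t * ?I) \<le> (clow / cbar) ^ t * (cbar ^ t * ?I)"
      using c ratio t' g(5) by (intro mult_right_mono power_decreasing) auto
    also have "\<dots> = clow ^ t * ?I" using c by (simp add: power_divide)
    also have "\<dots> \<le> hybrid \<PP> U (Suc t) - hybrid \<PP> U t"
      unfolding hybrid_diff[OF t(1)] by (rule score_op_lower[OF \<PP> lb t(2) g(1-3)])
    finally show "(clow / cbar) ^ (T - 1) * (cbar ^ t * trans_op M \<PP> t
      (\<lambda>x. score_step M \<PP> t (foldr (opt_score_step M \<PP>) [t + 1..<T] U) x - foldr (opt_score_step M \<PP>) [t..<T] U x))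
      \<le> hybrid \<PP> U (Suc t) - hybrid \<PP> U t" unfolding g(4) .
  qed
qed

end

section \<open>Concentration of empirical measures\<close>

lemma (in prob_space) variance_le_1:
  fixes \<phi> :: "'a \<Rightarrow> real"
  assumes "\<phi> \<in> borel_measurable M" "\<And>y. \<bar>\<phi> y\<bar> \<le> 1"
  shows "variance \<phi> \<le> 1"
proof -
  have i: "integrable M \<phi>" by (rule integrable_const_bound[of _ 1]) (use assms in auto)
  have sq: "(\<phi> y)\<^sup>2 \<le> 1" for y using assms(2)[of y] by (simp add: abs_square_le_1)
  have i2: "integrable M (\<lambda>y. (\<phi> y)\<^sup>2)" by (rule integrable_const_bound[of _ 1]) (use assms sq in auto)
  have "variance \<phi> = expectation (\<lambda>y. (\<phi> y)\<^sup>2) - (expectation \<phi>)\<^sup>2" by (rule variance_eq[OF i i2])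
  also have "\<dots> \<le> expectation (\<lambda>y. (\<phi> y)\<^sup>2)" by simp
  also have "\<dots> \<le> expectation (\<lambda>y. 1)" by (rule integral_mono[OF i2]) (use sq in auto)
  finally show ?thesis by (simp add: prob_space)
qed

text \<open>Distinct coordinates of a product measure are uncorrelated.\<close>

lemma (in product_prob_space) product_variance:
  fixes \<phi> :: "'i \<Rightarrow> 'a \<Rightarrow> real"
  assumes J: "finite J" and \<phi>: "\<And>i. i \<in> J \<Longrightarrow> \<phi> i \<in> borel_measurable (M i)" "\<And>i y. i \<in> J \<Longrightarrow> \<bar>\<phi> i y\<bar> \<le> 1"
  shows "(\<integral>y. (\<Sum>i\<in>J. \<phi> i (y i) - (\<integral>z. \<phi> i z \<partial>M i))\<^sup>2 \<partial>Pi\<^sub>M J M) \<le> card J"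
proof -
  define \<psi> where "\<psi> i z = \<phi> i z - (\<integral>z. \<phi> i z \<partial>M i)" for i z
  have i\<phi>: "integrable (M i) (\<phi> i)" if "i \<in> J" for i
    by (rule M.integrable_const_bound[where B=1]) (use \<phi> that in auto)
  have m: "\<psi> i \<in> borel_measurable (M i)" if "i \<in> J" for i unfolding \<psi>_def using \<phi>(1)[OF that] by simp
  have b: "\<bar>\<psi> i z\<bar> \<le> 2" if "i \<in> J" for i z
  proof -
    have "\<bar>\<integral>z. \<phi> i z \<partial>M i\<bar> \<le> 1" by (rule integral_bounds[OF M.prob_space_axioms refl]) (use \<phi> that in auto)
    then show ?thesis using \<phi>(2)[OF that, of z] unfolding \<psi>_def by linarith
  qed
  have int: "integrable (M i) (\<psi> i)" "integrable (M i) (\<lambda>z. (\<psi> i z)\<^sup>2)" if "i \<in> J" for i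
  proof -
    show "integrable (M i) (\<psi> i)" by (rule M.integrable_const_bound[where B=2]) (use m b that in auto)
    have "(\<psi> i z)\<^sup>2 \<le> 4" for z
    proof -
      have "\<bar>\<psi> i z\<bar>\<^sup>2 \<le> 2\<^sup>2" by (rule power_mono[OF b[OF that]]) simp
      then show ?thesis by simp
    qed
    then show "integrable (M i) (\<lambda>z. (\<psi> i z)\<^sup>2)"
      by (intro M.integrable_const_bound[where B=4]) (use m[OF that] in auto)
  qed
  have mean0: "(\<integral>z. \<psi> i z \<partial>M i) = 0" if "i \<in> J" for i
    unfolding \<psi>_def using i\<phi>[OF that] by (simp add: M.prob_space)
  have prod_eq: "integrable (Pi\<^sub>M J M) (\<lambda>y. \<psi> i (y i) * \<psi> j (y j)) \<and>
    (\<integral>y. \<psi> i (y i) * \<psi> j (y j) \<partial>Pi\<^sub>M J M) \<le> (if i = j then 1 else 0)" if ij: "i \<in> J" "j \<in> J" for i j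
  proof -
    define f where "f k z = (if k = i then \<psi> i z else 1) * (if k = j then \<psi> j z else 1)" for k z
    have f_int: "integrable (M k) (f k)" if "k \<in> J" for k
    proof (cases "k = i")
      case True
      then show ?thesis
        using int[OF ij(1)] unfolding f_def by (cases "k = j") (auto simp: power2_eq_square)
    next
      case False
      then show ?thesis using int[OF ij(2)] unfolding f_def by (cases "k = j") auto
    qed
    have eq: "(\<Prod>k\<in>J. f k (y k)) = \<psi> i (y i) * \<psi> j (y j)" for y
      unfolding f_def prod.distrib using ij J
      by (subst prod.delta, simp, subst prod.delta, simp) simp
    note P = product_integrable_prod[OF J f_int, unfolded eq] product_integral_prod[OF J f_int, unfolded eq]
    have "(\<Prod>k\<in>J. \<integral>z. f k z \<partial>M k) \<le> (if i = j then 1 else 0)"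
    proof (cases "i = j")
      case False
      then have "f i = \<psi> i" by (auto simp: f_def)
      then have "(\<integral>z. f i z \<partial>M i) = 0" using mean0[OF ij(1)] by simp
      then show ?thesis using False J ij by (auto intro!: prod_zero[THEN eq_refl])
    next
      case True
      then have "(\<Prod>k\<in>J. \<integral>z. f k z \<partial>M k) = (\<Prod>k\<in>J. if k = i then (\<integral>z. (\<psi> i z)\<^sup>2 \<partial>M i) else 1)"
        by (intro prod.cong) (auto simp: f_def power2_eq_square M.prob_space)
      also have "\<dots> = (\<integral>z. (\<psi> i z)\<^sup>2 \<partial>M i)" using ij J by (subst prod.delta) auto
      also have "\<dots> \<le> 1" unfolding \<psi>_def by (rule M.variance_le_1) (use \<phi> ij in auto)
      finally show ?thesis using True by simp
    qed
    with P show ?thesis by simp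
  qed
  have "(\<integral>y. (\<Sum>i\<in>J. \<psi> i (y i))\<^sup>2 \<partial>Pi\<^sub>M J M) = (\<integral>y. (\<Sum>i\<in>J. \<Sum>j\<in>J. \<psi> i (y i) * \<psi> j (y j)) \<partial>Pi\<^sub>M J M)"
    by (simp add: power2_eq_square sum_product)
  also have "\<dots> = (\<Sum>i\<in>J. \<Sum>j\<in>J. \<integral>y. \<psi> i (y i) * \<psi> j (y j) \<partial>Pi\<^sub>M J M)"
    using prod_eq by (simp add: Bochner_Integration.integral_sum)
  also have "\<dots> \<le> (\<Sum>i\<in>J. \<Sum>j\<in>J. if i = j then 1 else 0)"
    using prod_eq by (intro sum_mono) auto
  also have "\<dots> = card J" using J by simp
  finally show ?thesis by (simp add: \<psi>_def)
qed

lemma PiM_variance: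
  fixes \<phi> :: "nat \<Rightarrow> 'x::topological_space \<Rightarrow> real"
  assumes \<nu>: "\<And>n. n \<in> {1..N} \<Longrightarrow> \<nu> n \<in> prob_measures" and N: "1 \<le> N"
    and \<phi>: "\<And>n. n \<in> {1..N} \<Longrightarrow> \<phi> n \<in> borel_measurable borel" "\<And>n y. n \<in> {1..N} \<Longrightarrow> \<bar>\<phi> n y\<bar> \<le> 1"
  shows "(\<integral>\<^sup>+y. ennreal (((\<Sum>n=1..N. \<phi> n (y n)) / N - (\<Sum>n=1..N. \<integral>z. \<phi> n z \<partial>\<nu> n) / N)\<^sup>2) \<partial>Pi\<^sub>M {1..N} \<nu>)
    \<le> ennreal (1 / N)"
proof -
  \<comment> \<open>Only the factors with index in \<open>{1..N}\<close> enter the product; the others are filled with Dirac measures.\<close>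
  define \<nu>' where "\<nu>' n = (if n \<in> {1..N} then \<nu> n else return borel undefined)" for n
  have ps: "prob_space (\<nu>' n)" for n
    using \<nu> by (auto simp: \<nu>'_def prob_measures_def intro!: prob_space_return)
  have st: "sets (\<nu>' n) = sets borel" for n
    using \<nu> by (auto simp: \<nu>'_def prob_measures_def)
  interpret product_prob_space \<nu>' "{1..N}" by (rule product_prob_spaceI) (rule ps)
  interpret P: finite_product_prob_space \<nu>' "{1..N}" by standard simp
  have eq: "Pi\<^sub>M {1..N} \<nu> = Pi\<^sub>M {1..N} \<nu>'" by (rule PiM_cong) (auto simp: \<nu>'_def)
  have \<phi>m: "\<phi> n \<in> borel_measurable (\<nu>' n)" if "n \<in> {1..N}" for n
    using \<phi>(1)[OF that] by (subst measurable_cong_sets[OF st refl])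
  let ?S = "\<lambda>y. \<Sum>n=1..N. \<phi> n (y n) - (\<integral>z. \<phi> n z \<partial>\<nu>' n)"
  have "((\<Sum>n=1..N. \<phi> n (y n)) / N - (\<Sum>n=1..N. \<integral>z. \<phi> n z \<partial>\<nu> n) / N)\<^sup>2 = (?S y)\<^sup>2 / (real N)\<^sup>2" for y
    by (simp add: \<nu>'_def sum_subtractf power_divide flip: diff_divide_distrib)
  then have "(\<integral>\<^sup>+y. ennreal (((\<Sum>n=1..N. \<phi> n (y n)) / N - (\<Sum>n=1..N. \<integral>z. \<phi> n z \<partial>\<nu> n) / N)\<^sup>2) \<partial>Pi\<^sub>M {1..N} \<nu>)
    = (\<integral>\<^sup>+y. ennreal ((?S y)\<^sup>2 / (real N)\<^sup>2) \<partial>Pi\<^sub>M {1..N} \<nu>')" by (simp only: eq)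
  also have "\<dots> = ennreal (\<integral>y. (?S y)\<^sup>2 / (real N)\<^sup>2 \<partial>Pi\<^sub>M {1..N} \<nu>')"
  proof (rule nn_integral_eq_integral)
    have "(\<lambda>y. \<phi> n (y n)) \<in> borel_measurable (Pi\<^sub>M {1..N} \<nu>')" if n: "n \<in> {1..N}" for n
      by (rule measurable_compose[OF measurable_component_singleton[OF n, of \<nu>'] \<phi>m[OF n]])
    then have m: "?S \<in> borel_measurable (Pi\<^sub>M {1..N} \<nu>')"
      by (intro borel_measurable_sum borel_measurable_diff borel_measurable_const)
    have bd: "\<bar>?S y\<bar> \<le> 2 * N" for y
    proof -
      have "\<bar>\<phi> n (y n) - (\<integral>z. \<phi> n z \<partial>\<nu>' n)\<bar> \<le> 2" if "n \<in> {1..N}" for n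
      proof -
        have "\<bar>\<integral>z. \<phi> n z \<partial>\<nu>' n\<bar> \<le> 1" by (rule integral_bounds[OF ps refl \<phi>m[OF that]]) (use \<phi> that in auto)
        then show ?thesis using \<phi>(2)[OF that, of "y n"] by linarith
      qed
      then have "(\<Sum>n=1..N. \<bar>\<phi> n (y n) - (\<integral>z. \<phi> n z \<partial>\<nu>' n)\<bar>) \<le> (\<Sum>n=1..N. 2)" by (intro sum_mono) auto
      with sum_abs have "\<bar>?S y\<bar> \<le> (\<Sum>n=1..N. 2)" by (rule order_trans)
      then show ?thesis by simp
    qed
    show "integrable (Pi\<^sub>M {1..N} \<nu>') (\<lambda>y. (?S y)\<^sup>2 / (real N)\<^sup>2)"
    proof (rule P.integrable_const_bound[of _ "(2 * real N)\<^sup>2 / (real N)\<^sup>2"])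
      show "AE y in Pi\<^sub>M {1..N} \<nu>'. norm ((?S y)\<^sup>2 / (real N)\<^sup>2) \<le> (2 * real N)\<^sup>2 / (real N)\<^sup>2"
      proof (rule AE_I2)
        fix y
        have "(?S y)\<^sup>2 \<le> (2 * real N)\<^sup>2" using power_mono[OF bd[of y] abs_ge_zero, of 2] by (simp only: power2_abs of_nat_mult of_nat_numeral)
        then have "(?S y)\<^sup>2 / (real N)\<^sup>2 \<le> (2 * real N)\<^sup>2 / (real N)\<^sup>2" by (rule divide_right_mono) simp
        moreover have "norm ((?S y)\<^sup>2 / (real N)\<^sup>2) = (?S y)\<^sup>2 / (real N)\<^sup>2"
          unfolding real_norm_def by (rule abs_of_nonneg) simp
        ultimately show "norm ((?S y)\<^sup>2 / (real N)\<^sup>2) \<le> (2 * real N)\<^sup>2 / (real N)\<^sup>2" by (simp only:)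
      qed
    qed (use m in measurable)
  qed simp
  also have "\<dots> \<le> ennreal (1 / N)"
  proof (rule ennreal_leI)
    have "(\<integral>y. (?S y)\<^sup>2 / (real N)\<^sup>2 \<partial>Pi\<^sub>M {1..N} \<nu>') = (\<integral>y. (?S y)\<^sup>2 \<partial>Pi\<^sub>M {1..N} \<nu>') / (real N)\<^sup>2" by simp
    also have "\<dots> \<le> card {1..N} / (real N)\<^sup>2"
      by (intro divide_right_mono product_variance) (use \<phi>m \<phi>(2) in auto)
    also have "\<dots> = 1 / N" using N by (simp add: power2_eq_square)
    finally show "(\<integral>y. (?S y)\<^sup>2 / (real N)\<^sup>2 \<partial>Pi\<^sub>M {1..N} \<nu>') \<le> 1 / N" .
  qed
  finally show ?thesis .
qed

text \<open>Each deviation satisfies \<open>\<bar>d\<bar> \<le> d\<^sup>2 / (2 * h) + h / 2\<close>, so the mean of the largest one is bounded by the sum of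
  the variances. The choice \<open>h = card F / sqrt N\<close> makes both terms at most \<open>h / 2\<close>.\<close>

lemma PiM_max_deviation:
  fixes \<phi> :: "'k \<Rightarrow> nat \<Rightarrow> 'x::topological_space \<Rightarrow> real"
  assumes \<nu>: "\<And>n. n \<in> {1..N} \<Longrightarrow> \<nu> n \<in> prob_measures" and N: "1 \<le> N" and F: "finite F"
    and \<phi>: "\<And>k n. k \<in> F \<Longrightarrow> n \<in> {1..N} \<Longrightarrow> \<phi> k n \<in> borel_measurable borel" "\<And>k n y. k \<in> F \<Longrightarrow> n \<in> {1..N} \<Longrightarrow> \<bar>\<phi> k n y\<bar> \<le> 1"
  shows "(\<integral>\<^sup>+y. (SUP k\<in>F. ennreal (1/2 * ((\<Sum>n=1..N. \<phi> k n (y n)) / N - c k))) \<partial>Pi\<^sub>M {1..N} \<nu>)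
    \<le> (SUP k\<in>F. ennreal (1/2 * ((\<Sum>n=1..N. \<integral>z. \<phi> k n z \<partial>\<nu> n) / N - c k))) + ennreal (1/2 * (card F / sqrt N))"
proof (cases "F = {}")
  case True then show ?thesis by (simp add: bot_ennreal)
next
  case False
  define h where "h = card F / sqrt N"
  have card1: "1 \<le> card F" using False F by (simp add: Suc_leI card_gt_0_iff)
  have h: "0 < h" using card1 N by (auto simp: h_def)
  have ps: "prob_space (Pi\<^sub>M {1..N} \<nu>)" "sets (Pi\<^sub>M {1..N} \<nu>) = sets (Pi\<^sub>M {1..N} (\<lambda>_. borel))"
    using PiM_in_prob_algebra(1)[of "{1..N}" \<nu> "\<lambda>_. borel"] \<nu> by (auto simp: prob_measures_eq dest: prob_algebraD)
  interpret prob_space "Pi\<^sub>M {1..N} \<nu>" by (rule ps)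
  define D where "D k y = (\<Sum>n=1..N. \<phi> k n (y n)) / N - (\<Sum>n=1..N. \<integral>z. \<phi> k n z \<partial>\<nu> n) / N" for k y
  define s where "s = (SUP k\<in>F. ennreal (1/2 * ((\<Sum>n=1..N. \<integral>z. \<phi> k n z \<partial>\<nu> n) / N - c k)))"
  have Dm: "D k \<in> borel_measurable (Pi\<^sub>M {1..N} \<nu>)" if "k \<in> F" for k
  proof -
    have "(\<lambda>y. \<phi> k n (y n)) \<in> borel_measurable (Pi\<^sub>M {1..N} (\<lambda>_. borel))" if n: "n \<in> {1..N}" for n
      by (rule measurable_compose[OF measurable_component_singleton[OF n] \<phi>(1)[OF \<open>k \<in> F\<close> n]])
    then show ?thesis
      unfolding D_def measurable_cong_sets[OF ps(2) refl]
      by (intro borel_measurable_diff borel_measurable_divide borel_measurable_sum borel_measurable_const)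
  qed
  have "(SUP k\<in>F. ennreal (1/2 * ((\<Sum>n=1..N. \<phi> k n (y n)) / N - c k)))
    \<le> s + (ennreal (1 / (4 * h)) * (\<Sum>k\<in>F. ennreal ((D k y)\<^sup>2)) + ennreal (h / 4))" for y
  proof (rule SUP_least)
    fix k assume k: "k \<in> F"
    let ?m = "(\<Sum>n=1..N. \<integral>z. \<phi> k n z \<partial>\<nu> n) / N"
    have "0 \<le> (\<bar>D k y\<bar> - h)\<^sup>2" by simp
    then have "2 * h * \<bar>D k y\<bar> \<le> (D k y)\<^sup>2 + h\<^sup>2" by (simp add: power2_diff algebra_simps)
    then have "\<bar>D k y\<bar> \<le> (D k y)\<^sup>2 / (2 * h) + h / 2" using h by (simp add: field_simps power2_eq_square)
    then have "1/2 * ((\<Sum>n=1..N. \<phi> k n (y n)) / N - c k) \<le> 1/2 * (?m - c k) + (1 / (4 * h) * (D k y)\<^sup>2 + h / 4)"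
      unfolding D_def by (simp add: algebra_simps)
    then have "ennreal (1/2 * ((\<Sum>n=1..N. \<phi> k n (y n)) / N - c k)) \<le> ennreal (max 0 (1/2 * (?m - c k)) + (1 / (4 * h) * (D k y)\<^sup>2 + h / 4))"
      by (intro ennreal_leI) linarith
    also have "\<dots> = ennreal (1/2 * (?m - c k)) + (ennreal (1 / (4 * h)) * ennreal ((D k y)\<^sup>2) + ennreal (h / 4))"
    proof -
      have "ennreal (1 / (4 * h) * (D k y)\<^sup>2) = ennreal (1 / (4 * h)) * ennreal ((D k y)\<^sup>2)"
        using h by (intro ennreal_mult) auto
      then have "ennreal (1 / (4 * h) * (D k y)\<^sup>2 + h / 4) = ennreal (1 / (4 * h)) * ennreal ((D k y)\<^sup>2) + ennreal (h / 4)"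
        using h by (subst ennreal_plus) auto
      moreover have "ennreal (max 0 (1/2 * (?m - c k))) = ennreal (1/2 * (?m - c k))" by (rule ennreal_max_0)
      ultimately show ?thesis using h by (subst ennreal_plus) auto
    qed
    also have "\<dots> \<le> s + (ennreal (1 / (4 * h)) * (\<Sum>k\<in>F. ennreal ((D k y)\<^sup>2)) + ennreal (h / 4))"
      unfolding s_def using k F
      by (intro add_mono mult_left_mono SUP_upper order_refl member_le_sum[of k F "\<lambda>k. ennreal ((D k y)\<^sup>2)"]) auto
    finally show "ennreal (1/2 * ((\<Sum>n=1..N. \<phi> k n (y n)) / N - c k))
      \<le> s + (ennreal (1 / (4 * h)) * (\<Sum>k\<in>F. ennreal ((D k y)\<^sup>2)) + ennreal (h / 4))" .
  qed
  then have "(\<integral>\<^sup>+y. (SUP k\<in>F. ennreal (1/2 * ((\<Sum>n=1..N. \<phi> k n (y n)) / N - c k))) \<partial>Pi\<^sub>M {1..N} \<nu>)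
    \<le> (\<integral>\<^sup>+y. s + (ennreal (1 / (4 * h)) * (\<Sum>k\<in>F. ennreal ((D k y)\<^sup>2)) + ennreal (h / 4)) \<partial>Pi\<^sub>M {1..N} \<nu>)"
    by (intro nn_integral_mono)
  also have "\<dots> = s + (ennreal (1 / (4 * h)) * (\<Sum>k\<in>F. \<integral>\<^sup>+y. ennreal ((D k y)\<^sup>2) \<partial>Pi\<^sub>M {1..N} \<nu>) + ennreal (h / 4))"
  proof -
    have D2: "(\<lambda>y. ennreal ((D k y)\<^sup>2)) \<in> borel_measurable (Pi\<^sub>M {1..N} \<nu>)" if "k \<in> F" for k
      using Dm[OF that] by measurable
    have const: "(\<integral>\<^sup>+y. c \<partial>Pi\<^sub>M {1..N} \<nu>) = c" for c
      unfolding nn_integral_const by (simp only: emeasure_space_1 mult_1_right)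
    have sum: "(\<lambda>y. \<Sum>k\<in>F. ennreal ((D k y)\<^sup>2)) \<in> borel_measurable (Pi\<^sub>M {1..N} \<nu>)"
      by (rule borel_measurable_sum[OF D2])
    then have prod: "(\<lambda>y. ennreal (1 / (4 * h)) * (\<Sum>k\<in>F. ennreal ((D k y)\<^sup>2))) \<in> borel_measurable (Pi\<^sub>M {1..N} \<nu>)"
      by (intro borel_measurable_times_ennreal borel_measurable_const)
    show ?thesis
      by (subst nn_integral_add; (intro borel_measurable_add borel_measurable_const prod)?)
         (subst nn_integral_add; (intro borel_measurable_const prod)?; simp only: const nn_integral_cmult[OF sum] nn_integral_sum[OF D2])
  qed
  also have "\<dots> \<le> s + (ennreal (1 / (4 * h)) * (\<Sum>k\<in>F. ennreal (1 / N)) + ennreal (h / 4))"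
    unfolding D_def using \<phi> by (intro add_mono mult_left_mono sum_mono PiM_variance[OF \<nu> N] order_refl) auto
  also have "(\<Sum>k\<in>F. ennreal (1 / N)) = ennreal (card F / N)"
    by (simp add: ennreal_of_nat_eq_real_of_nat flip: ennreal_mult)
  also have "s + (ennreal (1 / (4 * h)) * ennreal (card F / N) + ennreal (h / 4)) = s + ennreal (1 / (4 * h) * (card F / N) + h / 4)"
  proof -
    have "ennreal (1 / (4 * h)) * ennreal (card F / N) = ennreal (1 / (4 * h) * (card F / N))"
      using h by (intro ennreal_mult[symmetric]) auto
    then show ?thesis using h by (subst ennreal_plus) auto
  qed
  also have "\<dots> \<le> s + ennreal (1/2 * h)"
  proof (intro add_left_mono ennreal_leI)
    have "1 / (4 * h) * (card F / N) = 1 / (4 * sqrt N)"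
      using card1 N by (simp add: h_def field_simps flip: real_sqrt_mult)
    also have "\<dots> \<le> h / 4" using card1 N by (simp add: h_def field_simps)
    finally show "1 / (4 * h) * (card F / N) + h / 4 \<le> 1/2 * h" by simp
  qed
  finally show ?thesis unfolding s_def h_def .
qed

text \<open>Off the compact set a test function is replaced by its upper bound 1. In the difference of the integrals this
  leaves only the mass that the second law has outside, which tightness controls; the first law, the random
  one, is not estimated there.\<close>

definition ext_one :: "'x set \<Rightarrow> ('x \<Rightarrow> real) \<Rightarrow> 'x \<Rightarrow> real" where
  "ext_one K g x = (if x \<in> K then g x else 1)"

lemma ext_one_measurable:
  fixes g :: "'x::metric_space \<Rightarrow> real"
  assumes "compact K" "g \<in> C_BL K"
  shows "ext_one K g \<in> borel_measurable borel" "\<bar>ext_one K g x\<bar> \<le> 1"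
proof -
  have g: "1-lipschitz_on K g" "\<And>x. x \<in> K \<Longrightarrow> g x \<in> {-1..1}" using assms(2) by (auto simp: C_BL_def PiE_def Pi_def)
  have "continuous_on K g" by (rule lipschitz_on_continuous_on[OF g(1)])
  then show "ext_one K g \<in> borel_measurable borel"
    unfolding ext_one_def using compact_imp_closed[OF assms(1)]
    by (intro borel_measurable_continuous_on_if) auto
  show "\<bar>ext_one K g x\<bar> \<le> 1" using g(2)[of x] by (auto simp: ext_one_def)
qed

text \<open>The covers whose least cardinality is the covering number.\<close>

definition BL_cover :: "nat \<Rightarrow> 'x::metric_space set \<Rightarrow> ('x \<Rightarrow> real) set \<Rightarrow> bool" where
  "BL_cover j K F \<longleftrightarrow> finite F \<and> F \<subseteq> C_BL K \<and>
     (\<forall>h\<in>C_BL K. \<exists>g\<in>F. (SUP x\<in>K. ennreal \<bar>h x - g x\<bar>) < ennreal (1 / real j))"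

lemma covering_number_eq: "covering_number j K = (INF F\<in>{F. BL_cover j K F}. of_nat (card F))"
  by (simp add: covering_number_def BL_cover_def)

lemma BL_cover_nonempty: "BL_cover j K F \<Longrightarrow> 1 \<le> card F"
proof -
  assume F: "BL_cover j K F"
  have "restrict (\<lambda>_. 0) K \<in> C_BL K" by (auto simp: C_BL_def lipschitz_on_def)
  then have "F \<noteq> {}" using F by (auto simp: BL_cover_def)
  then show ?thesis using F by (simp add: BL_cover_def Suc_leI card_gt_0_iff)
qed

text \<open>Passing from a test function to the centre of its ball changes both integrals by at most \<open>1 / j\<close>, and the
  distance carries the factor 1/2.\<close>

lemma bl_dist_cover:
  fixes \<mu> \<xi> :: "'x::metric_space measure"
  assumes \<mu>: "\<mu> \<in> prob_measures" and \<xi>: "\<xi> \<in> prob_measures"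
    and K: "compact K" and F: "BL_cover j K F" and tight: "measure \<xi> (- K) \<le> r"
  shows "ennreal (bl_dist \<mu> \<xi>) \<le> ennreal (1 / j + r)
    + (SUP g\<in>F. ennreal (1/2 * ((\<integral>x. ext_one K g x \<partial>\<mu>) - (\<integral>x. ext_one K g x \<partial>\<xi>))))"
proof (cases "(SUP g\<in>F. ennreal (1/2 * ((\<integral>x. ext_one K g x \<partial>\<mu>) - (\<integral>x. ext_one K g x \<partial>\<xi>)))) = \<top>")
  case False
  then obtain s where s: "0 \<le> s" "(SUP g\<in>F. ennreal (1/2 * ((\<integral>x. ext_one K g x \<partial>\<mu>) - (\<integral>x. ext_one K g x \<partial>\<xi>)))) = ennreal s"
    by (metis enn2real_nonneg ennreal_enn2real_if)
  have r: "0 \<le> r" using tight measure_nonneg order_trans by blast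
  have "bl_dist \<mu> \<xi> \<le> 1 / j + r + s"
  proof (rule bl_dist_le)
    fix h :: "'x \<Rightarrow> real"
    assume h: "1-lipschitz_on UNIV h" "\<And>x. \<bar>h x\<bar> \<le> 1" and hm: "h \<in> borel_measurable borel"
    have "restrict h K \<in> C_BL K"
      using h lipschitz_on_subset[OF h(1), of K] by (auto simp: C_BL_def lipschitz_on_def abs_le_iff minus_le_iff)
    then obtain g where g: "g \<in> F" "(SUP x\<in>K. ennreal \<bar>restrict h K x - g x\<bar>) < ennreal (1 / j)"
      using F unfolding BL_cover_def by blast
    have close: "\<bar>h x - g x\<bar> \<le> 1 / j" if "x \<in> K" for x
    proof -
      have "ennreal \<bar>h x - g x\<bar> \<le> (SUP x\<in>K. ennreal \<bar>restrict h K x - g x\<bar>)"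
        by (rule SUP_upper2[OF that]) (use that in simp)
      also note g(2)
      finally show ?thesis by (simp add: ennreal_less_iff less_imp_le)
    qed
    have gC: "g \<in> C_BL K" using g F by (auto simp: BL_cover_def)
    note e = ext_one_measurable[OF K gC]
    note i = prob_bounds(2)[OF \<mu> hm h(2)] prob_bounds(2)[OF \<mu> e] prob_bounds(2)[OF \<xi> hm h(2)] prob_bounds(2)[OF \<xi> e]
    interpret \<mu>: prob_space \<mu> by (rule prob_measuresD[OF \<mu>])
    interpret \<xi>: prob_space \<xi> by (rule prob_measuresD[OF \<xi>])
    have K_set: "- K \<in> sets \<xi>" using prob_measuresD(2)[OF \<xi>] compact_imp_closed[OF K] by simp
    have "(\<integral>x. h x \<partial>\<mu>) \<le> (\<integral>x. ext_one K g x + 1 / j \<partial>\<mu>)"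
    proof (rule integral_mono)
      fix x show "h x \<le> ext_one K g x + 1 / j"
        using close[of x] h(2)[of x] by (auto simp: ext_one_def abs_le_iff intro: order_trans add_increasing2)
    qed (use i in auto)
    also have "\<dots> = (\<integral>x. ext_one K g x \<partial>\<mu>) + 1 / j" using i by (simp add: \<mu>.prob_space)
    finally have 1: "(\<integral>x. h x \<partial>\<mu>) \<le> (\<integral>x. ext_one K g x \<partial>\<mu>) + 1 / j" .
    have ind: "integrable \<xi> (\<lambda>x. indicator (- K) x :: real)" using K_set by (simp add: \<xi>.emeasure_eq_measure)
    have "(\<integral>x. ext_one K g x \<partial>\<xi>) \<le> (\<integral>x. h x + (1 / j + 2 * indicator (- K) x) \<partial>\<xi>)"
    proof (rule integral_mono)
      fix x
      show "ext_one K g x \<le> h x + (1 / j + 2 * indicator (- K) x)"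
      proof (cases "x \<in> K")
        case True then show ?thesis using close[of x] by (auto simp: ext_one_def abs_le_iff)
      next
        case False
        have "0 \<le> 1 / real j" by simp
        moreover have "- 1 \<le> h x" using h(2)[of x] by linarith
        ultimately have "1 \<le> h x + (1 / real j + 2)" by linarith
        then show ?thesis using False by (simp add: ext_one_def)
      qed
    qed (use i ind in auto)
    also have "\<dots> = (\<integral>x. h x \<partial>\<xi>) + (1 / j + 2 * measure \<xi> (- K))"
      using i ind K_set by (simp add: \<xi>.prob_space)
    finally have 2: "(\<integral>x. ext_one K g x \<partial>\<xi>) \<le> (\<integral>x. h x \<partial>\<xi>) + (1 / j + 2 * measure \<xi> (- K))" .
    have "ennreal (1/2 * ((\<integral>x. ext_one K g x \<partial>\<mu>) - (\<integral>x. ext_one K g x \<partial>\<xi>))) \<le> ennreal s"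
      unfolding s(2)[symmetric] by (rule SUP_upper[OF g(1)])
    then have "1/2 * ((\<integral>x. ext_one K g x \<partial>\<mu>) - (\<integral>x. ext_one K g x \<partial>\<xi>)) \<le> s"
      by (rule ennreal_le_iff[OF s(1), THEN iffD1])
    then show "1/2 * ((\<integral>x. h x \<partial>\<mu>) - (\<integral>x. h x \<partial>\<xi>)) \<le> 1 / j + r + s"
      using 1 2 tight by (simp add: field_simps)
  qed
  then show ?thesis unfolding s(2) using r s(1) by (simp flip: ennreal_plus add: ennreal_leI)
next
  case True
  show ?thesis unfolding True by simp
qed

text \<open>A nearly optimal choice in the infimum that defines the rate, with a cover of least size. The constant
  \<open>sqrt (pi / 2)\<close> of the rate is estimated from below by 1.\<close>

lemma emp_rate_less:
  fixes K :: "nat \<Rightarrow> 'x::metric_space set"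
  assumes s: "emp_rate K N < s" and N: "1 \<le> N"
  obtains i j F where "1 \<le> i" "1 \<le> j" "BL_cover j (K i) F"
    "ennreal (1 / (2 * real j) + 1 / real i + card F / sqrt N) \<le> s"
proof -
  obtain i j where i: "1 \<le> i" and j: "1 \<le> j"
    and less: "ennreal (1/2 * (1 / real j)) + ennreal (1 / real i)
       + ennreal (sqrt pi) * covering_number j (K i) / ennreal (sqrt (2 * real N)) < s"
    using s unfolding emp_rate_def by (auto simp: INF_less_iff)
  have "covering_number j (K i) \<noteq> \<top>"
  proof
    assume "covering_number j (K i) = \<top>"
    then have "ennreal (sqrt pi) * covering_number j (K i) / ennreal (sqrt (2 * real N)) = \<top>"
      using N by (simp add: ennreal_mult_top ennreal_top_divide)
    then show False using less by simp
  qed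
  then have "{F. BL_cover j (K i) F} \<noteq> {}" by (auto simp: covering_number_eq)
  then obtain F0 where F0: "BL_cover j (K i) F0" by blast
  define k where "k = (LEAST k. \<exists>F. BL_cover j (K i) F \<and> card F = k)"
  have "\<exists>F. BL_cover j (K i) F \<and> card F = k"
    unfolding k_def by (rule LeastI_ex) (use F0 in blast)
  then obtain F where F: "BL_cover j (K i) F" "card F = k" by blast
  have kmin: "k \<le> card F'" if "BL_cover j (K i) F'" for F'
    unfolding k_def by (rule Least_le) (use that in blast)
  have "of_nat (card F) \<le> covering_number j (K i)"
    unfolding covering_number_eq using kmin F(2) by (intro INF_greatest) auto
  then have "ennreal (sqrt pi) * of_nat (card F) / ennreal (sqrt (2 * real N))
    \<le> ennreal (sqrt pi) * covering_number j (K i) / ennreal (sqrt (2 * real N))"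
    by (intro divide_right_mono_ennreal mult_left_mono) auto
  moreover have "ennreal (card F / sqrt N) \<le> ennreal (sqrt pi) * of_nat (card F) / ennreal (sqrt (2 * real N))"
  proof -
    have "sqrt 2 \<le> sqrt pi" using pi_ge_two by simp
    then have "sqrt 2 * card F \<le> sqrt pi * card F" by (intro mult_right_mono) auto
    then have "card F / sqrt N \<le> sqrt pi * card F / sqrt (2 * N)"
      using N by (simp add: real_sqrt_mult field_simps)
    then show ?thesis
      using N by (simp add: ennreal_of_nat_eq_real_of_nat divide_ennreal ennreal_leI flip: ennreal_mult)
  qed
  ultimately have "ennreal (1/2 * (1 / real j)) + ennreal (1 / real i) + ennreal (card F / sqrt N) \<le> s"
    using less by (meson add_left_mono less_imp_le order_trans)
  then have "ennreal (1 / (2 * real j) + 1 / real i + card F / sqrt N) \<le> s"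
    by (simp add: ennreal_plus del: ennreal_plus_if)
  then show ?thesis using that[OF i j F(1)] by blast
qed

section \<open>The mean field flow\<close>

context game_model
begin

definition avg_law :: "(nat \<Rightarrow> 'x measure) \<Rightarrow> 'x measure" where
  "avg_law \<nu> = uniform_count_measure {1..N} \<bind> \<nu>"

lemma avg_law:
  assumes \<nu>: "\<And>n. n \<in> {1..N} \<Longrightarrow> \<nu> n \<in> prob_measures"
  shows "avg_law \<nu> \<in> prob_measures"
    and "\<lbrakk>f \<in> borel_measurable borel; \<And>y. \<bar>f y\<bar> \<le> (C::real)\<rbrakk> \<Longrightarrow>
      (\<integral>y. f y \<partial>avg_law \<nu>) = (\<Sum>n=1..N. \<integral>y. f y \<partial>\<nu> n) / N"
proof -
  let ?U = "uniform_count_measure {1..N}"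
  have U: "?U \<in> space (prob_algebra ?U)"
    using N1 prob_space_uniform_count_measure[of "{1..N}"] by (simp add: space_prob_algebra)
  have "\<nu> \<in> count_space {1..N} \<rightarrow>\<^sub>M prob_algebra borel"
    using \<nu> by (auto simp: prob_measures_eq)
  then have K: "\<nu> \<in> ?U \<rightarrow>\<^sub>M prob_algebra borel"
    by (subst measurable_cong_sets[of _ "count_space {1..N}"]) (auto simp: sets_uniform_count_measure)
  show "avg_law \<nu> \<in> prob_measures"
    unfolding avg_law_def prob_measures_eq by (rule bind_in_prob_algebra[OF U K])
  assume f: "f \<in> borel_measurable borel" "\<And>y. \<bar>f y\<bar> \<le> C"
  have "(\<integral>y. f y \<partial>avg_law \<nu>) = (\<integral>n. (\<integral>y. f y \<partial>\<nu> n) \<partial>?U)"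
    unfolding avg_law_def by (rule integral_bind_kernel[OF U K f(1)]) (rule f(2))
  also have "\<dots> = (\<Sum>n=1..N. \<integral>y. f y \<partial>\<nu> n) / N"
    by (subst integral_uniform_count_measure) auto
  finally show "(\<integral>y. f y \<partial>avg_law \<nu>) = (\<Sum>n=1..N. \<integral>y. f y \<partial>\<nu> n) / N" .
qed

end

text \<open>\<open>mf_law M p t n\<close> is the law at time \<open>t\<close> of a single player who uses \<open>p n\<close> and whose population
  law at each time is the average of these laws over all players. As for the players' chain, time starts at 1.\<close>

primrec mf_law ::
  "('x::polish_space, 'a::polish_space) game \<Rightarrow> (nat \<Rightarrow> nat \<Rightarrow> ('x, 'a) mf_policy) \<Rightarrow> nat \<Rightarrow> nat \<Rightarrow> 'x measure" where
  "mf_law M p 0 = (\<lambda>n. init_law M)"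
| "mf_law M p (Suc t) = (if t = 0 then (\<lambda>n. init_law M)
     else (\<lambda>n. mf_law M p t n \<bind> (\<lambda>x. mixed_kernel M t x (game_model.avg_law M (mf_law M p t))
            (p n t x (game_model.avg_law M (mf_law M p t))))))"

locale mf_model = score_model M c0 c1 \<zeta> for M :: "('x::polish_space, 'a::polish_space) game" and c0 c1 \<zeta> +
  fixes cbar :: real and K :: "nat \<Rightarrow> 'x set" and \<eta> \<theta> \<iota> :: "ennreal \<Rightarrow> ennreal"
    and p :: "nat \<Rightarrow> nat \<Rightarrow> ('x, 'a) mf_policy" and U :: "(nat \<Rightarrow> 'x) \<Rightarrow> real" and V :: "'x \<times> 'x measure \<Rightarrow> real"
  assumes tight: "uniform_tightness M K" and ib: "integral_bound M cbar" and consist: "consistency M"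
    and kernel_cont: "kernel_continuity M \<eta>" and sym: "symmetric_continuity M \<theta> \<iota> p U V"
begin

lemma moduli: "subadditive_modulus \<eta>" "subadditive_modulus \<theta>" "subadditive_modulus \<iota>"
  using kernel_cont sym by (auto simp: kernel_continuity_def symmetric_continuity_def)

lemma p_mod: "n \<in> {1..N} \<Longrightarrow> t \<in> {1..<T} \<Longrightarrow> p n t \<in> mf_policies_mod \<theta>"
  using sym by (auto simp: symmetric_continuity_def mf_profiles_mod_def)

lemma p_measurable:
  assumes "n \<in> {1..N}" "t \<in> {1..<T}"
  shows "(\<lambda>(x, \<xi>). p n t x \<xi>) \<in> borel \<Otimes>\<^sub>M borel_prob \<rightarrow>\<^sub>M borel_prob"
  using p_mod[OF assms] by (simp add: mf_policies_mod_def mf_policies_def)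

lemma p_slice:
  assumes "n \<in> {1..N}" "t \<in> {1..<T}" "\<xi> \<in> prob_measures"
  shows "(\<lambda>x. p n t x \<xi>) \<in> borel \<rightarrow>\<^sub>M borel_prob" "p n t x \<xi> \<in> prob_measures"
proof -
  have "(\<lambda>x. (x, \<xi>)) \<in> (borel :: 'x measure) \<rightarrow>\<^sub>M borel \<Otimes>\<^sub>M (borel_prob :: 'x measure measure)"
    using assms(3) by (intro measurable_Pair measurable_const measurable_ident)
      (simp_all add: space_borel_prob)
  from measurable_compose[OF this p_measurable[OF assms(1,2)]]
  show "(\<lambda>x. p n t x \<xi>) \<in> borel \<rightarrow>\<^sub>M borel_prob" by simp
  from measurable_space[OF this, of x] show "p n t x \<xi> \<in> prob_measures" by (simp add: space_borel_prob)
qed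

definition flow :: "nat \<Rightarrow> 'x measure" where
  "flow t = avg_law (mf_law M p t)"

definition mf_kernel :: "nat \<Rightarrow> nat \<Rightarrow> 'x \<Rightarrow> 'x measure" where
  "mf_kernel n t x = mixed_kernel M t x (flow t) (p n t x (flow t))"

lemma mf_law_Suc: "1 \<le> t \<Longrightarrow> mf_law M p (Suc t) n = mf_law M p t n \<bind> mf_kernel n t"
  by (simp add: mf_kernel_def[abs_def] flow_def)

declare mf_law.simps(2) [simp del]

lemma mf_kernel_measurable:
  assumes "n \<in> {1..N}" "t \<in> {1..<T}" "flow t \<in> prob_measures"
  shows "mf_kernel n t \<in> borel \<rightarrow>\<^sub>M prob_algebra borel"
  unfolding mf_kernel_def[abs_def]
proof (rule mixed_kernel_measurable[OF assms(2) _ _ p_slice(1)[OF assms]])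
  show "(\<lambda>x. flow t) \<in> borel \<rightarrow>\<^sub>M borel_prob" using assms(3) by (simp add: space_borel_prob)
qed simp

lemma mf_law_prob: "t \<in> {1..T} \<Longrightarrow> n \<in> {1..N} \<Longrightarrow> mf_law M p t n \<in> prob_measures"
proof (induction t arbitrary: n)
  case (Suc t)
  show ?case
  proof (cases "t = 0")
    case True then show ?thesis using init_law by (simp add: mf_law.simps)
  next
    case False
    then have t: "t \<in> {1..<T}" using Suc.prems by auto
    have "flow t \<in> prob_measures" unfolding flow_def using t by (intro avg_law(1) Suc.IH) auto
    from bind_in_prob_algebra[OF Suc.IH[unfolded prob_measures_eq] mf_kernel_measurable[OF Suc.prems(2) t this]]
    show ?thesis using t Suc.prems by (simp add: mf_law_Suc prob_measures_eq)
  qed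
qed simp

lemma flow_prob: "t \<in> {1..T} \<Longrightarrow> flow t \<in> prob_measures"
  unfolding flow_def by (intro avg_law(1) mf_law_prob)

lemma integral_flow:
  assumes "t \<in> {1..T}" "f \<in> borel_measurable borel" "\<And>y. \<bar>f y\<bar> \<le> C"
  shows "(\<integral>y. f y \<partial>flow t) = (\<Sum>n=1..N. \<integral>y. f y \<partial>mf_law M p t n) / N"
  unfolding flow_def using assms by (intro avg_law(2) mf_law_prob) auto

lemma mf_trans_step_eq: "mf_trans_step M (p n) flow t f x = (\<integral>y. f y \<partial>mf_kernel n t x)"
  by (simp add: mf_trans_step_def mf_kernel_def)

lemma mf_trans_step_bounded:
  assumes "n \<in> {1..N}" "t \<in> {1..<T}" "f \<in> borel_measurable borel" "\<And>y. \<bar>f y\<bar> \<le> C"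
  shows "mf_trans_step M (p n) flow t f \<in> borel_measurable borel" "\<bar>mf_trans_step M (p n) flow t f x\<bar> \<le> C"
proof -
  have k: "mf_kernel n t \<in> borel \<rightarrow>\<^sub>M prob_algebra borel"
    using assms by (intro mf_kernel_measurable flow_prob) auto
  show "mf_trans_step M (p n) flow t f \<in> borel_measurable borel"
    unfolding mf_trans_step_eq[abs_def] by (rule measurable_integral_kernel[OF k assms(3)])
  show "\<bar>mf_trans_step M (p n) flow t f x\<bar> \<le> C"
    unfolding mf_trans_step_eq
    by (rule integral_bounds[OF _ _ assms(3)]) (use kernelD[OF k, of x] assms(4) in auto)
qed

text \<open>The mean of \<open>f\<close> at time \<open>t\<close> in the mean field chain of player \<open>n\<close> started at time \<open>s\<close>.\<close>

definition bwd :: "nat \<Rightarrow> nat \<Rightarrow> nat \<Rightarrow> ('x \<Rightarrow> real) \<Rightarrow> 'x \<Rightarrow> real" where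
  "bwd n s t f = foldr (mf_trans_step M (p n) flow) [s..<t] f"

lemma bwd_bounded:
  assumes n: "n \<in> {1..N}" and st: "1 \<le> s" "s \<le> t" "t \<le> T" and f: "f \<in> borel_measurable borel" "\<And>y. \<bar>f y\<bar> \<le> C"
  shows "bwd n s t f \<in> borel_measurable borel \<and> (\<forall>x. \<bar>bwd n s t f x\<bar> \<le> C)"
  using st(2,1)
proof (induction rule: inc_induct)
  case base then show ?case using f by (simp add: bwd_def)
next
  case (step m)
  then have IH: "bwd n (Suc m) t f \<in> borel_measurable borel" "\<And>x. \<bar>bwd n (Suc m) t f x\<bar> \<le> C" by auto
  have "bwd n m t f = mf_trans_step M (p n) flow m (bwd n (Suc m) t f)"
    using step by (simp add: bwd_def foldr_upt_step)
  then show ?case using mf_trans_step_bounded[OF n _ IH, of m] step st by auto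
qed

lemma bwd_step: "s < t \<Longrightarrow> bwd n s t f x = (\<integral>y. bwd n (Suc s) t f y \<partial>mf_kernel n s x)"
  by (simp add: bwd_def foldr_upt_step mf_trans_step_eq)

lemma integral_mf_law:
  assumes n: "n \<in> {1..N}"
  shows "\<lbrakk>t \<in> {1..T}; f \<in> borel_measurable borel; \<And>y. \<bar>f y\<bar> \<le> C\<rbrakk> \<Longrightarrow>
    (\<integral>y. f y \<partial>mf_law M p t n) = (\<integral>x. bwd n 1 t f x \<partial>init_law M)"
proof (induction t arbitrary: f)
  case (Suc t)
  show ?case
  proof (cases "t = 0")
    case True then show ?thesis by (simp add: mf_law.simps bwd_def)
  next
    case False
    then have t: "t \<in> {1..<T}" using Suc.prems by auto
    have k: "mf_kernel n t \<in> borel \<rightarrow>\<^sub>M prob_algebra borel"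
      using n t by (intro mf_kernel_measurable flow_prob) auto
    have "(\<integral>y. f y \<partial>mf_law M p (Suc t) n) = (\<integral>x. (\<integral>y. f y \<partial>mf_kernel n t x) \<partial>mf_law M p t n)"
      unfolding mf_law_Suc[of t, OF atLeastLessThan_iff[THEN iffD1, OF t, THEN conjunct1]]
      by (rule integral_bind_kernel[OF _ k Suc.prems(2)])
         (use mf_law_prob[of t n] n t Suc.prems(3) in \<open>auto simp: prob_measures_eq\<close>)
    also have "\<dots> = (\<integral>x. mf_trans_step M (p n) flow t f x \<partial>mf_law M p t n)"
      by (simp add: mf_trans_step_eq)
    also have "\<dots> = (\<integral>x. bwd n 1 t (mf_trans_step M (p n) flow t f) x \<partial>init_law M)"
      using t by (intro Suc.IH mf_trans_step_bounded[OF n t Suc.prems(2,3)]) auto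
    also have "bwd n 1 t (mf_trans_step M (p n) flow t f) = bwd n 1 (Suc t) f"
      using t by (simp add: bwd_def)
    finally show ?thesis .
  qed
qed simp

text \<open>The flow is the average of laws to which the tightness assumption applies, taken along the flow itself.\<close>

lemma flow_tight:
  assumes t: "t \<in> {1..T}" and i: "1 \<le> i"
  shows "measure (flow t) (- K i) \<le> 1 / i"
proof -
  have cl: "closed (K i)" using tight i by (auto simp: uniform_tightness_def intro: compact_imp_closed)
  then have m: "indicator (- K i) \<in> borel_measurable (borel :: 'x measure)" by simp
  have le: "(\<integral>y. indicator (- K i) y \<partial>mf_law M p t n) \<le> 1 / real i" if n: "n \<in> {1..N}" for n
  proof -
    have "(\<integral>y. indicator (- K i) y \<partial>mf_law M p t n) = mf_prob M (p n) flow t (- K i)"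
      using integral_mf_law[OF n t m, of 1] by (simp add: mf_prob_def mf_trans_op_def bwd_def)
    moreover have "\<forall>s\<in>{1..<T}. flow s \<in> prob_measures \<and> p n s \<in> mf_policies"
      using flow_prob p_mod[OF n] by (auto simp: mf_policies_mod_def)
    ultimately show ?thesis using tight t i unfolding uniform_tightness_def by metis
  qed
  have "measure (flow t) (- K i) = (\<integral>y. indicator (- K i) y \<partial>flow t)"
    using prob_measuresD[OF flow_prob[OF t]] cl by simp
  also have "\<dots> = (\<Sum>n=1..N. \<integral>y. indicator (- K i) y \<partial>mf_law M p t n) / N"
    by (rule integral_flow[OF t m, of 1]) auto
  also have "\<dots> \<le> (\<Sum>n=1..N. 1 / real i) / N" by (intro divide_right_mono sum_mono le) auto
  also have "\<dots> = 1 / i" using N1 by simp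
  finally show ?thesis .
qed

section \<open>Bias of the players against the mean field\<close>

definition Z :: "nat \<Rightarrow> (nat \<Rightarrow> 'x) \<Rightarrow> ennreal" where
  "Z t x = ennreal (bl_dist (empirical M x) (flow t))"

lemma Z_measurable: "t \<in> {1..T} \<Longrightarrow> Z t \<in> borel_measurable ST"
  unfolding Z_def[abs_def] using bl_empirical_measurable[OF flow_prob] by simp

text \<open>The constraint under the infimum in the error terms.\<close>

definition admissible :: "real \<Rightarrow> bool" where
  "admissible L \<longleftrightarrow> 0 < L \<and> 1 + \<eta> (ennreal (2 / L)) < ennreal L"

lemma admissibleD:
  assumes "admissible L" shows "1 < L" "\<eta> (ennreal (2 / L)) < \<top>"
proof -
  have *: "1 + \<eta> (ennreal (2 / L)) < ennreal L" using assms by (simp add: admissible_def)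
  have "ennreal 1 \<le> 1 + \<eta> (ennreal (2 / L))" by simp
  with * have "ennreal 1 < ennreal L" by (rule le_less_trans[rotated])
  then show "1 < L" by (simp add: ennreal_less_iff)
  have "\<eta> (ennreal (2 / L)) \<le> 1 + \<eta> (ennreal (2 / L))" by simp
  also note *
  finally show "\<eta> (ennreal (2 / L)) < \<top>" by (rule less_trans) simp
qed

text \<open>Up to the regularisation error \<open>\<eta> (2 / L)\<close>, the bias of one transition as a function of the distance to the
  flow.\<close>

definition drift :: "real \<Rightarrow> ennreal \<Rightarrow> ennreal" where
  "drift L z = ennreal L * \<theta> z + \<eta> z"

lemma drift_modulus: "subadditive_modulus (drift L)"
  unfolding drift_def[abs_def] by (intro modulus_add modulus_cmult moduli)

text \<open>All comparisons are made along chains in which at most player 1 deviates from \<open>p\<close>.\<close>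

definition follows :: "(nat \<Rightarrow> nat \<Rightarrow> ('x, 'a) policy) \<Rightarrow> bool" where
  "follows \<QQ> \<longleftrightarrow> \<QQ> \<in> profiles M \<and> (\<forall>n\<in>{2..N}. \<forall>t\<in>{1..<T}. \<forall>x\<in>space ST. \<QQ> n t x = p n t (x n) (empirical M x))"

lemma follows_profile: "follows \<QQ> \<Longrightarrow> \<QQ> \<in> profiles M"
  by (simp add: follows_def)

lemma law_prob: "follows \<QQ> \<Longrightarrow> t \<in> {1..T} \<Longrightarrow> state_law M \<QQ> t \<in> space (prob_algebra ST)"
  by (rule state_law_prob[OF follows_profile]) simp_all

lemma nn_integral_law_const: "follows \<QQ> \<Longrightarrow> t \<in> {1..T} \<Longrightarrow> (\<integral>\<^sup>+x. c \<partial>state_law M \<QQ> t) = c"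
  using prob_space.emeasure_space_1[OF prob_algebraD(1)[OF law_prob]] by simp

lemma law_measurable:
  "follows \<QQ> \<Longrightarrow> t \<in> {1..T} \<Longrightarrow> f \<in> borel_measurable ST \<Longrightarrow> f \<in> borel_measurable (state_law M \<QQ> t)"
  by (subst measurable_cong_sets[OF prob_algebraD(2)[OF law_prob] refl])

lemma modulus_Z_measurable: "subadditive_modulus \<beta> \<Longrightarrow> s \<in> {1..T} \<Longrightarrow> (\<lambda>x. \<beta> (Z s x)) \<in> borel_measurable ST"
  by (rule measurable_compose[OF Z_measurable modulus_measurable])

abbreviation "EZ \<QQ> t \<beta> \<equiv> \<integral>\<^sup>+x. \<beta> (Z t x) \<partial>state_law M \<QQ> t"

abbreviation "rate i j F \<equiv> 1 / (2 * real j) + 1 / real i + card F / sqrt N"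

text \<open>The transition law of a player differs from the mean field one in two ways. Changing the population law costs
  \<open>\<eta>\<close>. Changing the action law costs \<open>L * \<theta> + \<eta> (2 / L)\<close>: the mean transition is a function of the action with
  modulus \<open>\<eta>\<close>, so its Lipschitz regularisation applies.\<close>

lemma bias_player:
  assumes L: "admissible L" and n: "n \<in> {1..N}" and t: "t \<in> {1..<T}"
    and f: "f \<in> borel_measurable borel" "\<And>y. \<bar>f y\<bar> \<le> 1"
  shows "ennreal (1/2 * ((\<integral>y. f y \<partial>mixed_kernel M t (x n) (empirical M x) (p n t (x n) (empirical M x)))
      - (\<integral>y. f y \<partial>mf_kernel n t (x n)))) \<le> drift L (Z t x) + \<eta> (ennreal (2 / L))"
proof (cases "\<eta> (Z t x) = \<top> \<or> \<theta> (Z t x) = \<top>")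
  case True
  then have "drift L (Z t x) = \<top>"
    using admissibleD(1)[OF L] by (auto simp: drift_def ennreal_mult_top)
  then show ?thesis by simp
next
  case False
  define \<mu> where "\<mu> = empirical M x"
  define \<xi> where "\<xi> = flow t"
  define l1 l2 where "l1 = p n t (x n) \<mu>" and "l2 = p n t (x n) \<xi>"
  have pm: "\<mu> \<in> prob_measures" "\<xi> \<in> prob_measures" unfolding \<mu>_def \<xi>_def using empirical_prob flow_prob t by auto
  have l: "l1 \<in> prob_measures" "l2 \<in> prob_measures"
    unfolding l1_def l2_def using pm by (intro p_slice(2)[OF n t]; simp)+
  obtain e1 where e1: "0 \<le> e1" "\<eta> (Z t x) = ennreal e1" using False by (cases "\<eta> (Z t x)") auto
  obtain e2 where e2: "0 \<le> e2" "\<theta> (Z t x) = ennreal e2" using False by (cases "\<theta> (Z t x)") auto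
  obtain \<omega> where \<omega>: "0 \<le> \<omega>" "\<eta> (ennreal (2 / L)) = ennreal \<omega>"
    using admissibleD(2)[OF L] by (cases "\<eta> (ennreal (2 / L))") auto
  have L1: "1 < L" by (rule admissibleD(1)[OF L])
  let ?P = "\<lambda>\<nu> a. \<integral>y. f y \<partial>trans_kernel M t (x n) \<nu> a"
  have Pprob: "trans_kernel M t (x n) \<nu> a \<in> prob_measures" if "\<nu> \<in> prob_measures" for \<nu> a
    using measurable_space[OF trans_kernel_measurable[OF t that], of a "x n"] by (simp add: prob_measures_eq)
  have Pm: "?P \<nu> \<in> borel_measurable borel" if "\<nu> \<in> prob_measures" for \<nu>
    by (rule measurable_integral_kernel[OF trans_kernel_measurable[OF t that] f(1)])
  have Pb: "\<bar>?P \<nu> a\<bar> \<le> 1" if "\<nu> \<in> prob_measures" for \<nu> a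
    by (rule prob_bounds(1)[OF Pprob[OF that] f])
  have tv: "?P \<nu> a - ?P \<nu>' a' \<le> 2 * b"
    if "\<nu> \<in> prob_measures" "\<nu>' \<in> prob_measures" "\<eta> (ennreal (dist a a')) + \<eta> (ennreal (bl_dist \<nu> \<nu>')) \<le> ennreal b" "0 \<le> b" for \<nu> \<nu>' a a' b
  proof -
    have "ennreal (tv_dist (trans_kernel M t (x n) \<nu> a) (trans_kernel M t (x n) \<nu>' a')) \<le> ennreal b"
    proof (rule order_trans[OF _ that(3)])
      show "ennreal (tv_dist (trans_kernel M t (x n) \<nu> a) (trans_kernel M t (x n) \<nu>' a'))
        \<le> \<eta> (ennreal (dist a a')) + \<eta> (ennreal (bl_dist \<nu> \<nu>'))"
        using kernel_cont t that(1,2) unfolding kernel_continuity_def by blast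
    qed
    then have "tv_dist (trans_kernel M t (x n) \<nu> a) (trans_kernel M t (x n) \<nu>' a') \<le> b" using that(4) by (simp add: ennreal_le_iff)
    with tv_dist_ge[OF Pprob[OF that(1)] Pprob[OF that(2)] f, of a a'] show ?thesis by linarith
  qed
  have 1: "(\<integral>a. ?P \<mu> a \<partial>l1) \<le> (\<integral>a. ?P \<xi> a \<partial>l1) + 2 * e1"
  proof -
    interpret prob_space l1 by (rule prob_measuresD[OF l(1)])
    note i = prob_bounds(2)[OF l(1) Pm[OF pm(1)] Pb[OF pm(1)]] prob_bounds(2)[OF l(1) Pm[OF pm(2)] Pb[OF pm(2)]]
    have "?P \<mu> a \<le> ?P \<xi> a + 2 * e1" for a
      using tv[OF pm, of a a e1] e1 by (simp add: modulus_0[OF moduli(1)] Z_def \<mu>_def \<xi>_def)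
    then have "(\<integral>a. ?P \<mu> a \<partial>l1) \<le> (\<integral>a. ?P \<xi> a + 2 * e1 \<partial>l1)" by (intro integral_mono) (use i in auto)
    then show ?thesis using i by (simp add: prob_space)
  qed
  have 2: "(\<integral>a. ?P \<xi> a \<partial>l1) - (\<integral>a. ?P \<xi> a \<partial>l2) \<le> 2 * (L * bl_dist l1 l2 + \<omega>)"
  proof (rule bl_dist_modulus[OF l Pm[OF pm(2)] Pb[OF pm(2)] L1 _ \<omega>(1)])
    fix a b :: 'a assume "dist a b \<le> 2 / L"
    then have "\<eta> (ennreal (dist a b)) \<le> ennreal \<omega>" unfolding \<omega>(2)[symmetric] by (intro modulusD(1)[OF moduli(1)] ennreal_leI)
    then show "?P \<xi> a - ?P \<xi> b \<le> 2 * \<omega>"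
      by (intro tv[OF pm(2,2)]) (simp_all add: bl_dist_self[OF pm(2)] modulus_0[OF moduli(1)] \<omega>(1))
  qed
  have 3: "bl_dist l1 l2 \<le> e2"
  proof -
    have "ennreal (bl_dist l1 l2) \<le> \<theta> (ennreal (bl_dist \<mu> \<xi>))"
      using p_mod[OF n t] pm unfolding mf_policies_mod_def l1_def l2_def by blast
    also have "\<dots> = ennreal e2" using e2(2) by (simp add: Z_def \<mu>_def \<xi>_def)
    finally show ?thesis using e2(1) by (simp add: ennreal_le_iff)
  qed
  have "(\<integral>y. f y \<partial>mixed_kernel M t (x n) \<mu> l1) - (\<integral>y. f y \<partial>mf_kernel n t (x n)) \<le> 2 * (L * e2 + e1 + \<omega>)"
    unfolding mf_kernel_def \<xi>_def[symmetric] l2_def[symmetric]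
      integral_mixed_kernel[OF t pm(1) l(1) f] integral_mixed_kernel[OF t pm(2) l(2) f]
  proof -
    have "L * bl_dist l1 l2 \<le> L * e2" using 3 L1 by (intro mult_left_mono) auto
    moreover have "A - C \<le> 2 * (Y + e1 + \<omega>)" if "A \<le> B + 2 * e1" "B - C \<le> 2 * (X + \<omega>)" "X \<le> Y" for A B C X Y :: real
      using that unfolding distrib_left by linarith
    ultimately show "(\<integral>a. ?P \<mu> a \<partial>l1) - (\<integral>a. ?P \<xi> a \<partial>l2) \<le> 2 * (L * e2 + e1 + \<omega>)" using 1 2 by blast
  qed
  then have "ennreal (1/2 * ((\<integral>y. f y \<partial>mixed_kernel M t (x n) \<mu> l1) - (\<integral>y. f y \<partial>mf_kernel n t (x n)))) \<le> ennreal (L * e2 + e1 + \<omega>)"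
    by (intro ennreal_leI) simp
  also have "\<dots> = drift L (Z t x) + \<eta> (ennreal (2 / L))"
    using e1 e2 \<omega> L1 by (simp add: drift_def ennreal_plus ennreal_mult del: ennreal_plus_if)
  finally show ?thesis unfolding \<mu>_def l1_def .
qed

text \<open>Player 1 may deviate in any way, which moves an average over \<open>N\<close> players by at most \<open>2 / N\<close>. The constant
  \<open>c\<close> is the value with which the averages are compared.\<close>

lemma bias_average:
  assumes Q: "follows \<QQ>" and L: "admissible L" and t: "t \<in> {1..<T}" and x: "x \<in> space ST"
    and f: "\<And>n. n \<in> {1..N} \<Longrightarrow> f n \<in> borel_measurable borel" "\<And>n y. n \<in> {1..N} \<Longrightarrow> \<bar>f n y\<bar> \<le> 1"
  shows "ennreal (1/2 * ((\<Sum>n=1..N. \<integral>y. f n y \<partial>mixed_kernel M t (x n) (empirical M x) (\<QQ> n t x)) / N - c))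
    \<le> ennreal (1/2 * ((\<Sum>n=1..N. \<integral>y. f n y \<partial>mf_kernel n t (x n)) / N - c))
      + (ennreal (1 / N) + (drift L (Z t x) + \<eta> (ennreal (2 / L))))"
proof (cases "drift L (Z t x) + \<eta> (ennreal (2 / L))")
  case (real b)
  let ?q = "\<lambda>n. \<integral>y. f n y \<partial>mixed_kernel M t (x n) (empirical M x) (\<QQ> n t x)"
  let ?m = "\<lambda>n. \<integral>y. f n y \<partial>mf_kernel n t (x n)"
  have "?q n \<le> ?m n + (2 * b + (if n = 1 then 2 else 0))" if n: "n \<in> {1..N}" for n
  proof (cases "n = 1")
    case True
    have QQ: "\<QQ> n t x \<in> prob_measures" using Q profileD(2)[OF _ n t x] by (simp add: follows_def)
    have fl: "flow t \<in> prob_measures" using flow_prob t by auto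
    have "\<bar>?q n\<bar> \<le> 1" "\<bar>?m n\<bar> \<le> 1"
      unfolding mf_kernel_def
      by (intro prob_bounds(1)[OF _ f(1)[OF n]] mixed_kernel_prob[OF t] empirical_prob QQ fl p_slice(2)[OF n t] f(2)[OF n])+
    then show ?thesis using True real(1) by auto
  next
    case False
    then have "\<QQ> n t x = p n t (x n) (empirical M x)" using Q n t x by (auto simp: follows_def)
    with bias_player[OF L n t f(1)[OF n] f(2)[OF n], of x] have "ennreal (1/2 * (?q n - ?m n)) \<le> ennreal b" by (simp add: real)
    then have "1/2 * (?q n - ?m n) \<le> b" by (rule ennreal_le_iff[OF real(1), THEN iffD1])
    then show ?thesis using False by simp
  qed
  then have "(\<Sum>n=1..N. ?q n) \<le> (\<Sum>n=1..N. ?m n + (2 * b + (if n = 1 then 2 else 0)))" by (rule sum_mono)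
  also have "\<dots> = (\<Sum>n=1..N. ?m n) + (2 * b * N + 2)"
    using N1 by (simp add: sum.distrib sum.delta)
  finally have "(\<Sum>n=1..N. ?q n) / N \<le> ((\<Sum>n=1..N. ?m n) + (2 * b * N + 2)) / N" by (intro divide_right_mono) auto
  also have "\<dots> = (\<Sum>n=1..N. ?m n) / N + 2 * (1 / N + b)" using N1 by (simp add: field_simps)
  finally have "(\<Sum>n=1..N. ?q n) / N \<le> (\<Sum>n=1..N. ?m n) / N + 2 * (1 / N + b)" .
  moreover have "1/2 * (a - c) \<le> 1/2 * (m - c) + d" if "a \<le> m + 2 * d" for a m d :: real
    using that by (simp add: field_simps)
  ultimately have "1/2 * ((\<Sum>n=1..N. ?q n) / N - c) \<le> 1/2 * ((\<Sum>n=1..N. ?m n) / N - c) + (1 / N + b)" by blast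
  then have "ennreal (1/2 * ((\<Sum>n=1..N. ?q n) / N - c)) \<le> ennreal (max 0 (1/2 * ((\<Sum>n=1..N. ?m n) / N - c)) + (1 / N + b))"
    by (intro ennreal_leI) linarith
  also have "\<dots> = ennreal (max 0 (1/2 * ((\<Sum>n=1..N. ?m n) / N - c))) + (ennreal (1 / N) + ennreal b)"
    using real(1) by (simp add: ennreal_plus del: ennreal_plus_if)
  also have "ennreal (max 0 (1/2 * ((\<Sum>n=1..N. ?m n) / N - c))) = ennreal (1/2 * ((\<Sum>n=1..N. ?m n) / N - c))"
    by (rule ennreal_max_0)
  finally show ?thesis unfolding real(2) .
next
  case top
  show ?thesis unfolding top by simp
qed

section \<open>Propagation of chaos\<close>

text \<open>Given the states at time \<open>s\<close>: half of the largest excess, over the centres of the cover, of the players' average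
  mean field prediction for time \<open>t\<close> over the value of the flow. At \<open>s = t\<close> it bounds the distance to the flow
  up to the covering radius and the mass outside the compact set, and at \<open>s = 1\<close> the prediction is centred.\<close>

definition \<Psi> :: "nat \<Rightarrow> ('x \<Rightarrow> real) set \<Rightarrow> 'x set \<Rightarrow> nat \<Rightarrow> (nat \<Rightarrow> 'x) \<Rightarrow> ennreal" where
  "\<Psi> t F A s x = (SUP g\<in>F. ennreal (1/2 * ((\<Sum>n=1..N. bwd n s t (ext_one A g) (x n)) / N - (\<integral>y. ext_one A g y \<partial>flow t))))"

context
  fixes i j F \<QQ>
  assumes ij: "1 \<le> i" "1 \<le> j" and cover: "BL_cover j (K i) F" and Q: "follows \<QQ>"
begin

lemma K_compact: "compact (K i)" using tight ij(1) by (auto simp: uniform_tightness_def)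

lemma F_facts: "finite F" "\<And>g. g \<in> F \<Longrightarrow> g \<in> C_BL (K i)" "1 \<le> card F"
  using cover BL_cover_nonempty[OF cover] by (auto simp: BL_cover_def)

lemma ext_bounds: "g \<in> F \<Longrightarrow> ext_one (K i) g \<in> borel_measurable borel" "g \<in> F \<Longrightarrow> \<bar>ext_one (K i) g y\<bar> \<le> 1"
  using ext_one_measurable[OF K_compact F_facts(2)] by auto

lemma bwd_ext:
  assumes "g \<in> F" "n \<in> {1..N}" "1 \<le> s" "s \<le> t" "t \<le> T"
  shows "bwd n s t (ext_one (K i) g) \<in> borel_measurable borel" "\<bar>bwd n s t (ext_one (K i) g) y\<bar> \<le> 1"
  using bwd_bounded[OF assms(2-5) ext_bounds(1)[OF assms(1)], of 1] ext_bounds(2)[OF assms(1)] by auto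

lemma Z_le_\<Psi>:
  assumes t: "t \<in> {1..T}"
  shows "Z t x \<le> ennreal (1 / j + 1 / i) + \<Psi> t F (K i) t x"
proof -
  have "Z t x \<le> ennreal (1 / j + 1 / i) + (SUP g\<in>F. ennreal (1/2 * ((\<integral>y. ext_one (K i) g y \<partial>empirical M x) - (\<integral>y. ext_one (K i) g y \<partial>flow t))))"
    unfolding Z_def by (rule bl_dist_cover[OF empirical_prob flow_prob[OF t] K_compact cover flow_tight[OF t ij(1)]])
  also have "(SUP g\<in>F. ennreal (1/2 * ((\<integral>y. ext_one (K i) g y \<partial>empirical M x) - (\<integral>y. ext_one (K i) g y \<partial>flow t)))) = \<Psi> t F (K i) t x"
    unfolding \<Psi>_def using ext_bounds(1) by (intro SUP_cong) (simp_all add: integral_empirical bwd_def)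
  finally show ?thesis .
qed

lemma \<Psi>_measurable:
  assumes "1 \<le> s" "s \<le> t" "t \<le> T"
  shows "\<Psi> t F (K i) s \<in> borel_measurable ST"
proof -
  have "(\<lambda>x. bwd n s t (ext_one (K i) g) (x n)) \<in> borel_measurable ST" if "g \<in> F" "n \<in> {1..N}" for g n
    by (rule measurable_compose[OF component_measurable[OF that(2)] bwd_ext(1)[OF that assms]])
  then have "(\<lambda>x. ennreal (1/2 * ((\<Sum>n=1..N. bwd n s t (ext_one (K i) g) (x n)) / N - (\<integral>y. ext_one (K i) g y \<partial>flow t)))) \<in> borel_measurable ST" if "g \<in> F" for g
    using that by (intro measurable_compose[OF _ measurable_ennreal] borel_measurable_times borel_measurable_diff borel_measurable_divide borel_measurable_sum borel_measurable_const)
  then show ?thesis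
    unfolding \<Psi>_def[abs_def] using F_facts(1) by (intro borel_measurable_SUP countable_finite)
qed

abbreviation "h \<equiv> card F / sqrt N"

lemma \<Psi>_init:
  assumes t: "t \<in> {1..T}"
  shows "(\<integral>\<^sup>+x. \<Psi> t F (K i) 1 x \<partial>state_law M \<QQ> 1) \<le> ennreal (1/2 * h)"
proof -
  have "(\<integral>\<^sup>+x. \<Psi> t F (K i) 1 x \<partial>state_law M \<QQ> 1)
    \<le> (SUP g\<in>F. ennreal (1/2 * ((\<Sum>n=1..N. \<integral>z. bwd n 1 t (ext_one (K i) g) z \<partial>init_law M) / N - (\<integral>y. ext_one (K i) g y \<partial>flow t))))
      + ennreal (1/2 * h)"
    unfolding \<Psi>_def state_law.simps One_nat_def init_tuple_law_def if_True simp_thms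
    unfolding One_nat_def[symmetric]
    by (rule PiM_max_deviation[OF init_law N1 F_facts(1)]) (use bwd_ext t in auto)
  also have "(SUP g\<in>F. ennreal (1/2 * ((\<Sum>n=1..N. \<integral>z. bwd n 1 t (ext_one (K i) g) z \<partial>init_law M) / N - (\<integral>y. ext_one (K i) g y \<partial>flow t)))) = 0"
  proof -
    have "(\<integral>y. ext_one (K i) g y \<partial>flow t) = (\<Sum>n=1..N. \<integral>z. bwd n 1 t (ext_one (K i) g) z \<partial>init_law M) / N" if "g \<in> F" for g
      using integral_flow[OF t ext_bounds[OF that]] integral_mf_law[OF _ t ext_bounds[OF that]] by simp
    moreover have "F \<noteq> {}" using F_facts(3) by auto
    ultimately show ?thesis by (simp cong: SUP_cong)
  qed
  finally show ?thesis by simp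
qed

text \<open>Conditionally on the present, the players move independently. Replacing their transition laws by the mean
  field ones costs the bias, and the fluctuation of the move costs half of \<open>card F / sqrt N\<close>.\<close>

lemma \<Psi>_step:
  assumes L: "admissible L" and s: "1 \<le> s" "s < t" "t \<le> T" and x: "x \<in> space ST"
  shows "(\<integral>\<^sup>+y. \<Psi> t F (K i) (Suc s) y \<partial>next_law M s (\<lambda>n. \<QQ> n s x) x)
    \<le> \<Psi> t F (K i) s x + (ennreal (1 / N) + (drift L (Z s x) + \<eta> (ennreal (2 / L)))) + ennreal (1/2 * h)"
proof -
  have s': "s \<in> {1..<T}" using s by auto
  let ?\<nu> = "\<lambda>n. mixed_kernel M s (x n) (empirical M x) (\<QQ> n s x)"
  have \<nu>: "?\<nu> n \<in> prob_measures" if "n \<in> {1..N}" for n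
    using Q profileD(2)[OF _ that s' x] by (intro mixed_kernel_prob[OF s' empirical_prob]) (simp add: follows_def)
  have "(\<integral>\<^sup>+y. \<Psi> t F (K i) (Suc s) y \<partial>next_law M s (\<lambda>n. \<QQ> n s x) x)
    \<le> (SUP g\<in>F. ennreal (1/2 * ((\<Sum>n=1..N. \<integral>z. bwd n (Suc s) t (ext_one (K i) g) z \<partial>?\<nu> n) / N - (\<integral>y. ext_one (K i) g y \<partial>flow t))))
      + ennreal (1/2 * h)"
    unfolding \<Psi>_def next_law_def
    by (rule PiM_max_deviation[OF \<nu> N1 F_facts(1)]) (use bwd_ext s in auto)
  also have "(SUP g\<in>F. ennreal (1/2 * ((\<Sum>n=1..N. \<integral>z. bwd n (Suc s) t (ext_one (K i) g) z \<partial>?\<nu> n) / N - (\<integral>y. ext_one (K i) g y \<partial>flow t))))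
    \<le> \<Psi> t F (K i) s x + (ennreal (1 / N) + (drift L (Z s x) + \<eta> (ennreal (2 / L))))"
  proof (rule SUP_least)
    fix g assume g: "g \<in> F"
    have "ennreal (1/2 * ((\<Sum>n=1..N. \<integral>z. bwd n (Suc s) t (ext_one (K i) g) z \<partial>?\<nu> n) / N - (\<integral>y. ext_one (K i) g y \<partial>flow t)))
      \<le> ennreal (1/2 * ((\<Sum>n=1..N. \<integral>z. bwd n (Suc s) t (ext_one (K i) g) z \<partial>mf_kernel n s (x n)) / N - (\<integral>y. ext_one (K i) g y \<partial>flow t)))
        + (ennreal (1 / N) + (drift L (Z s x) + \<eta> (ennreal (2 / L))))"
      by (rule bias_average[OF Q L s' x]) (use bwd_ext[OF g] s in auto)
    also have "ennreal (1/2 * ((\<Sum>n=1..N. \<integral>z. bwd n (Suc s) t (ext_one (K i) g) z \<partial>mf_kernel n s (x n)) / N - (\<integral>y. ext_one (K i) g y \<partial>flow t)))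
      \<le> \<Psi> t F (K i) s x"
      unfolding \<Psi>_def using s(2) by (intro SUP_upper2[OF g]) (simp add: bwd_step)
    finally show "ennreal (1/2 * ((\<Sum>n=1..N. \<integral>z. bwd n (Suc s) t (ext_one (K i) g) z \<partial>?\<nu> n) / N - (\<integral>y. ext_one (K i) g y \<partial>flow t)))
      \<le> \<Psi> t F (K i) s x + (ennreal (1 / N) + (drift L (Z s x) + \<eta> (ennreal (2 / L))))" by (simp add: add_right_mono)
  qed
  finally show ?thesis by (simp add: add_right_mono)
qed

lemma \<Psi>_bound:
  assumes L: "admissible L" and t: "t \<in> {1..T}"
  shows "1 \<le> s \<Longrightarrow> s \<le> t \<Longrightarrow> (\<integral>\<^sup>+x. \<Psi> t F (K i) s x \<partial>state_law M \<QQ> s)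
    \<le> of_nat s * ennreal (1/2 * h) + (\<Sum>r=1..<s. ennreal (1 / N) + ((EZ \<QQ> r (drift L)) + \<eta> (ennreal (2 / L))))"
proof (induction s rule: nat_induct_at_least)
  case base then show ?case using \<Psi>_init[OF t] by simp
next
  case (Suc s)
  then have s: "1 \<le> s" "s < t" "t \<le> T" "s \<in> {1..T}" "s \<in> {1..<T}" using t by auto
  let ?\<mu> = "state_law M \<QQ> s"
  have "(\<integral>\<^sup>+x. \<Psi> t F (K i) (Suc s) x \<partial>state_law M \<QQ> (Suc s))
    = (\<integral>\<^sup>+x. (\<integral>\<^sup>+y. \<Psi> t F (K i) (Suc s) y \<partial>next_law M s (\<lambda>n. \<QQ> n s x) x) \<partial>?\<mu>)"
    by (rule nn_integral_state_law_Suc[OF s(5) follows_profile[OF Q] \<Psi>_measurable]) (use s in auto)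
  also have "\<dots> \<le> (\<integral>\<^sup>+x. \<Psi> t F (K i) s x + (ennreal (1 / N) + (drift L (Z s x) + \<eta> (ennreal (2 / L)))) + ennreal (1/2 * h) \<partial>?\<mu>)"
    using \<Psi>_step[OF L s(1-3)] prob_algebraD(3)[OF law_prob[OF Q s(4)]] by (intro nn_integral_mono) auto
  also have "\<dots> = (\<integral>\<^sup>+x. \<Psi> t F (K i) s x \<partial>?\<mu>) + (ennreal (1 / N) + ((\<integral>\<^sup>+x. drift L (Z s x) \<partial>?\<mu>) + \<eta> (ennreal (2 / L)))) + ennreal (1/2 * h)"
  proof -
    have m: "\<Psi> t F (K i) s \<in> borel_measurable ?\<mu>" "(\<lambda>x. drift L (Z s x)) \<in> borel_measurable ?\<mu>"
      using s by (intro law_measurable[OF Q] \<Psi>_measurable modulus_Z_measurable[OF drift_modulus]; simp)+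
    note c = nn_integral_law_const[OF Q s(4)]
    show ?thesis
      using m by (simp only: nn_integral_add borel_measurable_add borel_measurable_const c)
  qed
  also have "\<dots> \<le> (of_nat s * ennreal (1/2 * h) + (\<Sum>r=1..<s. ennreal (1 / N) + ((EZ \<QQ> r (drift L)) + \<eta> (ennreal (2 / L)))))
    + (ennreal (1 / N) + ((\<integral>\<^sup>+x. drift L (Z s x) \<partial>?\<mu>) + \<eta> (ennreal (2 / L)))) + ennreal (1/2 * h)"
    using s by (intro add_right_mono Suc.IH) auto
  also have "\<dots> = of_nat (Suc s) * ennreal (1/2 * h) + (\<Sum>r=1..<Suc s. ennreal (1 / N) + ((EZ \<QQ> r (drift L)) + \<eta> (ennreal (2 / L))))"
    using s(1) by (simp add: distrib_right ac_simps)
  finally show ?case .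
qed

lemma mean_Z:
  assumes L: "admissible L" and t: "t \<in> {1..T}"
  shows "(\<integral>\<^sup>+x. Z t x \<partial>state_law M \<QQ> t) \<le> ennreal (1 / j + 1 / i) + (of_nat t * ennreal (1/2 * h)
    + (\<Sum>r=1..<t. ennreal (1 / N) + ((EZ \<QQ> r (drift L)) + \<eta> (ennreal (2 / L)))))"
proof -
  have m: "\<Psi> t F (K i) t \<in> borel_measurable (state_law M \<QQ> t)"
    using t by (intro law_measurable[OF Q] \<Psi>_measurable) auto
  have "(\<integral>\<^sup>+x. Z t x \<partial>state_law M \<QQ> t) \<le> (\<integral>\<^sup>+x. ennreal (1 / j + 1 / i) + \<Psi> t F (K i) t x \<partial>state_law M \<QQ> t)"
    by (intro nn_integral_mono Z_le_\<Psi>[OF t])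
  also have "\<dots> = ennreal (1 / j + 1 / i) + (\<integral>\<^sup>+x. \<Psi> t F (K i) t x \<partial>state_law M \<QQ> t)"
    using m by (simp only: nn_integral_add borel_measurable_const nn_integral_law_const[OF Q t])
  also have "\<dots> \<le> ennreal (1 / j + 1 / i) + (of_nat t * ennreal (1/2 * h)
    + (\<Sum>r=1..<t. ennreal (1 / N) + ((EZ \<QQ> r (drift L)) + \<eta> (ennreal (2 / L)))))"
    using t by (intro add_left_mono \<Psi>_bound[OF L t]) auto
  finally show ?thesis .
qed

end

end

context mf_model
begin

abbreviation "e \<equiv> err \<eta> \<theta> K N"

text \<open>The bracket under the infimum in the error terms.\<close>

definition core :: "nat \<Rightarrow> real \<Rightarrow> ennreal" where
  "core t L = (\<Sum>r=1..<t. drift L (e r)) + \<eta> (ennreal (2 / L))"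

lemma err_1: "e 1 = emp_rate K N"
  by (subst err.simps) simp

lemma err_rec: "2 \<le> t \<Longrightarrow> e t = 2 * (INF L\<in>{L. admissible L}. core t L) + of_nat t / of_nat N + emp_rate K N"
proof -
  assume t: "2 \<le> t"
  have "{L. admissible L} = {L. 0 < L \<and> 1 + \<eta> (ennreal (2 / L)) < ennreal L}" by (simp add: admissible_def)
  then show ?thesis using t by (subst err.simps) (simp only: core_def[abs_def] drift_def, simp)
qed

text \<open>Estimates that hold for all covers hold with the error rate, which is the infimum over them.\<close>

lemma rate_limit:
  assumes \<beta>: "subadditive_modulus \<beta>" and \<gamma>: "subadditive_modulus \<gamma>" "\<And>z. z \<le> \<gamma> z"
    and y: "y \<le> \<beta> \<top>" and c: "1 \<le> c"
    and le: "\<And>i j F. 1 \<le> i \<Longrightarrow> 1 \<le> j \<Longrightarrow> BL_cover j (K i) F \<Longrightarrow>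
      y \<le> ennreal c * \<beta> (A + \<gamma> (ennreal (rate i j F)))"
  shows "y \<le> ennreal c * \<beta> (A + \<gamma> (emp_rate K N))"
proof (cases "emp_rate K N = \<top>")
  case True
  then have "A + \<gamma> (emp_rate K N) = \<top>" using \<gamma>(2)[of \<top>] by (simp add: top_unique)
  moreover have "1 * \<beta> \<top> \<le> ennreal c * \<beta> \<top>" using c by (intro mult_right_mono) (auto simp flip: ennreal_1 intro: ennreal_leI)
  then have "y \<le> ennreal c * \<beta> \<top>" using y by simp
  ultimately show ?thesis by (simp only:)
next
  case False
  show ?thesis
  proof (rule modulus_limit[OF \<beta> \<gamma>(1)])
    fix \<delta> :: real assume \<delta>: "0 < \<delta>"
    have "emp_rate K N < emp_rate K N + ennreal \<delta>"
      using False \<delta> by (cases "emp_rate K N") (auto simp flip: ennreal_plus intro!: ennreal_lessI)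
    then obtain i j F where ij: "1 \<le> i" "1 \<le> j" "BL_cover j (K i) F"
      and r: "ennreal (rate i j F) \<le> emp_rate K N + ennreal \<delta>"
      by (rule emp_rate_less[OF _ N1])
    have "y \<le> ennreal c * \<beta> (A + \<gamma> (ennreal (rate i j F)))"
      by (rule le[OF ij])
    also have "\<dots> \<le> ennreal c * \<beta> (A + (\<gamma> (emp_rate K N) + \<gamma> (ennreal \<delta>)))"
      by (intro mult_left_mono modulusD(1)[OF \<beta>] add_left_mono order_trans[OF modulusD(1)[OF \<gamma>(1) r] modulusD(2)[OF \<gamma>(1)]]) auto
    finally show "y \<le> ennreal c * \<beta> (A + \<gamma> (emp_rate K N) + \<gamma> (ennreal \<delta>))" by (simp add: add.assoc)
  qed
qed

text \<open>The same for the infimum over \<open>L\<close>; without an admissible \<open>L\<close> the error term is infinite.\<close>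

lemma core_limit:
  assumes \<beta>: "subadditive_modulus \<beta>" and y: "y \<le> \<beta> \<top>" and c: "1 \<le> c" and t: "2 \<le> t"
    and le: "\<And>L. admissible L \<Longrightarrow> y \<le> ennreal c * \<beta> (2 * core t L + of_nat t / of_nat N + emp_rate K N)"
  shows "y \<le> ennreal c * \<beta> (e t)"
proof (cases "{L. admissible L} = {}")
  case True
  have "e t = \<top>" unfolding err_rec[OF t] True by (simp add: ennreal_mult_top)
  moreover have "1 * \<beta> \<top> \<le> ennreal c * \<beta> \<top>" using c by (intro mult_right_mono) (auto simp flip: ennreal_1 intro: ennreal_leI)
  then have "y \<le> ennreal c * \<beta> \<top>" using y by simp
  ultimately show ?thesis by (simp only:)
next
  case False
  show ?thesis
  proof (rule modulus_limit[OF \<beta> modulus_cmult[OF modulus_id, of 2]])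
    fix \<delta> :: real assume "0 < \<delta>"
    then obtain L where L: "admissible L" and le_L: "core t L \<le> (INF L\<in>{L. admissible L}. core t L) + ennreal \<delta>"
      using ennreal_near_Inf[of "core t ` {L. admissible L}" \<delta>] False by auto
    have "y \<le> ennreal c * \<beta> (2 * core t L + of_nat t / of_nat N + emp_rate K N)" by (rule le[OF L])
    also have "2 * core t L \<le> 2 * ((INF L\<in>{L. admissible L}. core t L) + ennreal \<delta>)"
      by (rule mult_left_mono[OF le_L]) simp
    then have "ennreal c * \<beta> (2 * core t L + of_nat t / of_nat N + emp_rate K N)
      \<le> ennreal c * \<beta> (2 * ((INF L\<in>{L. admissible L}. core t L) + ennreal \<delta>) + of_nat t / of_nat N + emp_rate K N)"
      by (intro mult_left_mono[OF modulusD(1)[OF \<beta>]] add_right_mono) auto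
    also have "2 * ((INF L\<in>{L. admissible L}. core t L) + ennreal \<delta>) + of_nat t / of_nat N + emp_rate K N = e t + ennreal 2 * ennreal \<delta>"
      unfolding err_rec[OF t] by (simp add: distrib_left ac_simps ennreal_numeral)
    finally show "y \<le> ennreal c * \<beta> (e t + ennreal 2 * ennreal \<delta>)" .
  qed
qed

text \<open>A modulus need not be concave, so Jensen's inequality is replaced by \<open>\<beta> z \<le> (1 + z / m) * \<beta> m\<close>.\<close>

lemma modulus_mean:
  assumes \<beta>: "subadditive_modulus \<beta>" and Q: "follows \<QQ>" and t: "t \<in> {1..T}"
    and mean: "(\<integral>\<^sup>+x. Z t x \<partial>state_law M \<QQ> t) \<le> ennreal \<rho> * m" and m: "0 < m" and \<rho>: "0 \<le> \<rho>"
  shows "EZ \<QQ> t \<beta> \<le> ennreal (1 + \<rho>) * \<beta> m"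
proof (cases m)
  case top
  have "EZ \<QQ> t \<beta> \<le> (\<integral>\<^sup>+x. \<beta> m \<partial>state_law M \<QQ> t)"
    unfolding top by (intro nn_integral_mono modulusD(1)[OF \<beta>]) simp
  also have "\<dots> = 1 * \<beta> m" using nn_integral_law_const[OF Q t] by simp
  also have "\<dots> \<le> ennreal (1 + \<rho>) * \<beta> m" using \<rho> by (intro mult_right_mono) (auto simp flip: ennreal_1 intro: ennreal_leI)
  finally show ?thesis .
next
  case (real r)
  then have r: "0 < r" using m by simp
  have Zm: "Z t \<in> borel_measurable (state_law M \<QQ> t)" by (rule law_measurable[OF Q t Z_measurable[OF t]])
  have "EZ \<QQ> t \<beta> \<le> (\<integral>\<^sup>+x. (ennreal (1 / r) * Z t x + 1) * \<beta> m \<partial>state_law M \<QQ> t)"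
  proof (rule nn_integral_mono)
    fix x
    define z where "z = bl_dist (empirical M x) (flow t)"
    have z: "0 \<le> z" unfolding z_def by (rule bl_dist_nonneg[OF empirical_prob flow_prob[OF t]])
    have "Z t x = ennreal (z / r) * m" using r z unfolding real(2) by (simp add: Z_def z_def flip: ennreal_mult)
    then have "\<beta> (Z t x) \<le> ennreal (z / r + 1) * \<beta> m" using r z by (intro modulus_scale[OF \<beta>]) auto
    also have "ennreal (z / r + 1) = ennreal (1 / r) * Z t x + 1"
      using r z by (simp add: Z_def ennreal_plus flip: z_def ennreal_mult del: ennreal_plus_if)
    finally show "\<beta> (Z t x) \<le> (ennreal (1 / r) * Z t x + 1) * \<beta> m" .
  qed
  also have "\<dots> = (ennreal (1 / r) * (\<integral>\<^sup>+x. Z t x \<partial>state_law M \<QQ> t) + 1) * \<beta> m"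
    using Zm nn_integral_law_const[OF Q t] by (simp add: nn_integral_multc nn_integral_add nn_integral_cmult)
  also have "\<dots> \<le> (ennreal (1 / r) * (ennreal \<rho> * m) + 1) * \<beta> m"
    by (intro mult_right_mono add_right_mono mult_left_mono mean) auto
  also have "ennreal (1 / r) * (ennreal \<rho> * m) + 1 = ennreal (1 + \<rho>)"
  proof -
    have "ennreal (1 / r) * (ennreal \<rho> * m) = ennreal \<rho>" using r \<rho> unfolding real(2) by (simp flip: ennreal_mult)
    then show ?thesis using \<rho> by (simp add: ennreal_plus add.commute del: ennreal_plus_if)
  qed
  finally show ?thesis .
qed

lemma integral_modulus_le_top:
  assumes "subadditive_modulus \<beta>" "follows \<QQ>" "t \<in> {1..T}"
  shows "EZ \<QQ> t \<beta> \<le> \<beta> \<top>"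
proof -
  have "EZ \<QQ> t \<beta> \<le> (\<integral>\<^sup>+x. \<beta> \<top> \<partial>state_law M \<QQ> t)"
    by (intro nn_integral_mono modulusD(1)[OF assms(1)]) simp
  then show ?thesis by (simp only: nn_integral_law_const[OF assms(2,3)])
qed

text \<open>By strong induction over time. The mean distance is at most \<open>\<rho> = (1 + T) / 2\<close> times the error term: the
  covering radius counts twice, which needs \<open>\<rho> \<ge> 2\<close>; the \<open>t\<close> fluctuations of size \<open>h / 2\<close> need
  \<open>\<rho> \<ge> t / 2\<close>; the earlier distances enter with the factor \<open>1 + \<rho> \<le> 2 * \<rho>\<close>; and the \<open>t - 1\<close>
  regularisation errors need \<open>2 * \<rho> \<ge> t - 1\<close>.\<close>

lemma chaos_long:
  assumes T3: "3 \<le> T" and Q: "follows \<QQ>"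
  shows "t \<in> {1..T} \<Longrightarrow> subadditive_modulus \<beta> \<Longrightarrow>
    (EZ \<QQ> t \<beta>) \<le> ennreal ((3 + T) / 2) * \<beta> (e t)"
proof (induction t arbitrary: \<beta> rule: less_induct)
  case (less t)
  note t = less.prems(1) and \<beta> = less.prems(2)
  define \<rho> where "\<rho> = (1 + T) / 2"
  have \<rho>: "2 \<le> \<rho>" "real t / 2 \<le> \<rho>" "(3 + T) / 2 = 1 + \<rho>" "1 + \<rho> \<le> \<rho> * 2" "real t \<le> \<rho> * 2"
    using T3 t by (auto simp: \<rho>_def field_simps)
  note y = integral_modulus_le_top[OF \<beta> Q t]
  \<comment> \<open>The three parts of the rate, with the covering radius counted twice.\<close>
  have rate: "1 / real j + 1 / real i + t / 2 * h \<le> \<rho> * (1 / (2 * real j) + 1 / real i + h)" if "0 \<le> h" for i j :: nat and h :: real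
  proof -
    have "1 / real j \<le> \<rho> * (1 / (2 * real j))" using mult_right_mono[OF \<rho>(1), of "1 / (2 * real j)"] by simp
    moreover have "1 / real i \<le> \<rho> * (1 / real i)" using mult_right_mono[of 1 \<rho> "1 / real i"] \<rho>(1) by simp
    moreover have "t / 2 * h \<le> \<rho> * h" using that \<rho>(2) by (rule mult_right_mono[rotated])
    ultimately show ?thesis unfolding distrib_left by linarith
  qed
  have rate': "ennreal (1 / j + 1 / i) + of_nat t * ennreal (1/2 * h) \<le> ennreal \<rho> * ennreal (1 / (2 * real j) + 1 / real i + h)"
    if "0 \<le> h" for i j :: nat and h :: real
  proof -
    have "ennreal (1 / j + 1 / i) + of_nat t * ennreal (1/2 * h) = ennreal (1 / real j + 1 / real i + t / 2 * h)"
      using that by (simp add: ennreal_of_nat_eq_real_of_nat ennreal_plus flip: ennreal_mult del: ennreal_plus_if)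
    also have "\<dots> \<le> ennreal (\<rho> * (1 / (2 * real j) + 1 / real i + h))" by (rule ennreal_leI[OF rate[OF that]])
    also have "\<dots> = ennreal \<rho> * ennreal (1 / (2 * real j) + 1 / real i + h)"
      using \<rho>(1) that by (intro ennreal_mult) auto
    finally show ?thesis .
  qed
  have pos: "0 < card F / sqrt N" if "BL_cover j (K i) F" for i j F
    using BL_cover_nonempty[OF that] N1 by simp
  show ?case
  proof (cases "t = 1")
    case True
    have "EZ \<QQ> t \<beta> \<le> ennreal (1 + \<rho>) * \<beta> (0 + emp_rate K N)"
    proof (rule rate_limit[OF \<beta> modulus_id order_refl y])
      fix i j F assume ij: "1 \<le> i" "1 \<le> j" "BL_cover j (K i) F"
      have m: "\<Psi> t F (K i) t \<in> borel_measurable (state_law M \<QQ> t)"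
        using t by (intro law_measurable[OF Q] \<Psi>_measurable[OF ij Q]) auto
      have "(\<integral>\<^sup>+x. Z t x \<partial>state_law M \<QQ> t) \<le> (\<integral>\<^sup>+x. ennreal (1 / j + 1 / i) + \<Psi> t F (K i) t x \<partial>state_law M \<QQ> t)"
        by (intro nn_integral_mono Z_le_\<Psi>[OF ij Q t])
      also have "\<dots> = ennreal (1 / j + 1 / i) + (\<integral>\<^sup>+x. \<Psi> t F (K i) t x \<partial>state_law M \<QQ> t)"
        using m by (simp only: nn_integral_add borel_measurable_const nn_integral_law_const[OF Q t])
      also have "\<dots> \<le> ennreal (1 / j + 1 / i) + of_nat t * ennreal (1/2 * (card F / sqrt N))"
        using \<Psi>_init[OF ij Q t] True by (intro add_left_mono) simp
      also have "\<dots> \<le> ennreal \<rho> * ennreal (rate i j F)"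
        using pos[OF ij(3)] by (intro rate') simp
      finally have "(\<integral>\<^sup>+x. Z t x \<partial>state_law M \<QQ> t) \<le> ennreal \<rho> * ennreal (rate i j F)" .
      then have "EZ \<QQ> t \<beta> \<le> ennreal (1 + \<rho>) * \<beta> (ennreal (rate i j F))"
        using pos[OF ij(3)] \<rho>(1) ij by (intro modulus_mean[OF \<beta> Q t]) (auto simp: add_nonneg_pos)
      then show "EZ \<QQ> t \<beta> \<le> ennreal (1 + \<rho>) * \<beta> (0 + ennreal (rate i j F))"
        by simp
    qed (use \<rho> in auto)
    then show ?thesis unfolding \<rho>(3) using True err_1 by simp
  next
    case False
    then have t2: "2 \<le> t" using t by auto
    have "EZ \<QQ> t \<beta> \<le> ennreal (1 + \<rho>) * \<beta> (e t)"
    proof (rule core_limit[OF \<beta> y _ t2])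
      fix L assume L: "admissible L"
      let ?A = "2 * core t L + of_nat t / of_nat N"
      show "EZ \<QQ> t \<beta> \<le> ennreal (1 + \<rho>) * \<beta> (?A + emp_rate K N)"
      proof (rule rate_limit[OF \<beta> modulus_id order_refl y])
        fix i j F assume ij: "1 \<le> i" "1 \<le> j" "BL_cover j (K i) F"
        let ?r = "ennreal (rate i j F)"
        have "(\<integral>\<^sup>+x. Z t x \<partial>state_law M \<QQ> t) \<le> (ennreal (1 / j + 1 / i) + of_nat t * ennreal (1/2 * (card F / sqrt N)))
          + (\<Sum>r=1..<t. ennreal (1 / N) + ((EZ \<QQ> r (drift L)) + \<eta> (ennreal (2 / L))))"
          using mean_Z[OF ij Q L t] by (simp add: add.assoc)
        also have "\<dots> \<le> ennreal \<rho> * ?r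
          + (\<Sum>r=1..<t. ennreal (1 / N) + (ennreal (1 + \<rho>) * drift L (e r) + \<eta> (ennreal (2 / L))))"
        proof (intro add_mono sum_mono rate' order_refl)
          fix r assume "r \<in> {1..<t}"
          then show "(EZ \<QQ> r (drift L)) \<le> ennreal (1 + \<rho>) * drift L (e r)"
            unfolding \<rho>(3)[symmetric] using t by (intro less.IH drift_modulus) auto
        qed (use pos[OF ij(3)] in simp)
        also have "(\<Sum>r=1..<t. ennreal (1 / N) + (ennreal (1 + \<rho>) * drift L (e r) + \<eta> (ennreal (2 / L))))
          = of_nat (t - 1) * ennreal (1 / N) + (ennreal (1 + \<rho>) * (\<Sum>r=1..<t. drift L (e r)) + of_nat (t - 1) * \<eta> (ennreal (2 / L)))"
          by (simp add: sum.distrib sum_distrib_left)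
        also have "\<dots> \<le> ennreal \<rho> * (of_nat t / of_nat N) + (ennreal (\<rho> * 2) * (\<Sum>r=1..<t. drift L (e r)) + ennreal (\<rho> * 2) * \<eta> (ennreal (2 / L)))"
        proof (intro add_mono mult_right_mono)
          have "of_nat (t - 1) * ennreal (1 / N) = ennreal ((t - 1) / N)"
            by (simp add: ennreal_of_nat_eq_real_of_nat flip: ennreal_mult)
          also have "\<dots> \<le> ennreal (\<rho> * (t / N))"
          proof (rule ennreal_leI)
            have "real (t - 1) / N \<le> 1 * (t / N)" using t by (simp add: divide_right_mono)
            also have "\<dots> \<le> \<rho> * (t / N)" using \<rho>(1) by (intro mult_right_mono) auto
            finally show "real (t - 1) / N \<le> \<rho> * (t / N)" .
          qed
          also have "\<dots> = ennreal \<rho> * ennreal (t / N)" using \<rho>(1) by (intro ennreal_mult) auto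
          also have "ennreal (t / N) = of_nat t / of_nat N"
            using N1 by (simp add: ennreal_of_nat_eq_real_of_nat divide_ennreal)
          finally show "of_nat (t - 1) * ennreal (1 / N) \<le> ennreal \<rho> * (of_nat t / of_nat N)" .
          show "ennreal (1 + \<rho>) \<le> ennreal (\<rho> * 2)" by (rule ennreal_leI[OF \<rho>(4)])
          show "of_nat (t - 1) \<le> ennreal (\<rho> * 2)"
            using \<rho>(5) t by (simp add: ennreal_of_nat_eq_real_of_nat ennreal_leI)
        qed auto
        also have "ennreal \<rho> * (of_nat t / of_nat N) + (ennreal (\<rho> * 2) * (\<Sum>r=1..<t. drift L (e r)) + ennreal (\<rho> * 2) * \<eta> (ennreal (2 / L)))
          = ennreal \<rho> * ?A"
        proof -
          have "ennreal (\<rho> * 2) = ennreal \<rho> * 2" using \<rho>(1) by (simp add: ennreal_mult ennreal_numeral)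
          then show ?thesis by (simp add: core_def distrib_left ac_simps)
        qed
        finally have "(\<integral>\<^sup>+x. Z t x \<partial>state_law M \<QQ> t) \<le> ennreal \<rho> * ?r + ennreal \<rho> * ?A" by (simp add: add_left_mono)
        then have "(\<integral>\<^sup>+x. Z t x \<partial>state_law M \<QQ> t) \<le> ennreal \<rho> * (?A + ?r)" by (simp add: distrib_left add.commute)
        moreover have "0 < ?r" using pos[OF ij(3)] by (simp add: add_nonneg_pos)
        then have "0 < ?A + ?r" by (rule less_le_trans) (rule add_increasing[OF zero_le order_refl])
        ultimately show "EZ \<QQ> t \<beta> \<le> ennreal (1 + \<rho>) * \<beta> (?A + ?r)"
          using \<rho>(1) by (intro modulus_mean[OF \<beta> Q t]) auto
      qed (use \<rho> in auto)
    qed (use \<rho> in auto)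
    then show ?thesis unfolding \<rho>(3) .
  qed
qed

end

section \<open>Second moments over two time steps\<close>

text \<open>For \<open>T = 2\<close> the factor to be reached is 5/2. The covering radius alone accounts for a factor 2 on the
  distance, which costs a modulus exactly 2; the remaining 1/2 has to pay for random fluctuations. They exceed
  the factor 2 only through large deviations, and these are controlled by variances.\<close>

context mf_model
begin

text \<open>Up to the factor 1/2 and truncation at 0, the quantity under the supremum in \<open>\<Psi>\<close> at time 1; it is centred
  under the initial law.\<close>

definition dev :: "nat \<Rightarrow> 'x set \<Rightarrow> ('x \<Rightarrow> real) \<Rightarrow> (nat \<Rightarrow> 'x) \<Rightarrow> real" where
  "dev t A g x = (\<Sum>n=1..N. bwd n 1 t (ext_one A g) (x n)) / N - (\<integral>y. ext_one A g y \<partial>flow t)"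

definition sqdev :: "nat \<Rightarrow> 'x set \<Rightarrow> ('x \<Rightarrow> real) set \<Rightarrow> (nat \<Rightarrow> 'x) \<Rightarrow> real" where
  "sqdev t A F x = (\<Sum>g\<in>F. (dev t A g x)\<^sup>2)"

lemma ennreal_affine:
  assumes "0 \<le> a" "0 \<le> c" "0 \<le> s" shows "ennreal (a + c * s) = ennreal a + ennreal c * ennreal s"
  using assms by (simp add: ennreal_plus ennreal_mult del: ennreal_plus_if)

lemma sqdev_nonneg: "0 \<le> sqdev t A F x"
  by (simp add: sqdev_def sum_nonneg)

lemma le_sqrt_sum_squares:
  fixes f :: "'b \<Rightarrow> real"
  assumes "finite F" "g \<in> F" shows "f g \<le> sqrt (\<Sum>g\<in>F. (f g)\<^sup>2)"
proof -
  have "(f g)\<^sup>2 \<le> (\<Sum>g\<in>F. (f g)\<^sup>2)" using assms by (intro member_le_sum) auto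
  then have "\<bar>f g\<bar> \<le> sqrt (\<Sum>g\<in>F. (f g)\<^sup>2)" by (simp add: real_le_rsqrt)
  then show ?thesis by simp
qed

context
  fixes i j F \<QQ>
  assumes ij: "1 \<le> i" "1 \<le> j" and cover: "BL_cover j (K i) F" and Q: "follows \<QQ>"
begin

lemmas ctx = ij cover Q

abbreviation "hh \<equiv> card F / sqrt N"

lemma hh: "0 < hh" "card F / N / hh\<^sup>2 \<le> 1"
proof -
  have c: "1 \<le> card F" by (rule BL_cover_nonempty[OF cover])
  then show "0 < hh" using N1 by simp
  have "real (card F) \<le> (real (card F))\<^sup>2" using c by (simp add: power2_eq_square)
  then show "card F / N / hh\<^sup>2 \<le> 1" using c N1 by (simp add: power_divide field_simps)
qed

lemma dev_measurable:
  assumes "g \<in> F" "t \<in> {1..T}"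
  shows "dev t (K i) g \<in> borel_measurable ST"
proof -
  have "(\<lambda>x. bwd n 1 t (ext_one (K i) g) (x n)) \<in> borel_measurable ST" if "n \<in> {1..N}" for n
    by (rule measurable_compose[OF component_measurable[OF that] bwd_ext(1)[OF ctx assms(1) that]]) (use assms in auto)
  then show ?thesis unfolding dev_def[abs_def]
    by (intro borel_measurable_diff borel_measurable_divide borel_measurable_sum borel_measurable_const)
qed

lemma sqdev_measurable: "t \<in> {1..T} \<Longrightarrow> sqdev t (K i) F \<in> borel_measurable ST"
  unfolding sqdev_def[abs_def] by (intro borel_measurable_sum borel_measurable_power dev_measurable)

lemma sqdev_ennreal: "ennreal (sqdev t (K i) F x) = (\<Sum>g\<in>F. ennreal ((dev t (K i) g x)\<^sup>2))"
  unfolding sqdev_def by (rule sum_ennreal[symmetric]) simp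

lemma mean_sqdev:
  assumes t: "t \<in> {1..T}"
  shows "(\<integral>\<^sup>+x. ennreal (sqdev t (K i) F x) \<partial>state_law M \<QQ> 1) \<le> ennreal (card F / N)"
proof -
  have "(\<integral>\<^sup>+x. ennreal (sqdev t (K i) F x) \<partial>state_law M \<QQ> 1) = (\<Sum>g\<in>F. \<integral>\<^sup>+x. ennreal ((dev t (K i) g x)\<^sup>2) \<partial>state_law M \<QQ> 1)"
    unfolding sqdev_ennreal
    by (rule nn_integral_sum, rule law_measurable[OF Q]) (use T2 dev_measurable[OF _ t] in \<open>auto intro!: borel_measurable_power\<close>)
  also have "\<dots> \<le> (\<Sum>g\<in>F. ennreal (1 / N))"
  proof (rule sum_mono)
    fix g assume g: "g \<in> F"
    have "(\<integral>y. ext_one (K i) g y \<partial>flow t) = (\<Sum>n=1..N. \<integral>z. bwd n 1 t (ext_one (K i) g) z \<partial>init_law M) / N"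
      using integral_flow[OF t ext_bounds[OF ctx g]] integral_mf_law[OF _ t ext_bounds[OF ctx g]] by simp
    then have "(\<integral>\<^sup>+x. ennreal ((dev t (K i) g x)\<^sup>2) \<partial>state_law M \<QQ> 1)
      = (\<integral>\<^sup>+x. ennreal (((\<Sum>n=1..N. bwd n 1 t (ext_one (K i) g) (x n)) / N - (\<Sum>n=1..N. \<integral>z. bwd n 1 t (ext_one (K i) g) z \<partial>init_law M) / N)\<^sup>2)
        \<partial>Pi\<^sub>M {1..N} (\<lambda>_. init_law M))"
      by (simp add: dev_def init_tuple_law_def)
    also have "\<dots> \<le> ennreal (1 / N)"
      by (rule PiM_variance[OF init_law N1]) (use bwd_ext[OF ctx g] t in auto)
    finally show "(\<integral>\<^sup>+x. ennreal ((dev t (K i) g x)\<^sup>2) \<partial>state_law M \<QQ> 1) \<le> ennreal (1 / N)" .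
  qed
  also have "\<dots> = ennreal (card F / N)" by (simp add: ennreal_of_nat_eq_real_of_nat flip: ennreal_mult)
  finally show ?thesis .
qed

text \<open>With \<open>s\<close> the sum of the squared deviations: the bound on the distance exceeds twice the rate only if
  \<open>sqrt s\<close> is larger than \<open>4 * hh\<close>.\<close>

lemma scale_bound:
  assumes "0 \<le> s"
  shows "1 / j + 1 / i + 1/2 * sqrt s \<le> max 2 (sqrt s / (2 * hh)) * rate i j F"
proof -
  let ?w = "sqrt s / (2 * hh)"
  have "1 / real j = 2 * (1 / (2 * real j))" by simp
  also have "\<dots> \<le> max 2 ?w * (1 / (2 * real j))" by (rule mult_right_mono) auto
  finally have "1 / real j \<le> max 2 ?w * (1 / (2 * real j))" .
  moreover have "1 * (1 / real i) \<le> max 2 ?w * (1 / real i)" by (rule mult_right_mono) auto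
  moreover have "?w * hh \<le> max 2 ?w * hh" by (rule mult_right_mono) (use hh(1) in auto)
  moreover have "?w * hh = 1/2 * sqrt s"
  proof -
    have "hh \<noteq> 0" using hh(1) by linarith
    then show ?thesis by (simp only: nonzero_mult_div_cancel_right times_divide_eq_left times_divide_eq_right) (simp add: field_simps)
  qed
  ultimately show ?thesis unfolding distrib_left by linarith
qed

lemma w_square: "0 \<le> s \<Longrightarrow> (sqrt s / (2 * hh))\<^sup>2 = s / (4 * hh\<^sup>2)"
  by (simp add: power_divide power_mult_distrib)

lemma first_step:
  assumes \<beta>: "subadditive_modulus \<beta>"
  shows "\<beta> (Z 1 x) \<le> ennreal (2 + sqdev 1 (K i) F x / (4 * hh\<^sup>2) / 4) * \<beta> (ennreal (rate i j F))"
proof (rule modulus_scale_max2[OF \<beta>])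
  let ?s = "sqdev 1 (K i) F x"
  have "Z 1 x \<le> ennreal (1 / j + 1 / i) + \<Psi> 1 F (K i) 1 x" using T2 by (intro Z_le_\<Psi>[OF ctx]) auto
  also have "\<Psi> 1 F (K i) 1 x \<le> ennreal (1/2 * sqrt ?s)"
    unfolding \<Psi>_def
  proof (intro SUP_least ennreal_leI mult_left_mono)
    fix g assume "g \<in> F"
    from le_sqrt_sum_squares[OF F_facts(1)[OF ctx] this, of "\<lambda>g. dev 1 (K i) g x"]
    show "(\<Sum>n=1..N. bwd n 1 1 (ext_one (K i) g) (x n)) / N - (\<integral>y. ext_one (K i) g y \<partial>flow 1) \<le> sqrt ?s"
      by (simp add: dev_def sqdev_def)
  qed simp
  finally have "Z 1 x \<le> ennreal (1 / j + 1 / i) + ennreal (1/2 * sqrt ?s)" by (simp add: add_left_mono)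
  also have "\<dots> = ennreal (1 / j + 1 / i + 1/2 * sqrt ?s)"
    using sqdev_nonneg by (intro ennreal_plus[symmetric]) auto
  also have "\<dots> \<le> ennreal (max 2 (sqrt ?s / (2 * hh)) * rate i j F)"
    by (rule ennreal_leI[OF scale_bound[OF sqdev_nonneg]])
  also have "\<dots> = ennreal (max 2 (sqrt ?s / (2 * hh))) * ennreal (rate i j F)"
    using hh(1) by (intro ennreal_mult) auto
  finally show "Z 1 x \<le> ennreal (max 2 (sqrt ?s / (2 * hh))) * ennreal (rate i j F)" .
  show "(sqrt ?s / (2 * hh))\<^sup>2 \<le> ?s / (4 * hh\<^sup>2)" using w_square[OF sqdev_nonneg] by simp
qed

lemma first_mean:
  assumes \<beta>: "subadditive_modulus \<beta>"
  shows "EZ \<QQ> 1 \<beta> \<le> ennreal (5/2) * \<beta> (ennreal (rate i j F))"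
proof -
  have t1: "1 \<in> {1..T}" using T2 by auto
  let ?c = "1 / (16 * hh\<^sup>2)"
  have "EZ \<QQ> 1 \<beta>
    \<le> (\<integral>\<^sup>+x. (2 + ennreal ?c * ennreal (sqdev 1 (K i) F x)) * \<beta> (ennreal (rate i j F)) \<partial>state_law M \<QQ> 1)"
  proof (rule nn_integral_mono)
    fix x
    have "ennreal (2 + sqdev 1 (K i) F x / (4 * hh\<^sup>2) / 4) = 2 + ennreal ?c * ennreal (sqdev 1 (K i) F x)"
    proof -
      have "ennreal (2 + sqdev 1 (K i) F x / (4 * hh\<^sup>2) / 4) = ennreal (2 + ?c * sqdev 1 (K i) F x)" by simp
      also have "\<dots> = ennreal 2 + ennreal ?c * ennreal (sqdev 1 (K i) F x)"
        by (rule ennreal_affine) (use sqdev_nonneg in auto)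
      finally show ?thesis by (simp only: ennreal_numeral)
    qed
    then show "\<beta> (Z 1 x) \<le> (2 + ennreal ?c * ennreal (sqdev 1 (K i) F x)) * \<beta> (ennreal (rate i j F))"
      using first_step[OF \<beta>, of x] by simp
  qed
  also have "\<dots> = (2 + ennreal ?c * (\<integral>\<^sup>+x. ennreal (sqdev 1 (K i) F x) \<partial>state_law M \<QQ> 1)) * \<beta> (ennreal (rate i j F))"
  proof -
    have m: "(\<lambda>x. ennreal (sqdev 1 (K i) F x)) \<in> borel_measurable (state_law M \<QQ> 1)"
      using sqdev_measurable[OF t1] by (intro law_measurable[OF Q t1]) simp
    show ?thesis using m
      by (simp only: nn_integral_multc nn_integral_add nn_integral_cmult borel_measurable_add borel_measurable_times_ennreal borel_measurable_const nn_integral_law_const[OF Q t1])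
  qed
  also have "\<dots> \<le> (2 + ennreal ?c * ennreal (card F / N)) * \<beta> (ennreal (rate i j F))"
    by (intro mult_right_mono add_left_mono mult_left_mono mean_sqdev[OF t1]) auto
  also have "\<dots> \<le> ennreal (5/2) * \<beta> (ennreal (rate i j F))"
  proof (rule mult_right_mono)
    have "2 + ennreal ?c * ennreal (card F / N) = ennreal (2 + ?c * (card F / N))"
      using ennreal_affine[of 2 ?c "card F / N"] by (simp only: ennreal_numeral) simp
    also have "\<dots> \<le> ennreal (5/2)"
    proof (rule ennreal_leI)
      have "?c * (card F / N) = 1/16 * (card F / N / hh\<^sup>2)" by simp
      also have "\<dots> \<le> 1/16 * 1" by (rule mult_left_mono[OF hh(2)]) simp
      finally have "?c * (card F / N) \<le> 1/16 * 1" .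
      then show "2 + ?c * (card F / N) \<le> 5/2" by linarith
    qed
    finally show "2 + ennreal ?c * ennreal (card F / N) \<le> ennreal (5/2)" .
  qed simp
  finally show ?thesis .
qed

definition step_law :: "(nat \<Rightarrow> 'x) \<Rightarrow> nat \<Rightarrow> 'x measure" where
  "step_law x n = mixed_kernel M 1 (x n) (empirical M x) (\<QQ> n 1 x)"

text \<open>The deviation caused by the move from \<open>x\<close> to \<open>y\<close>; it is centred given \<open>x\<close>.\<close>

definition dev2 :: "('x \<Rightarrow> real) \<Rightarrow> (nat \<Rightarrow> 'x) \<Rightarrow> (nat \<Rightarrow> 'x) \<Rightarrow> real" where
  "dev2 g x y = (\<Sum>n=1..N. ext_one (K i) g (y n)) / N - (\<Sum>n=1..N. \<integral>z. ext_one (K i) g z \<partial>step_law x n) / N"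

lemma step_law_prob: "x \<in> space ST \<Longrightarrow> n \<in> {1..N} \<Longrightarrow> step_law x n \<in> prob_measures"
  unfolding step_law_def using T2 profileD(2)[OF follows_profile[OF Q], of n 1 x]
  by (intro mixed_kernel_prob empirical_prob) auto

lemma next_law_step: "next_law M 1 (\<lambda>n. \<QQ> n 1 x) x = Pi\<^sub>M {1..N} (step_law x)"
  by (simp add: next_law_def step_law_def[abs_def])

text \<open>The distance at time 2 is made of the covering radius, the fluctuations of both times (factor \<open>w\<close>) and the
  drift at the distance of time 1. The latter is at most \<open>2 * a\<close> times the drift at the rate, and the error term
  contains twice that drift. The whole is thus at most \<open>max (max 2 w) a\<close> times the error term, and whichever of
  the factors is largest determines the cost for the modulus.\<close>

lemma second_step:
  assumes \<beta>: "subadditive_modulus \<beta>" and L: "admissible L" and x: "x \<in> space ST"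
  defines "m \<equiv> 2 * (drift L (ennreal (rate i j F)) + \<eta> (ennreal (2 / L))) + of_nat 2 / of_nat N + ennreal (rate i j F)"
    and "q \<equiv> \<lambda>y. (\<Sum>g\<in>F. (dev2 g x y)\<^sup>2 + (dev 2 (K i) g x)\<^sup>2) / (2 * hh\<^sup>2)"
  shows "\<beta> (Z 2 y) \<le> ennreal (2 + q y / 4 + sqdev 1 (K i) F x / (32 * hh\<^sup>2)) * \<beta> m"
proof -
  define s where "s = (\<Sum>g\<in>F. (dev2 g x y + dev 2 (K i) g x)\<^sup>2)"
  define w where "w = sqrt s / (2 * hh)"
  define a where "a = 1 + sqdev 1 (K i) F x / (32 * hh\<^sup>2)"
  define b where "b = drift L (Z 1 x) + \<eta> (ennreal (2 / L))"
  have s0: "0 \<le> s" by (simp add: s_def sum_nonneg)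
  have a1: "1 \<le> a" using sqdev_nonneg[of 1 "K i" F x] by (simp add: a_def)
  have t: "1 \<in> {1..<T}" "2 \<in> {1..T}" using T2 by auto
  have wq: "w\<^sup>2 \<le> q y"
  proof -
    have "(u + v)\<^sup>2 \<le> 2 * (u\<^sup>2 + v\<^sup>2)" for u v :: real
      using zero_le_power2[of "u - v"] by (simp add: power2_eq_square algebra_simps)
    then have "s \<le> (\<Sum>g\<in>F. 2 * ((dev2 g x y)\<^sup>2 + (dev 2 (K i) g x)\<^sup>2))" unfolding s_def by (intro sum_mono)
    then have "s \<le> 2 * (\<Sum>g\<in>F. (dev2 g x y)\<^sup>2 + (dev 2 (K i) g x)\<^sup>2)" by (simp only: sum_distrib_left)
    then have "s / (4 * hh\<^sup>2) \<le> 2 * (\<Sum>g\<in>F. (dev2 g x y)\<^sup>2 + (dev 2 (K i) g x)\<^sup>2) / (4 * hh\<^sup>2)"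
      by (rule divide_right_mono) simp
    also have "\<dots> = q y" unfolding q_def by simp
    finally show ?thesis unfolding w_def w_square[OF s0] .
  qed
  have "Z 2 y \<le> ennreal (1 / j + 1 / i) + \<Psi> 2 F (K i) 2 y" by (rule Z_le_\<Psi>[OF ctx t(2)])
  also have "\<Psi> 2 F (K i) 2 y \<le> ennreal (1/2 * sqrt s) + (ennreal (1 / N) + b)"
    unfolding \<Psi>_def
  proof (rule SUP_least)
    fix g assume g: "g \<in> F"
    let ?e = "ext_one (K i) g"
    \<comment> \<open>Moving the fluctuation into the constant lets the bias estimate act on the conditional means.\<close>
    let ?c = "(\<integral>z. ?e z \<partial>flow 2) - dev2 g x y"
    have "(\<Sum>n=1..N. bwd n 2 2 ?e (y n)) / N - (\<integral>z. ?e z \<partial>flow 2) = (\<Sum>n=1..N. \<integral>z. ?e z \<partial>step_law x n) / N - ?c"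
      by (simp add: dev2_def bwd_def)
    then have "ennreal (1/2 * ((\<Sum>n=1..N. bwd n 2 2 ?e (y n)) / N - (\<integral>z. ?e z \<partial>flow 2)))
      = ennreal (1/2 * ((\<Sum>n=1..N. \<integral>z. ?e z \<partial>mixed_kernel M 1 (x n) (empirical M x) (\<QQ> n 1 x)) / N - ?c))"
      by (simp only: step_law_def)
    also have "\<dots> \<le> ennreal (1/2 * ((\<Sum>n=1..N. \<integral>z. ?e z \<partial>mf_kernel n 1 (x n)) / N - ?c)) + (ennreal (1 / N) + b)"
      unfolding b_def by (rule bias_average[OF Q L t(1) x]) (use ext_bounds[OF ctx g] in auto)
    also have "(\<Sum>n=1..N. \<integral>z. ?e z \<partial>mf_kernel n 1 (x n)) / N - ?c = dev2 g x y + dev 2 (K i) g x"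
    proof -
      have "bwd n 1 2 ?e z = (\<integral>w. ?e w \<partial>mf_kernel n 1 z)" for n z
        using bwd_step[of 1 2 n ?e z] by (simp add: bwd_def)
      then show ?thesis by (simp add: dev_def)
    qed
    also have "ennreal (1/2 * (dev2 g x y + dev 2 (K i) g x)) \<le> ennreal (1/2 * sqrt s)"
      unfolding s_def by (intro ennreal_leI mult_left_mono le_sqrt_sum_squares[OF F_facts(1)[OF ctx] g]) simp
    finally show "ennreal (1/2 * ((\<Sum>n=1..N. bwd n 2 2 ?e (y n)) / N - (\<integral>z. ?e z \<partial>flow 2)))
      \<le> ennreal (1/2 * sqrt s) + (ennreal (1 / N) + b)" by (simp add: add_right_mono)
  qed
  also have "ennreal (1 / j + 1 / i) + (ennreal (1/2 * sqrt s) + (ennreal (1 / N) + b)) = ennreal (1 / j + 1 / i + 1/2 * sqrt s) + (ennreal (1 / N) + b)"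
    using s0 by (simp add: ennreal_plus add.assoc del: ennreal_plus_if)
  also have "\<dots> \<le> ennreal (max (max 2 w) a) * ennreal (rate i j F) + (ennreal (max (max 2 w) a) * (of_nat 2 / of_nat N) + ennreal (max (max 2 w) a) * (2 * (drift L (ennreal (rate i j F)) + \<eta> (ennreal (2 / L)))))"
  proof (intro add_mono)
    have "1 / j + 1 / i + 1/2 * sqrt s \<le> max 2 w * rate i j F" unfolding w_def by (rule scale_bound[OF s0])
    also have "\<dots> \<le> max (max 2 w) a * rate i j F" using hh(1) by (intro mult_right_mono) auto
    finally have "ennreal (1 / j + 1 / i + 1/2 * sqrt s) \<le> ennreal (max (max 2 w) a * rate i j F)" by (rule ennreal_leI)
    also have "\<dots> = ennreal (max (max 2 w) a) * ennreal (rate i j F)" using hh(1) by (intro ennreal_mult) auto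
    finally show "ennreal (1 / j + 1 / i + 1/2 * sqrt s) \<le> ennreal (max (max 2 w) a) * ennreal (rate i j F)" .
    have "ennreal (1 / N) \<le> ennreal (max (max 2 w) a * (2 / N))"
      using mult_right_mono[of 1 "max (max 2 w) a" "2 / real N"] by (intro ennreal_leI) (auto simp: divide_simps intro: order_trans)
    also have "\<dots> = ennreal (max (max 2 w) a) * ennreal (2 / N)" by (intro ennreal_mult) auto
    also have "ennreal (2 / N) = of_nat 2 / of_nat N" using N1 by (simp add: ennreal_of_nat_eq_real_of_nat divide_ennreal ennreal_numeral flip: divide_ennreal)
    finally show "ennreal (1 / N) \<le> ennreal (max (max 2 w) a) * (of_nat 2 / of_nat N)" .
    have "b \<le> ennreal (2 * a) * drift L (ennreal (rate i j F)) + ennreal (2 * a) * \<eta> (ennreal (2 / L))"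
      unfolding b_def
    proof (rule add_mono)
      show "drift L (Z 1 x) \<le> ennreal (2 * a) * drift L (ennreal (rate i j F))"
        using first_step[OF drift_modulus, of L x] by (simp add: a_def)
      have "1 * \<eta> (ennreal (2 / L)) \<le> ennreal (2 * a) * \<eta> (ennreal (2 / L))"
        using a1 by (intro mult_right_mono) (auto simp flip: ennreal_1 intro: ennreal_leI)
      then show "\<eta> (ennreal (2 / L)) \<le> ennreal (2 * a) * \<eta> (ennreal (2 / L))" by simp
    qed
    also have "\<dots> = ennreal a * (2 * (drift L (ennreal (rate i j F)) + \<eta> (ennreal (2 / L))))"
      using a1 by (simp add: ennreal_mult ennreal_numeral distrib_left ac_simps)
    also have "\<dots> \<le> ennreal (max (max 2 w) a) * (2 * (drift L (ennreal (rate i j F)) + \<eta> (ennreal (2 / L))))"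
      by (intro mult_right_mono ennreal_leI) auto
    finally show "b \<le> ennreal (max (max 2 w) a) * (2 * (drift L (ennreal (rate i j F)) + \<eta> (ennreal (2 / L))))" .
  qed
  also have "\<dots> = ennreal (max (max 2 w) a) * m" by (simp add: m_def distrib_left ac_simps)
  finally have Z: "Z 2 y \<le> ennreal (max (max 2 w) a) * m" by (simp add: add_left_mono)
  have q0: "0 \<le> q y" unfolding q_def by (intro divide_nonneg_nonneg sum_nonneg) auto
  show ?thesis
  proof (cases "a \<le> max 2 w")
    case True
    then have "\<beta> (Z 2 y) \<le> ennreal (2 + q y / 4) * \<beta> m" using Z by (intro modulus_scale_max2[OF \<beta> _ wq]) (simp add: max.absorb1)
    also have "\<dots> \<le> ennreal (2 + q y / 4 + sqdev 1 (K i) F x / (32 * hh\<^sup>2)) * \<beta> m"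
      using sqdev_nonneg[of 1 "K i" F x] by (intro mult_right_mono ennreal_leI) auto
    finally show ?thesis .
  next
    case False
    then have "max (max 2 w) a = a" by linarith
    then have "\<beta> (Z 2 y) \<le> ennreal (a + 1) * \<beta> m" using Z a1 by (intro modulus_scale[OF \<beta>]) simp_all
    also have "\<dots> \<le> ennreal (2 + q y / 4 + sqdev 1 (K i) F x / (32 * hh\<^sup>2)) * \<beta> m"
      using q0 by (intro mult_right_mono ennreal_leI) (auto simp: a_def)
    finally show ?thesis .
  qed
qed

text \<open>In units of \<open>hh\<^sup>2\<close> every sum of variances is at most 1, which gives \<open>2 + 1/8 + 1/8 + 1/32 \<le> 5/2\<close>.\<close>

lemma second_mean:
  assumes \<beta>: "subadditive_modulus \<beta>" and L: "admissible L"
  shows "(EZ \<QQ> 2 \<beta>)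
    \<le> ennreal (5/2) * \<beta> (2 * (drift L (ennreal (rate i j F)) + \<eta> (ennreal (2 / L))) + of_nat 2 / of_nat N + ennreal (rate i j F))"
proof -
  define m where "m = 2 * (drift L (ennreal (rate i j F)) + \<eta> (ennreal (2 / L))) + of_nat 2 / of_nat N + ennreal (rate i j F)"
  have t: "1 \<in> {1..<T}" "1 \<in> {1..T}" "2 \<in> {1..T}" using T2 by auto
  define c where "c = 1 / (8 * hh\<^sup>2)"
  define k where "k = 1 / (32 * hh\<^sup>2)"
  have c0: "0 \<le> c" "0 \<le> k" by (auto simp: c_def k_def)
  have inner: "(\<integral>\<^sup>+y. \<beta> (Z 2 y) \<partial>next_law M 1 (\<lambda>n. \<QQ> n 1 x) x)
    \<le> (2 + ennreal c * ennreal (card F / N) + ennreal c * ennreal (sqdev 2 (K i) F x) + ennreal k * ennreal (sqdev 1 (K i) F x)) * \<beta> m"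
    if x: "x \<in> space ST" for x
  proof -
    let ?P = "Pi\<^sub>M {1..N} (step_law x)"
    have P: "?P \<in> space (prob_algebra (Pi\<^sub>M {1..N} (\<lambda>_. borel)))"
      by (rule PiM_in_prob_algebra(1)) (use step_law_prob[OF x] in \<open>auto simp: prob_measures_eq\<close>)
    interpret prob_space ?P by (rule prob_algebraD[OF P])
    have const: "(\<integral>\<^sup>+y. c \<partial>?P) = c" for c
      unfolding nn_integral_const by (simp only: emeasure_space_1 mult_1_right)
    have d2m: "(\<lambda>y. ennreal ((dev2 g x y)\<^sup>2)) \<in> borel_measurable ?P" if g: "g \<in> F" for g
    proof -
      have "(\<lambda>y. ext_one (K i) g (y n)) \<in> borel_measurable (Pi\<^sub>M {1..N} (\<lambda>_. borel))" if "n \<in> {1..N}" for n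
        by (rule measurable_compose[OF measurable_component_singleton[OF that] ext_bounds(1)[OF ctx g]])
      then have "dev2 g x \<in> borel_measurable (Pi\<^sub>M {1..N} (\<lambda>_. borel))"
        unfolding dev2_def[abs_def] by (intro borel_measurable_diff borel_measurable_divide borel_measurable_sum borel_measurable_const)
      then have "(\<lambda>y. ennreal ((dev2 g x y)\<^sup>2)) \<in> borel_measurable (Pi\<^sub>M {1..N} (\<lambda>_. borel))" by measurable
      then show ?thesis by (subst measurable_cong_sets[OF prob_algebraD(2)[OF P] refl])
    qed
    have "(\<integral>\<^sup>+y. \<beta> (Z 2 y) \<partial>?P) \<le> (\<integral>\<^sup>+y. (ennreal c * (\<Sum>g\<in>F. ennreal ((dev2 g x y)\<^sup>2))
      + (2 + ennreal c * ennreal (sqdev 2 (K i) F x) + ennreal k * ennreal (sqdev 1 (K i) F x))) * \<beta> m \<partial>?P)"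
    proof (rule nn_integral_mono)
      fix y
      let ?d = "\<Sum>g\<in>F. (dev2 g x y)\<^sup>2"
      have d0: "0 \<le> ?d" by (simp add: sum_nonneg)
      have "2 + (\<Sum>g\<in>F. (dev2 g x y)\<^sup>2 + (dev 2 (K i) g x)\<^sup>2) / (2 * hh\<^sup>2) / 4 + sqdev 1 (K i) F x / (32 * hh\<^sup>2)
        = c * ?d + (2 + c * sqdev 2 (K i) F x + k * sqdev 1 (K i) F x)"
        by (simp add: c_def k_def sum.distrib sqdev_def add_divide_distrib)
      then have "ennreal (2 + (\<Sum>g\<in>F. (dev2 g x y)\<^sup>2 + (dev 2 (K i) g x)\<^sup>2) / (2 * hh\<^sup>2) / 4 + sqdev 1 (K i) F x / (32 * hh\<^sup>2))
        = ennreal (c * ?d + (2 + c * sqdev 2 (K i) F x + k * sqdev 1 (K i) F x))" by (simp only:)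
      also have "\<dots> = ennreal c * ennreal ?d + (2 + ennreal c * ennreal (sqdev 2 (K i) F x) + ennreal k * ennreal (sqdev 1 (K i) F x))"
        using d0 c0 sqdev_nonneg by (simp add: ennreal_plus ennreal_mult ennreal_numeral del: ennreal_plus_if)
      also have "ennreal ?d = (\<Sum>g\<in>F. ennreal ((dev2 g x y)\<^sup>2))" by (rule sum_ennreal[symmetric]) simp
      finally have "ennreal (2 + (\<Sum>g\<in>F. (dev2 g x y)\<^sup>2 + (dev 2 (K i) g x)\<^sup>2) / (2 * hh\<^sup>2) / 4 + sqdev 1 (K i) F x / (32 * hh\<^sup>2))
        = ennreal c * (\<Sum>g\<in>F. ennreal ((dev2 g x y)\<^sup>2)) + (2 + ennreal c * ennreal (sqdev 2 (K i) F x) + ennreal k * ennreal (sqdev 1 (K i) F x))" .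
      then show "\<beta> (Z 2 y) \<le> (ennreal c * (\<Sum>g\<in>F. ennreal ((dev2 g x y)\<^sup>2))
        + (2 + ennreal c * ennreal (sqdev 2 (K i) F x) + ennreal k * ennreal (sqdev 1 (K i) F x))) * \<beta> m"
        using second_step[OF \<beta> L x, of y] by (simp only: m_def)
    qed
    also have "\<dots> = (ennreal c * (\<Sum>g\<in>F. \<integral>\<^sup>+y. ennreal ((dev2 g x y)\<^sup>2) \<partial>?P)
      + (2 + ennreal c * ennreal (sqdev 2 (K i) F x) + ennreal k * ennreal (sqdev 1 (K i) F x))) * \<beta> m"
      using d2m by (simp only: nn_integral_multc nn_integral_add nn_integral_cmult nn_integral_sum borel_measurable_sum
        borel_measurable_add borel_measurable_times_ennreal borel_measurable_const const)
    also have "\<dots> \<le> (ennreal c * (\<Sum>g\<in>F. ennreal (1 / N))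
      + (2 + ennreal c * ennreal (sqdev 2 (K i) F x) + ennreal k * ennreal (sqdev 1 (K i) F x))) * \<beta> m"
      unfolding dev2_def
      by (intro mult_right_mono add_right_mono mult_left_mono sum_mono PiM_variance[OF step_law_prob[OF x] N1]) (use ext_bounds[OF ctx] in auto)
    also have "(\<Sum>g\<in>F. ennreal (1 / N)) = ennreal (card F / N)" by (simp add: ennreal_of_nat_eq_real_of_nat flip: ennreal_mult)
    finally show ?thesis unfolding next_law_step by (simp add: ac_simps)
  qed
  have sm: "(\<lambda>x. ennreal (sqdev s (K i) F x)) \<in> borel_measurable (state_law M \<QQ> 1)" if "s \<in> {1..T}" for s
    using sqdev_measurable[OF that] by (intro law_measurable[OF Q t(2)]) simp
  have "(EZ \<QQ> 2 \<beta>) = (\<integral>\<^sup>+x. (\<integral>\<^sup>+y. \<beta> (Z 2 y) \<partial>next_law M 1 (\<lambda>n. \<QQ> n 1 x) x) \<partial>state_law M \<QQ> 1)"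
    using nn_integral_state_law_Suc[OF t(1) follows_profile[OF Q] modulus_Z_measurable[OF \<beta> t(3)]] by (simp add: numeral_2_eq_2)
  also have "\<dots> \<le> (\<integral>\<^sup>+x. (2 + ennreal c * ennreal (card F / N) + ennreal c * ennreal (sqdev 2 (K i) F x) + ennreal k * ennreal (sqdev 1 (K i) F x)) * \<beta> m \<partial>state_law M \<QQ> 1)"
    using inner prob_algebraD(3)[OF law_prob[OF Q t(2)]] by (intro nn_integral_mono) auto
  also have "\<dots> = (2 + ennreal c * ennreal (card F / N) + ennreal c * (\<integral>\<^sup>+x. ennreal (sqdev 2 (K i) F x) \<partial>state_law M \<QQ> 1)
    + ennreal k * (\<integral>\<^sup>+x. ennreal (sqdev 1 (K i) F x) \<partial>state_law M \<QQ> 1)) * \<beta> m"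
    using sm[OF t(2)] sm[OF t(3)] by (simp only: nn_integral_multc nn_integral_add nn_integral_cmult
        borel_measurable_add borel_measurable_times_ennreal borel_measurable_const nn_integral_law_const[OF Q t(2)])
  also have "\<dots> \<le> (2 + ennreal c * ennreal (card F / N) + ennreal c * ennreal (card F / N) + ennreal k * ennreal (card F / N)) * \<beta> m"
    by (intro mult_right_mono add_mono mult_left_mono mean_sqdev t order_refl) auto
  also have "\<dots> \<le> ennreal (5/2) * \<beta> m"
  proof (rule mult_right_mono)
    have "2 + ennreal c * ennreal (card F / N) + ennreal c * ennreal (card F / N) + ennreal k * ennreal (card F / N)
      = ennreal (2 + c * (card F / N) + c * (card F / N) + k * (card F / N))"
    proof -
      have X: "2 + ennreal u * ennreal d + ennreal v * ennreal d + ennreal w * ennreal d = ennreal (2 + u * d + v * d + w * d)"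
        if "0 \<le> u" "0 \<le> v" "0 \<le> w" "0 \<le> d" for u v w d :: real
        using that by (simp add: ennreal_plus ennreal_mult ennreal_numeral del: ennreal_plus_if)
      show ?thesis by (rule X) (use c0 in auto)
    qed
    also have "\<dots> \<le> ennreal (5/2)"
    proof (rule ennreal_leI)
      have "c * (card F / N) = 1/8 * (card F / N / hh\<^sup>2)" "k * (card F / N) = 1/32 * (card F / N / hh\<^sup>2)"
        by (simp_all add: c_def k_def)
      then show "2 + c * (card F / N) + c * (card F / N) + k * (card F / N) \<le> 5/2" using hh(2) by linarith
    qed
    finally show "2 + ennreal c * ennreal (card F / N) + ennreal c * ennreal (card F / N) + ennreal k * ennreal (card F / N) \<le> ennreal (5/2)" .
  qed simp
  finally show ?thesis unfolding m_def .
qed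

end

lemma chaos_two:
  assumes Q: "follows \<QQ>" and t: "t \<in> {1..2}" and \<beta>: "subadditive_modulus \<beta>"
  shows "EZ \<QQ> t \<beta> \<le> ennreal (5/2) * \<beta> (e t)"
proof -
  have "t \<in> {1..T}" using t T2 by auto
  note y = integral_modulus_le_top[OF \<beta> Q this]
  consider "t = 1" | "t = 2" using t by fastforce
  then show ?thesis
  proof cases
    case 1
    have "EZ \<QQ> t \<beta> \<le> ennreal (5/2) * \<beta> (0 + emp_rate K N)"
      by (rule rate_limit[OF \<beta> modulus_id order_refl y]) (use first_mean[OF _ _ _ Q \<beta>] 1 in auto)
    then show ?thesis using 1 err_1 by simp
  next
    case 2
    show ?thesis
    proof (rule core_limit[OF \<beta> y])
      fix L assume L: "admissible L"
      let ?\<gamma> = "\<lambda>z. ennreal 2 * drift L z + z"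
      have \<gamma>: "subadditive_modulus ?\<gamma>" by (intro modulus_add modulus_cmult drift_modulus modulus_id)
      have "EZ \<QQ> t \<beta> \<le> ennreal (5/2) * \<beta> ((2 * \<eta> (ennreal (2 / L)) + of_nat 2 / of_nat N) + ?\<gamma> (emp_rate K N))"
      proof (rule rate_limit[OF \<beta> \<gamma> _ y])
        fix i j F assume "1 \<le> i" "1 \<le> j" "BL_cover j (K i) F"
        from second_mean[OF this Q \<beta> L]
        show "(EZ \<QQ> t \<beta>)
          \<le> ennreal (5/2) * \<beta> ((2 * \<eta> (ennreal (2 / L)) + of_nat 2 / of_nat N) + ?\<gamma> (ennreal (rate i j F)))"
          unfolding 2 by (simp only: distrib_left ac_simps ennreal_numeral)
      qed simp_all
      also have "(2 * \<eta> (ennreal (2 / L)) + of_nat 2 / of_nat N) + ?\<gamma> (emp_rate K N) = 2 * core t L + of_nat t / of_nat N + emp_rate K N"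
      proof -
        have "{1..<2::nat} = {1}" by auto
        then show ?thesis unfolding 2 core_def by (simp add: err_1 distrib_left ac_simps ennreal_numeral flip: One_nat_def)
      qed
      finally show "EZ \<QQ> t \<beta> \<le> ennreal (5/2) * \<beta> (2 * core t L + of_nat t / of_nat N + emp_rate K N)" .
    qed (use 2 in auto)
  qed
qed

text \<open>The factor 2 on the left stands for the two comparisons with the mean field problem in which this estimate is
  used.\<close>

theorem propagation_of_chaos:
  assumes Q: "follows \<QQ>" and t: "t \<in> {1..T}" and \<beta>: "subadditive_modulus \<beta>"
  shows "2 * (EZ \<QQ> t \<beta>) \<le> (3 + of_nat T) * \<beta> (e t)"
proof -
  have "EZ \<QQ> t \<beta> \<le> ennreal ((3 + T) / 2) * \<beta> (e t)"
  proof (cases "3 \<le> T")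
    case True then show ?thesis by (rule chaos_long[OF _ Q t \<beta>])
  next
    case False
    then have "T = 2" using T2 by simp
    then show ?thesis using chaos_two[OF Q _ \<beta>, of t] t by simp
  qed
  then have "2 * (EZ \<QQ> t \<beta>) \<le> 2 * (ennreal ((3 + T) / 2) * \<beta> (e t))" by (rule mult_left_mono) simp
  also have "\<dots> = (3 + of_nat T) * \<beta> (e t)"
  proof -
    have "2 * ennreal ((3 + T) / 2) = ennreal (2 * ((3 + T) / 2))" by (subst ennreal_mult) (auto simp: ennreal_numeral)
    also have "2 * ((3 + T) / 2) = 3 + real T" by (simp add: field_simps)
    also have "ennreal (3 + real T) = 3 + of_nat T" by (simp add: ennreal_of_nat_eq_real_of_nat ennreal_plus ennreal_numeral del: ennreal_plus_if)
    finally show ?thesis by (simp only: mult.assoc[symmetric])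
  qed
  finally show ?thesis .
qed

end

section \<open>The frozen mean field problem\<close>

context mf_model
begin

abbreviation "PP \<equiv> as_profile M p"
abbreviation "C r \<equiv> cost_bound c0 c1 r (sup_norm (borel \<Otimes>\<^sub>M borel_prob) V)"

lemma cbar_pos: "0 < cbar" using ib by (simp add: integral_bound_def)

lemma as_policy_policies:
  assumes "n \<in> {1..N}" "p' \<in> mf_policies"
  shows "as_policy M n p' \<in> policies M"
proof -
  have "(\<lambda>x. (x n, empirical M x)) \<in> ST \<rightarrow>\<^sub>M borel \<Otimes>\<^sub>M borel_prob"
    by (rule measurable_Pair[OF component_measurable[OF assms(1)] empirical_measurable])
  from measurable_compose[OF this, of "\<lambda>(x, \<xi>). p' x \<xi>"] assms(2)
  show ?thesis by (simp add: policies_def as_policy_def[abs_def] mf_policies_def)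
qed

lemma PP_profile: "PP \<in> profiles M"
  using p_mod as_policy_policies by (auto simp: profiles_def as_profile_def mf_policies_mod_def)

lemma follows_upd:
  assumes "\<And>t. t \<in> {1..<T} \<Longrightarrow> \<pi> t \<in> policies M"
  shows "follows (PP(1 := \<pi>))"
  using assms PP_profile by (auto simp: follows_def profiles_def as_profile_def as_policy_def)

lemma U_bounded: "U \<in> bounded_borel ST" and V_bounded: "V \<in> bounded_borel (borel \<Otimes>\<^sub>M borel_prob)"
  and U_V: "x \<in> space ST \<Longrightarrow> U x = V (x 1, empirical M x)"
  and V_cont: "\<xi> \<in> prob_measures \<Longrightarrow> \<xi>' \<in> prob_measures \<Longrightarrow> ennreal \<bar>V (a, \<xi>) - V (a, \<xi>')\<bar> \<le> \<iota> (ennreal (bl_dist \<xi> \<xi>'))"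
  using sym by (auto simp: symmetric_continuity_def)

lemma cost_bound_Suc: "cost_bound c0 c1 (Suc r) z = c0 + c1 * cost_bound c0 c1 r z"
proof -
  have shift: "(\<Sum>k=1..r. c1 ^ (k - 1)) = (\<Sum>k<r. c1 ^ k)" for r
    by (simp add: sum.atLeast1_atMost_eq)
  show ?thesis
    unfolding cost_bound_def shift sum.lessThan_Suc_shift
    by (simp add: sum_distrib_left[symmetric] algebra_simps)
qed

text \<open>The control problem of a single player whose population law is frozen to the flow. Its value \<open>val\<close> is a
  function of the player's own state.\<close>

definition mf_opt :: "nat \<Rightarrow> ('x \<Rightarrow> real) \<Rightarrow> 'x \<Rightarrow> real" where
  "mf_opt t v a = (INF l\<in>prob_measures. mf_score M t (flow t) l v a)"

definition val :: "nat \<Rightarrow> 'x \<Rightarrow> real" where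
  "val t = foldr mf_opt [t..<T] (\<lambda>a. V (a, flow T))"

lemma mf_score_bounded:
  assumes "t \<in> {1..<T}" "v \<in> bounded_borel borel" "\<xi> \<in> prob_measures" "l \<in> prob_measures"
  shows "mf_score M t \<xi> l v \<in> bounded_borel borel" "\<bar>mf_score M t \<xi> l v a\<bar> \<le> c0 + c1 * sup_norm borel v"
proof -
  show b: "mf_score M t \<xi> l v \<in> bounded_borel borel" using wf assms by (auto simp: game_wf_def)
  have "sup_norm borel (mf_score M t \<xi> l v) \<le> c0 + c1 * sup_norm borel v"
    using growth assms by (auto simp: growth_bound_def)
  with bounded_borelD(2)[OF b, of a] show "\<bar>mf_score M t \<xi> l v a\<bar> \<le> c0 + c1 * sup_norm borel v" by simp
qed

lemma mf_score_lipschitz: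
  assumes t: "t \<in> {1..<T}" and v: "v \<in> bounded_borel borel" and \<xi>: "\<xi> \<in> prob_measures" "\<xi>' \<in> prob_measures"
    and l: "l \<in> prob_measures" "l' \<in> prob_measures"
  shows "ennreal \<bar>mf_score M t \<xi> l v a - mf_score M t \<xi>' l' v a\<bar>
    \<le> ennreal (c0 + c1 * sup_norm borel v) * (\<zeta> (ennreal (bl_dist \<xi> \<xi>')) + \<zeta> (ennreal (bl_dist l l')))"
proof -
  have "(\<lambda>a. mf_score M t \<xi> l v a - mf_score M t \<xi>' l' v a) \<in> bounded_borel borel"
    by (intro bounded_borel_diff mf_score_bounded assms)
  from bounded_borelD(2)[OF this, of a]
  have "ennreal \<bar>mf_score M t \<xi> l v a - mf_score M t \<xi>' l' v a\<bar>
    \<le> ennreal (sup_norm borel (\<lambda>a. mf_score M t \<xi> l v a - mf_score M t \<xi>' l' v a))" by (intro ennreal_leI) simp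
  also have "\<dots> \<le> ennreal (c0 + c1 * sup_norm borel v) * (\<zeta> (ennreal (bl_dist \<xi> \<xi>')) + \<zeta> (ennreal (bl_dist l l')))"
    using score_cont assms by (auto simp: score_continuity_def)
  finally show ?thesis .
qed

lemma mf_opt_selector:
  assumes t: "t \<in> {1..<T}" and v: "v \<in> bounded_borel borel"
  shows "mf_opt t v \<in> bounded_borel borel" "sup_norm borel (mf_opt t v) \<le> c0 + c1 * sup_norm borel v"
    and "\<And>l a. l \<in> prob_measures \<Longrightarrow> mf_opt t v a \<le> mf_score M t (flow t) l v a"
    and "0 < \<epsilon> \<Longrightarrow> \<exists>\<pi>\<in>borel \<rightarrow>\<^sub>M borel_prob. \<forall>a. mf_score M t (flow t) (\<pi> a) v a \<le> mf_opt t v a + \<epsilon>"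
proof -
  obtain d :: "nat \<Rightarrow> 'a measure" where d: "\<And>i. d i \<in> prob_measures"
    and dense: "\<And>l e. l \<in> prob_measures \<Longrightarrow> 0 < e \<Longrightarrow> \<exists>i. bl_dist l (d i) < e" by (rule dense_laws) blast
  have fl: "flow t \<in> prob_measures" using flow_prob t by auto
  let ?f = "\<lambda>i a. mf_score M t (flow t) (d i) v a"
  let ?B = "c0 + c1 * sup_norm borel v"
  have eq: "mf_opt t v a = (INF i. ?f i a)" for a
    unfolding mf_opt_def
  proof (rule INF_dense[OF d dense \<zeta>_modulus])
    fix l l' :: "'a measure" assume "l \<in> prob_measures" "l' \<in> prob_measures"
    from mf_score_lipschitz[OF t v fl fl this, of a]
    show "ennreal \<bar>mf_score M t (flow t) l v a - mf_score M t (flow t) l' v a\<bar> \<le> ennreal ?B * \<zeta> (ennreal (bl_dist l l'))"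
      by (simp add: bl_dist_self[OF fl] modulus_0[OF \<zeta>_modulus])
  qed (use mf_score_bounded(2)[OF t v fl] in auto)
  have m: "?f i \<in> borel_measurable borel" for i using bounded_borelD(1)[OF mf_score_bounded(1)[OF t v fl d]] .
  have b: "\<bar>?f i a\<bar> \<le> ?B" for i a by (rule mf_score_bounded(2)[OF t v fl d])
  have I: "(\<lambda>a. INF i. ?f i a) \<in> borel_measurable borel" "\<And>a. \<bar>INF i. ?f i a\<bar> \<le> ?B"
    "0 < \<epsilon> \<Longrightarrow> \<exists>k \<in> borel \<rightarrow>\<^sub>M count_space UNIV. \<forall>a. ?f (k a) a \<le> (INF i. ?f i a) + \<epsilon>"
    using INF_countable[where f = ?f and B = ?B and S = borel, OF m b] by auto
  show "mf_opt t v \<in> bounded_borel borel"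
    by (rule bounded_borelI[where C = ?B]) (use I in \<open>auto simp: eq[abs_def]\<close>)
  show "sup_norm borel (mf_opt t v) \<le> ?B" by (rule sup_norm_le) (use I in \<open>auto simp: eq\<close>)
  show "mf_opt t v a \<le> mf_score M t (flow t) l v a" if l: "l \<in> prob_measures" for l a
    unfolding mf_opt_def
  proof (rule cINF_lower[OF _ l])
    show "bdd_below ((\<lambda>l. mf_score M t (flow t) l v a) ` prob_measures)"
      by (rule bdd_belowI2[of _ "- ?B"])
         (use mf_score_bounded(2)[OF t v fl] in \<open>auto simp: abs_le_iff minus_le_iff\<close>)
  qed
  assume "0 < \<epsilon>"
  then obtain k where k: "k \<in> borel \<rightarrow>\<^sub>M count_space UNIV" "\<And>a. ?f (k a) a \<le> (INF i. ?f i a) + \<epsilon>"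
    using I(3) by blast
  show "\<exists>\<pi>\<in>borel \<rightarrow>\<^sub>M borel_prob. \<forall>a. mf_score M t (flow t) (\<pi> a) v a \<le> mf_opt t v a + \<epsilon>"
    by (rule bexI[of _ "\<lambda>a. d (k a)"]) (use k eq countable_selector[OF d k(1)] in auto)
qed

lemma val_T: "val T = (\<lambda>a. V (a, flow T))" and val_step: "t < T \<Longrightarrow> val t = mf_opt t (val (Suc t))"
  by (simp_all add: val_def foldr_upt_step)

lemma val_bounded:
  assumes "1 \<le> t" "t \<le> T"
  shows "val t \<in> bounded_borel borel \<and> sup_norm borel (val t) \<le> C (T - t)"
  using assms(2,1)
proof (induction rule: inc_induct)
  case base
  have T: "T \<in> {1..T}" using T2 by auto
  have fl: "flow T \<in> space borel_prob" using flow_prob[OF T] by (simp add: space_borel_prob)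
  then have sp: "(a, flow T) \<in> space (borel \<Otimes>\<^sub>M borel_prob)" for a :: 'x by (simp add: space_pair_measure)
  have "(\<lambda>a. (a, flow T)) \<in> (borel :: 'x measure) \<rightarrow>\<^sub>M borel \<Otimes>\<^sub>M borel_prob" using fl by simp
  from measurable_compose[OF this bounded_borelD(1)[OF V_bounded]]
  have "val T \<in> borel_measurable borel" by (simp add: val_T)
  moreover have "\<bar>val T a\<bar> \<le> sup_norm (borel \<Otimes>\<^sub>M borel_prob) V" for a
    using bounded_borelD(2)[OF V_bounded sp] by (simp add: val_T)
  ultimately show ?case
    by (auto intro!: bounded_borelI sup_norm_le simp: cost_bound_def)
next
  case (step t)
  then have t: "t \<in> {1..<T}" and IH: "val (Suc t) \<in> bounded_borel borel" "sup_norm borel (val (Suc t)) \<le> C (T - Suc t)" by auto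
  have "c0 + c1 * sup_norm borel (val (Suc t)) \<le> c0 + c1 * C (T - Suc t)"
    using IH(2) c_pos by (intro add_left_mono mult_left_mono) auto
  also have "\<dots> = C (Suc (T - Suc t))" by (simp add: cost_bound_Suc)
  also have "Suc (T - Suc t) = T - t" using t by auto
  finally show ?case using mf_opt_selector(1,2)[OF t IH(1)] step(2) by (simp add: val_step)
qed

lemma lift_bounded: "v \<in> bounded_borel borel \<Longrightarrow> (\<lambda>x. v (x 1)) \<in> bounded_borel ST"
proof -
  assume v: "v \<in> bounded_borel borel"
  have "(\<lambda>x. v (x 1)) \<in> borel_measurable ST"
    using N1 by (intro measurable_compose[OF component_measurable bounded_borelD(1)[OF v]]) auto
  then show ?thesis using bounded_borelD(2)[OF v] by (intro bounded_borelI[where C = "sup_norm borel v"]) auto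
qed

text \<open>Raising \<open>u\<close> to \<open>max u w\<close> can only raise the score, and the integral bound for \<open>max u w\<close> and \<open>w\<close> sees the
  positive part of \<open>u - w\<close>.\<close>

lemma one_sided:
  assumes u: "u \<in> bounded_borel ST" and w: "w \<in> bounded_borel ST"
  shows "ennreal (init_score M u - init_score M w) \<le> ennreal cbar * (\<integral>\<^sup>+y. ennreal (u y - w y) \<partial>init_tuple_law M)"
    and "t \<in> {1..<T} \<Longrightarrow> l \<in> space (action_laws M) \<Longrightarrow> x \<in> space ST \<Longrightarrow> next_law M t l x \<in> space (prob_algebra ST) \<Longrightarrow>
      ennreal (score M t l u x - score M t l w x) \<le> ennreal cbar * (\<integral>\<^sup>+y. ennreal (u y - w y) \<partial>next_law M t l x)"
proof -
  define z where "z y = max (u y) (w y)" for y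
  have z: "z \<in> bounded_borel ST"
  proof (rule bounded_borelI[where C = "max (sup_norm ST u) (sup_norm ST w)"])
    show "z \<in> borel_measurable ST" unfolding z_def using u w by (intro borel_measurable_max bounded_borelD(1))
    show "\<bar>z x\<bar> \<le> max (sup_norm ST u) (sup_norm ST w)" if "x \<in> space ST" for x
      using bounded_borelD(2)[OF u that] bounded_borelD(2)[OF w that] by (auto simp: z_def)
  qed
  have int: "ennreal (cbar * (\<integral>y. \<bar>z y - w y\<bar> \<partial>\<mu>)) = ennreal cbar * (\<integral>\<^sup>+y. ennreal (u y - w y) \<partial>\<mu>)"
    if \<mu>: "\<mu> \<in> space (prob_algebra ST)" for \<mu>
  proof -
    have "integrable \<mu> (\<lambda>y. \<bar>z y - w y\<bar>)"
      by (intro integrable_abs bounded_borel_integrable[OF bounded_borel_diff[OF z w] \<mu>])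
    then have "ennreal (\<integral>y. \<bar>z y - w y\<bar> \<partial>\<mu>) = (\<integral>\<^sup>+y. ennreal \<bar>z y - w y\<bar> \<partial>\<mu>)"
      by (intro nn_integral_eq_integral[symmetric]) auto
    also have "\<dots> = (\<integral>\<^sup>+y. ennreal (u y - w y) \<partial>\<mu>)"
    proof (rule nn_integral_cong)
      fix y
      show "ennreal \<bar>z y - w y\<bar> = ennreal (u y - w y)"
        by (cases "u y \<le> w y") (auto simp: z_def max_def ennreal_neg)
    qed
    finally show ?thesis using cbar_pos by (simp add: ennreal_mult)
  qed
  have "init_score M u - init_score M w \<le> init_score M z - init_score M w"
    using score_mono(1)[OF u z] by (simp add: z_def)
  also have "\<dots> \<le> \<bar>init_score M z - init_score M w\<bar>" by simp
  also have "\<dots> \<le> cbar * (\<integral>y. \<bar>z y - w y\<bar> \<partial>init_tuple_law M)"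
    using ib z w unfolding integral_bound_def by blast
  finally show "ennreal (init_score M u - init_score M w) \<le> ennreal cbar * (\<integral>\<^sup>+y. ennreal (u y - w y) \<partial>init_tuple_law M)"
    unfolding int[OF init_tuple_law, symmetric] by (rule ennreal_leI)
  assume t: "t \<in> {1..<T}" and l: "l \<in> space (action_laws M)" and x: "x \<in> space ST" and nl: "next_law M t l x \<in> space (prob_algebra ST)"
  have "score M t l u x - score M t l w x \<le> score M t l z x - score M t l w x"
    using score_mono(2)[OF u z _ t l x] by (simp add: z_def)
  also have "\<dots> \<le> \<bar>score M t l z x - score M t l w x\<bar>" by simp
  also have "\<dots> \<le> cbar * (\<integral>y. \<bar>z y - w y\<bar> \<partial>next_law M t l x)"
    using ib z w t l x unfolding integral_bound_def by blast
  finally show "ennreal (score M t l u x - score M t l w x) \<le> ennreal cbar * (\<integral>\<^sup>+y. ennreal (u y - w y) \<partial>next_law M t l x)"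
    unfolding int[OF nl, symmetric] by (rule ennreal_leI)
qed

lemma ennreal_diff_triangle: "ennreal (a - c) \<le> ennreal (a - b) + ennreal (b - c)"
proof -
  have "ennreal (a - c) \<le> ennreal (max 0 (a - b) + max 0 (b - c))" by (intro ennreal_leI) auto
  also have "\<dots> = ennreal (a - b) + ennreal (b - c)" by (subst ennreal_plus) (auto simp: ennreal_max_0)
  finally show ?thesis .
qed

text \<open>The score of a function of the own state is a mean field score, at the empirical measure instead of the flow
  (consistency). Freezing the population law costs \<open>\<zeta>\<close> of the distance, and the error of the continuation is
  integrated against the next law.\<close>

lemma step_compare:
  assumes Q: "follows \<QQ>" and t: "t \<in> {1..<T}" and x: "x \<in> space ST" and u: "u \<in> bounded_borel ST"
  shows "ennreal (score M t (tuple \<QQ> t x) u x - mf_score M t (flow t) (\<QQ> 1 t x) (val (Suc t)) (x 1))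
      \<le> ennreal (C (T - t)) * \<zeta> (Z t x) + ennreal cbar * (\<integral>\<^sup>+y. ennreal (u y - val (Suc t) (y 1)) \<partial>next_law M t (\<lambda>n. \<QQ> n t x) x)" (is ?A)
    and "ennreal (mf_score M t (flow t) (\<QQ> 1 t x) (val (Suc t)) (x 1) - score M t (tuple \<QQ> t x) u x)
      \<le> ennreal (C (T - t)) * \<zeta> (Z t x) + ennreal cbar * (\<integral>\<^sup>+y. ennreal (val (Suc t) (y 1) - u y) \<partial>next_law M t (\<lambda>n. \<QQ> n t x) x)" (is ?B)
proof -
  let ?v = "val (Suc t)" and ?l = "tuple \<QQ> t x"
  let ?w = "\<lambda>y :: nat \<Rightarrow> 'x. ?v (y 1)"
  have v: "?v \<in> bounded_borel borel" "sup_norm borel ?v \<le> C (T - Suc t)" using val_bounded[of "Suc t"] t by auto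
  have w: "?w \<in> bounded_borel ST" by (rule lift_bounded[OF v(1)])
  have l: "?l \<in> space (action_laws M)" by (rule tuple_in[OF follows_profile[OF Q] t x])
  have l1: "?l 1 = \<QQ> 1 t x" using N1 by (simp add: tuple_def)
  have q: "\<QQ> 1 t x \<in> prob_measures" using N1 by (intro profileD(2)[OF follows_profile[OF Q] _ t x]) auto
  have nl: "next_law M t ?l x = next_law M t (\<lambda>n. \<QQ> n t x) x" by (rule next_law_cong) (simp add: tuple_def)
  have nlp: "next_law M t ?l x \<in> space (prob_algebra ST)"
    unfolding nl by (rule measurable_space[OF profile_kernel[OF t follows_profile[OF Q]] x])
  have fl: "flow t \<in> prob_measures" using flow_prob t by auto
  have cons: "score M t ?l ?w x = mf_score M t (empirical M x) (\<QQ> 1 t x) ?v (x 1)"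
  proof -
    have "score M t ?l ?w x = mf_score M t (empirical M x) (?l 1) ?v (x 1)"
      using consist w v(1) t l x unfolding consistency_def by auto
    then show ?thesis unfolding l1 .
  qed
  have Cle: "c0 + c1 * sup_norm borel ?v \<le> C (T - t)"
  proof -
    have "c0 + c1 * sup_norm borel ?v \<le> c0 + c1 * C (T - Suc t)" using v(2) c_pos by (intro add_left_mono mult_left_mono) auto
    also have "\<dots> = C (Suc (T - Suc t))" by (simp add: cost_bound_Suc)
    also have "Suc (T - Suc t) = T - t" using t by auto
    finally show ?thesis .
  qed
  let ?m = "mf_score M t (flow t) (\<QQ> 1 t x) ?v (x 1)"
  have "ennreal \<bar>score M t ?l ?w x - ?m\<bar> \<le> ennreal (c0 + c1 * sup_norm borel ?v) * (\<zeta> (Z t x) + \<zeta> (ennreal (bl_dist (\<QQ> 1 t x) (\<QQ> 1 t x))))"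
    unfolding cons Z_def by (rule mf_score_lipschitz[OF t v(1) empirical_prob fl q q])
  also have "\<dots> \<le> ennreal (C (T - t)) * \<zeta> (Z t x)"
    unfolding bl_dist_self[OF q] using Cle by (simp add: modulus_0[OF \<zeta>_modulus] mult_right_mono ennreal_leI)
  finally have mid: "ennreal \<bar>score M t ?l ?w x - ?m\<bar> \<le> ennreal (C (T - t)) * \<zeta> (Z t x)" .
  have "ennreal (score M t ?l ?w x - ?m) \<le> ennreal (C (T - t)) * \<zeta> (Z t x)"
    by (rule order_trans[OF ennreal_leI mid]) simp
  from order_trans[OF ennreal_diff_triangle add_mono[OF one_sided(2)[OF u w t l x nlp] this]]
  show ?A unfolding nl by (simp only: add.commute)
  have "ennreal (?m - score M t ?l ?w x) \<le> ennreal (C (T - t)) * \<zeta> (Z t x)"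
    by (rule order_trans[OF ennreal_leI mid]) simp
  from order_trans[OF ennreal_diff_triangle add_mono[OF this one_sided(2)[OF w u t l x nlp]]]
  show ?B unfolding nl .
qed

definition side_error :: ennreal where
  "side_error = (\<Sum>r=1..T-1. ennreal (cbar ^ r * C (T - r)) * ((3 + of_nat T) * \<zeta> (e r)))
     + (3 + of_nat T) * ennreal (cbar ^ T) * \<iota> (e T)"

text \<open>Unrolling the recursion for the errors \<open>d\<close> along the chain replaces each distance by its mean, to which
  propagation of chaos applies.\<close>

lemma accumulate:
  assumes Q: "follows \<QQ>" and \<epsilon>: "0 \<le> \<epsilon>"
    and dm: "\<And>t. t \<in> {1..T} \<Longrightarrow> d t \<in> borel_measurable ST"
    and step: "\<And>t x. t \<in> {1..<T} \<Longrightarrow> x \<in> space ST \<Longrightarrow>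
      d t x \<le> ennreal \<epsilon> + (ennreal (C (T - t)) * \<zeta> (Z t x) + ennreal cbar * (\<integral>\<^sup>+y. d (Suc t) y \<partial>next_law M t (\<lambda>n. \<QQ> n t x) x))"
    and final: "\<And>x. x \<in> space ST \<Longrightarrow> d T x \<le> \<iota> (Z T x)"
  shows "2 * (ennreal cbar * (\<integral>\<^sup>+x. d 1 x \<partial>init_tuple_law M))
    \<le> ennreal (\<epsilon> * (2 * (\<Sum>r=1..T-1. cbar ^ r))) + side_error"
proof -
  let ?\<mu> = "state_law M \<QQ>"
  have C0: "0 \<le> C r" for r
  proof -
    have "(undefined, init_law M) \<in> space (borel \<Otimes>\<^sub>M borel_prob)"
      using init_law by (simp add: space_pair_measure space_borel_prob)
    then have "0 \<le> sup_norm (borel \<Otimes>\<^sub>M borel_prob) V"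
      using bounded_borelD(2)[OF V_bounded] order_trans[OF abs_ge_zero] by blast
    then show ?thesis using c_pos unfolding cost_bound_def
      by (intro add_nonneg_nonneg mult_nonneg_nonneg sum_nonneg) auto
  qed
  have iter: "ennreal cbar * (\<integral>\<^sup>+x. d 1 x \<partial>?\<mu> 1)
    \<le> (\<Sum>r=1..<t. ennreal (cbar ^ r) * (ennreal \<epsilon> + ennreal (C (T - r)) * (EZ \<QQ> r \<zeta>))) + ennreal (cbar ^ t) * (\<integral>\<^sup>+x. d t x \<partial>?\<mu> t)"
    if "1 \<le> t" "t \<le> T" for t
    using that
  proof (induction t rule: nat_induct_at_least)
    case base then show ?case by simp
  next
    case (Suc t)
    then have t: "t \<in> {1..<T}" "t \<in> {1..T}" "Suc t \<in> {1..T}" by auto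
    let ?K = "\<lambda>x. next_law M t (\<lambda>n. \<QQ> n t x) x"
    have m: "(\<lambda>x. \<zeta> (Z t x)) \<in> borel_measurable (?\<mu> t)" "(\<lambda>x. \<integral>\<^sup>+y. d (Suc t) y \<partial>?K x) \<in> borel_measurable (?\<mu> t)"
      by (intro law_measurable[OF Q t(2)] modulus_Z_measurable[OF \<zeta>_modulus t(2)]
           measurable_nn_integral_kernel[OF profile_kernel[OF t(1) follows_profile[OF Q]] dm[OF t(3)]])+
    have "(\<integral>\<^sup>+x. d t x \<partial>?\<mu> t) \<le> (\<integral>\<^sup>+x. ennreal \<epsilon> + (ennreal (C (T - t)) * \<zeta> (Z t x) + ennreal cbar * (\<integral>\<^sup>+y. d (Suc t) y \<partial>?K x)) \<partial>?\<mu> t)"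
      using step[OF t(1)] prob_algebraD(3)[OF law_prob[OF Q t(2)]] by (intro nn_integral_mono) auto
    also have "\<dots> = ennreal \<epsilon> + (ennreal (C (T - t)) * (EZ \<QQ> t \<zeta>) + ennreal cbar * (\<integral>\<^sup>+x. (\<integral>\<^sup>+y. d (Suc t) y \<partial>?K x) \<partial>?\<mu> t))"
      using m by (simp only: nn_integral_add nn_integral_cmult borel_measurable_add borel_measurable_times_ennreal borel_measurable_const nn_integral_law_const[OF Q t(2)])
    also have "(\<integral>\<^sup>+x. (\<integral>\<^sup>+y. d (Suc t) y \<partial>?K x) \<partial>?\<mu> t) = (\<integral>\<^sup>+x. d (Suc t) x \<partial>?\<mu> (Suc t))"
      by (rule nn_integral_state_law_Suc[OF t(1) follows_profile[OF Q] dm[OF t(3)], symmetric])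
    finally have "ennreal (cbar ^ t) * (\<integral>\<^sup>+x. d t x \<partial>?\<mu> t) \<le> ennreal (cbar ^ t) * (ennreal \<epsilon> + (ennreal (C (T - t)) * (EZ \<QQ> t \<zeta>)
       + ennreal cbar * (\<integral>\<^sup>+x. d (Suc t) x \<partial>?\<mu> (Suc t))))" by (rule mult_left_mono) simp
    also have "\<dots> = ennreal (cbar ^ t) * (ennreal \<epsilon> + ennreal (C (T - t)) * (EZ \<QQ> t \<zeta>)) + ennreal (cbar ^ Suc t) * (\<integral>\<^sup>+x. d (Suc t) x \<partial>?\<mu> (Suc t))"
      using cbar_pos by (simp add: distrib_left ennreal_mult ac_simps)
    finally have *: "ennreal (cbar ^ t) * (\<integral>\<^sup>+x. d t x \<partial>?\<mu> t)
      \<le> ennreal (cbar ^ t) * (ennreal \<epsilon> + ennreal (C (T - t)) * (EZ \<QQ> t \<zeta>)) + ennreal (cbar ^ Suc t) * (\<integral>\<^sup>+x. d (Suc t) x \<partial>?\<mu> (Suc t))" .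
    have "ennreal cbar * (\<integral>\<^sup>+x. d 1 x \<partial>?\<mu> 1)
      \<le> (\<Sum>r=1..<t. ennreal (cbar ^ r) * (ennreal \<epsilon> + ennreal (C (T - r)) * (EZ \<QQ> r \<zeta>))) + ennreal (cbar ^ t) * (\<integral>\<^sup>+x. d t x \<partial>?\<mu> t)"
      using t by (intro Suc.IH) auto
    also note add_left_mono[OF *]
    finally show ?case using t(1) by (simp add: add.assoc)
  qed
  have fin: "(\<integral>\<^sup>+x. d T x \<partial>?\<mu> T) \<le> (EZ \<QQ> T \<iota>)"
    using final prob_algebraD(3)[OF law_prob[OF Q, of T]] T2 by (intro nn_integral_mono) auto
  have Teq: "{1..<T} = {1..T-1}" using T2 by auto
  have "2 * (ennreal cbar * (\<integral>\<^sup>+x. d 1 x \<partial>init_tuple_law M)) = 2 * (ennreal cbar * (\<integral>\<^sup>+x. d 1 x \<partial>?\<mu> 1))" by simp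
  also have "\<dots> \<le> 2 * ((\<Sum>r=1..T-1. ennreal (cbar ^ r) * (ennreal \<epsilon> + ennreal (C (T - r)) * (EZ \<QQ> r \<zeta>))) + ennreal (cbar ^ T) * (EZ \<QQ> T \<iota>))"
  proof (rule mult_left_mono)
    have "ennreal cbar * (\<integral>\<^sup>+x. d 1 x \<partial>?\<mu> 1) \<le> (\<Sum>r=1..T-1. ennreal (cbar ^ r) * (ennreal \<epsilon> + ennreal (C (T - r)) * (EZ \<QQ> r \<zeta>)))
      + ennreal (cbar ^ T) * (\<integral>\<^sup>+x. d T x \<partial>?\<mu> T)"
      using iter[of T] T2 unfolding Teq by simp
    also have "\<dots> \<le> (\<Sum>r=1..T-1. ennreal (cbar ^ r) * (ennreal \<epsilon> + ennreal (C (T - r)) * (EZ \<QQ> r \<zeta>)))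
      + ennreal (cbar ^ T) * (EZ \<QQ> T \<iota>)"
      by (rule add_left_mono[OF mult_left_mono[OF fin]]) simp
    finally show "ennreal cbar * (\<integral>\<^sup>+x. d 1 x \<partial>?\<mu> 1) \<le> (\<Sum>r=1..T-1. ennreal (cbar ^ r) * (ennreal \<epsilon> + ennreal (C (T - r)) * (EZ \<QQ> r \<zeta>)))
      + ennreal (cbar ^ T) * (EZ \<QQ> T \<iota>)" .
  qed simp
  also have "\<dots> = (\<Sum>r=1..T-1. ennreal (cbar ^ r) * (2 * ennreal \<epsilon>) + ennreal (cbar ^ r) * ennreal (C (T - r)) * (2 * (EZ \<QQ> r \<zeta>)))
    + ennreal (cbar ^ T) * (2 * (EZ \<QQ> T \<iota>))"
    by (simp add: distrib_left sum_distrib_left ac_simps)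
  also have "\<dots> \<le> (\<Sum>r=1..T-1. ennreal (cbar ^ r) * (2 * ennreal \<epsilon>) + ennreal (cbar ^ r) * ennreal (C (T - r)) * ((3 + of_nat T) * \<zeta> (e r)))
    + ennreal (cbar ^ T) * ((3 + of_nat T) * \<iota> (e T))"
    using T2 by (intro add_mono sum_mono mult_left_mono propagation_of_chaos[OF Q] \<zeta>_modulus moduli order_refl) auto
  also have "\<dots> = (\<Sum>r=1..T-1. ennreal (cbar ^ r) * (2 * ennreal \<epsilon>)) + ((\<Sum>r=1..T-1. ennreal (cbar ^ r * C (T - r)) * ((3 + of_nat T) * \<zeta> (e r)))
      + (3 + of_nat T) * ennreal (cbar ^ T) * \<iota> (e T))"
    using cbar_pos C0 by (simp add: sum.distrib ennreal_mult ac_simps)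
  also have "(\<Sum>r=1..T-1. ennreal (cbar ^ r) * (2 * ennreal \<epsilon>)) = ennreal (\<epsilon> * (2 * (\<Sum>r=1..T-1. cbar ^ r)))"
  proof -
    have "(\<Sum>r=1..T-1. ennreal (cbar ^ r) * (2 * ennreal \<epsilon>)) = (\<Sum>r=1..T-1. ennreal (cbar ^ r * (2 * \<epsilon>)))"
      using \<epsilon> cbar_pos by (intro sum.cong refl) (simp add: ennreal_mult ennreal_numeral)
    also have "\<dots> = ennreal (\<Sum>r=1..T-1. cbar ^ r * (2 * \<epsilon>))" using \<epsilon> cbar_pos by (intro sum_ennreal) auto
    also have "(\<Sum>r=1..T-1. cbar ^ r * (2 * \<epsilon>)) = \<epsilon> * (2 * (\<Sum>r=1..T-1. cbar ^ r))"
      unfolding sum_distrib_right[symmetric] by simp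
    finally show ?thesis .
  qed
  finally show ?thesis unfolding side_error_def .
qed

lemma terminal_compare:
  assumes x: "x \<in> space ST"
  shows "ennreal \<bar>U x - val T (x 1)\<bar> \<le> \<iota> (Z T x)"
  unfolding U_V[OF x] val_T Z_def using T2 by (intro V_cont empirical_prob flow_prob) auto

section \<open>Restricted deviations\<close>

text \<open>A policy that is nearly optimal in the frozen problem depends on the own state only. It is therefore constant
  in the population law and satisfies the modulus condition whatever the modulus is.\<close>

lemma upper_value:
  assumes \<epsilon>: "0 < \<epsilon>"
  obtains q where "\<And>t. t \<in> {1..<T} \<Longrightarrow> q t \<in> mf_policies_mod \<theta>"
    "2 * ennreal (score_op M (PP(1 := \<lambda>t. as_policy M 1 (q t))) T U - init_score M (\<lambda>x. val 1 (x 1)))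
      \<le> ennreal (\<epsilon> * (2 * (\<Sum>r=1..T-1. cbar ^ r))) + side_error"
proof -
  have "\<exists>\<pi>\<in>borel \<rightarrow>\<^sub>M borel_prob. \<forall>a. mf_score M t (flow t) (\<pi> a) (val (Suc t)) a \<le> val t a + \<epsilon>" if t: "t \<in> {1..<T}" for t
    using mf_opt_selector(4)[OF t _ \<epsilon>, of "val (Suc t)"] val_bounded[of "Suc t"] val_step[of t] t by auto
  then obtain \<pi> where \<pi>: "\<And>t. t \<in> {1..<T} \<Longrightarrow> \<pi> t \<in> (borel :: 'x measure) \<rightarrow>\<^sub>M borel_prob"
    "\<And>t a. t \<in> {1..<T} \<Longrightarrow> mf_score M t (flow t) (\<pi> t a) (val (Suc t)) a \<le> val t a + \<epsilon>" by metis
  define q where "q t a (\<xi> :: 'x measure) = \<pi> t a" for t a \<xi>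
  have q: "q t \<in> mf_policies_mod \<theta>" if t: "t \<in> {1..<T}" for t
  proof -
    have pr: "\<pi> t a \<in> prob_measures" for a using measurable_space[OF \<pi>(1)[OF t], of a] by (simp add: space_borel_prob)
    have "(\<lambda>z. \<pi> t (fst z)) \<in> borel \<Otimes>\<^sub>M (borel_prob :: 'x measure measure) \<rightarrow>\<^sub>M borel_prob"
      by (rule measurable_compose[OF measurable_fst \<pi>(1)[OF t]])
    moreover have "(\<lambda>(a, \<xi>). q t a \<xi>) = (\<lambda>z. \<pi> t (fst z))" by (auto simp: q_def fun_eq_iff)
    ultimately have "q t \<in> mf_policies" by (simp add: mf_policies_def)
    then show ?thesis by (simp add: mf_policies_mod_def q_def bl_dist_self[OF pr])
  qed
  define QQ where "QQ = PP(1 := \<lambda>t. as_policy M 1 (q t))"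
  have Q: "follows QQ" unfolding QQ_def
    using q N1 by (intro follows_upd as_policy_policies) (auto simp: mf_policies_mod_def)
  have QQ1: "QQ 1 t x = \<pi> t (x 1)" for t x by (simp add: QQ_def as_policy_def q_def)
  define y where "y t = foldr (score_step M QQ) [t..<T] U" for t
  have yb: "y t \<in> bounded_borel ST" if "t \<in> {1..T}" for t
    unfolding y_def using that by (intro score_foldr_bounded(1)[OF follows_profile[OF Q] U_bounded]) auto
  have vb: "(\<lambda>x. val t (x 1)) \<in> bounded_borel ST" if "t \<in> {1..T}" for t
    using val_bounded[of t] that by (intro lift_bounded) auto
  have "2 * (ennreal cbar * (\<integral>\<^sup>+x. ennreal (y 1 x - val 1 (x 1)) \<partial>init_tuple_law M))
      \<le> ennreal (\<epsilon> * (2 * (\<Sum>r=1..T-1. cbar ^ r))) + side_error"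
  proof (rule accumulate[where d = "\<lambda>t x. ennreal (y t x - val t (x 1))", OF Q])
    show "(\<lambda>x. ennreal (y t x - val t (x 1))) \<in> borel_measurable ST" if "t \<in> {1..T}" for t
      using bounded_borelD(1)[OF bounded_borel_diff[OF yb[OF that] vb[OF that]]] by simp
    show "ennreal (y t x - val t (x 1)) \<le> ennreal \<epsilon> + (ennreal (C (T - t)) * \<zeta> (Z t x)
      + ennreal cbar * (\<integral>\<^sup>+w. ennreal (y (Suc t) w - val (Suc t) (w 1)) \<partial>next_law M t (\<lambda>n. QQ n t x) x))"
      if t: "t \<in> {1..<T}" and x: "x \<in> space ST" for t x
    proof -
      let ?m = "mf_score M t (flow t) (QQ 1 t x) (val (Suc t)) (x 1)"
      have "y t x = score M t (tuple QQ t x) (y (Suc t)) x"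
        using t by (simp add: y_def foldr_upt_step score_step_eq)
      then have "ennreal (y t x - val t (x 1)) \<le> ennreal (?m - val t (x 1)) + ennreal (score M t (tuple QQ t x) (y (Suc t)) x - ?m)"
        using ennreal_diff_triangle[of "y t x" "val t (x 1)" ?m] by (simp add: add.commute)
      also have "\<dots> \<le> ennreal \<epsilon> + (ennreal (C (T - t)) * \<zeta> (Z t x)
        + ennreal cbar * (\<integral>\<^sup>+w. ennreal (y (Suc t) w - val (Suc t) (w 1)) \<partial>next_law M t (\<lambda>n. QQ n t x) x))"
      proof (intro add_mono ennreal_leI step_compare(1)[OF Q t x] yb)
        show "?m - val t (x 1) \<le> \<epsilon>" unfolding QQ1 using \<pi>(2)[OF t, of "x 1"] by linarith
      qed (use t in auto)
      finally show ?thesis .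
    qed
    show "ennreal (y T x - val T (x 1)) \<le> \<iota> (Z T x)" if x: "x \<in> space ST" for x
      by (rule order_trans[OF ennreal_leI terminal_compare[OF x]]) (simp add: y_def)
  qed (use \<epsilon> in simp)
  moreover have "score_op M QQ T U = init_score M (y 1)" by (simp add: score_op_def y_def)
  then have "ennreal (score_op M QQ T U - init_score M (\<lambda>x. val 1 (x 1)))
    \<le> ennreal cbar * (\<integral>\<^sup>+x. ennreal (y 1 x - val 1 (x 1)) \<partial>init_tuple_law M)"
    using one_sided(1)[OF yb vb, of 1 1] T2 by simp
  ultimately have res: "2 * ennreal (score_op M QQ T U - init_score M (\<lambda>x. val 1 (x 1)))
      \<le> ennreal (\<epsilon> * (2 * (\<Sum>r=1..T-1. cbar ^ r))) + side_error"
    by (meson mult_left_mono order_trans zero_le)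
  show ?thesis by (rule that[of q, OF _ res[unfolded QQ_def]]) (rule q)
qed

text \<open>Conversely, an unrestricted nearly optimal response of player 1 is a competitor in the frozen problem.\<close>

lemma lower_value:
  assumes \<epsilon>: "0 < \<epsilon>"
  shows "2 * ennreal (init_score M (\<lambda>x. val 1 (x 1)) - opt_score_op M PP T U)
      \<le> ennreal (\<epsilon> * (2 * (\<Sum>r=1..T-1. cbar ^ r))) + side_error"
proof -
  define u where "u t = foldr (opt_score_step M PP) [t..<T] U" for t
  have ub: "u t \<in> bounded_borel ST" if "t \<in> {1..T}" for t
    unfolding u_def using that by (intro score_foldr_bounded(2)[OF PP_profile U_bounded]) auto
  have ustep: "u t x = opt_score_step M PP t (u (Suc t)) x" if "t \<in> {1..<T}" for t x
    using that by (simp add: u_def foldr_upt_step)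
  have vb: "(\<lambda>x. val t (x 1)) \<in> bounded_borel ST" if "t \<in> {1..T}" for t
    using val_bounded[of t] that by (intro lift_bounded) auto
  have "\<exists>\<pi>\<in>policies M. \<forall>x\<in>space ST. score M t ((tuple PP t x)(1 := \<pi> x)) (u (Suc t)) x \<le> u t x + \<epsilon>" if t: "t \<in> {1..<T}" for t
    using opt_score_step_selector(3)[OF PP_profile t ub \<epsilon>, of "Suc t"] t by (simp add: ustep)
  then obtain \<pi> where \<pi>: "\<And>t. t \<in> {1..<T} \<Longrightarrow> \<pi> t \<in> policies M"
    "\<And>t x. t \<in> {1..<T} \<Longrightarrow> x \<in> space ST \<Longrightarrow> score M t ((tuple PP t x)(1 := \<pi> t x)) (u (Suc t)) x \<le> u t x + \<epsilon>" by metis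
  define QQ where "QQ = PP(1 := \<pi>)"
  have Q: "follows QQ" unfolding QQ_def by (rule follows_upd[OF \<pi>(1)])
  have tuple: "(tuple PP t x)(1 := \<pi> t x) = tuple QQ t x" for t x
    using N1 by (auto simp: QQ_def tuple_def fun_eq_iff)
  have "2 * (ennreal cbar * (\<integral>\<^sup>+x. ennreal (val 1 (x 1) - u 1 x) \<partial>init_tuple_law M))
      \<le> ennreal (\<epsilon> * (2 * (\<Sum>r=1..T-1. cbar ^ r))) + side_error"
  proof (rule accumulate[where d = "\<lambda>t x. ennreal (val t (x 1) - u t x)", OF Q])
    show "(\<lambda>x. ennreal (val t (x 1) - u t x)) \<in> borel_measurable ST" if "t \<in> {1..T}" for t
      using bounded_borelD(1)[OF bounded_borel_diff[OF vb[OF that] ub[OF that]]] by simp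
    show "ennreal (val t (x 1) - u t x) \<le> ennreal \<epsilon> + (ennreal (C (T - t)) * \<zeta> (Z t x)
      + ennreal cbar * (\<integral>\<^sup>+w. ennreal (val (Suc t) (w 1) - u (Suc t) w) \<partial>next_law M t (\<lambda>n. QQ n t x) x))"
      if t: "t \<in> {1..<T}" and x: "x \<in> space ST" for t x
    proof -
      let ?m = "mf_score M t (flow t) (QQ 1 t x) (val (Suc t)) (x 1)"
      let ?s = "score M t (tuple QQ t x) (u (Suc t)) x"
      have "QQ 1 t x \<in> prob_measures" using N1 by (intro profileD(2)[OF follows_profile[OF Q] _ t x]) auto
      then have "val t (x 1) \<le> ?m"
        using mf_opt_selector(3)[OF t, of "val (Suc t)"] val_bounded[of "Suc t"] t by (simp add: val_step)
      then have "ennreal (val t (x 1) - u t x) \<le> ennreal (?m - u t x)" by (intro ennreal_leI) simp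
      also have "\<dots> \<le> ennreal (?s - u t x) + ennreal (?m - ?s)"
        using ennreal_diff_triangle[of ?m "u t x" ?s] by (simp add: add.commute)
      also have "\<dots> \<le> ennreal \<epsilon> + (ennreal (C (T - t)) * \<zeta> (Z t x)
        + ennreal cbar * (\<integral>\<^sup>+w. ennreal (val (Suc t) (w 1) - u (Suc t) w) \<partial>next_law M t (\<lambda>n. QQ n t x) x))"
      proof (intro add_mono ennreal_leI step_compare(2)[OF Q t x] ub)
        show "?s - u t x \<le> \<epsilon>" using \<pi>(2)[OF t x] unfolding tuple by linarith
      qed (use t in auto)
      finally show ?thesis .
    qed
    show "ennreal (val T (x 1) - u T x) \<le> \<iota> (Z T x)" if x: "x \<in> space ST" for x
      by (rule order_trans[OF ennreal_leI terminal_compare[OF x]]) (simp add: u_def)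
  qed (use \<epsilon> in simp)
  moreover have "opt_score_op M PP T U = init_score M (u 1)" by (simp add: opt_score_op_def u_def)
  then have "ennreal (init_score M (\<lambda>x. val 1 (x 1)) - opt_score_op M PP T U)
    \<le> ennreal cbar * (\<integral>\<^sup>+x. ennreal (val 1 (x 1) - u 1 x) \<partial>init_tuple_law M)"
    using one_sided(1)[OF vb ub, of 1 1] T2 by simp
  ultimately show ?thesis by (meson mult_left_mono order_trans zero_le)
qed

lemma opt_le_score_op:
  assumes q: "\<And>t. t \<in> {1..<T} \<Longrightarrow> q t \<in> mf_policies_mod \<theta>"
  shows "opt_score_op M PP T U \<le> score_op M (PP(1 := \<lambda>t. as_policy M 1 (q t))) T U"
proof -
  let ?Q = "PP(1 := \<lambda>t. as_policy M 1 (q t))"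
  have "follows ?Q" using q N1 by (intro follows_upd as_policy_policies) (auto simp: mf_policies_mod_def)
  note prof = follows_profile[OF this]
  have "opt_score_step M ?Q = opt_score_step M PP"
  proof (intro ext)
    fix t u x show "opt_score_step M ?Q t u x = opt_score_step M PP t u x" by (rule opt_score_step_cong) auto
  qed
  then have eq: "opt_score_op M ?Q T U = opt_score_op M PP T U" by (simp add: opt_score_op_def)
  have "0 \<le> exploitability M ?Q U"
    unfolding exploitability_telescope
  proof (rule sum_nonneg)
    fix t assume "t \<in> {1..T-1}"
    then have t: "t \<in> {1..<T}" "t \<in> {1..T}" by auto
    note g = gap[OF prof U_bounded t(1)]
    show "0 \<le> hybrid ?Q U (Suc t) - hybrid ?Q U t"
      unfolding hybrid_diff[OF t(1)] using score_op_mono[OF prof t(2) g(2,1,3)] by simp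
  qed
  then show ?thesis using eq by (simp add: exploitability_def)
qed

text \<open>The infimum over restricted policies lies between the optimal value and the score of the policy for the frozen
  flow. The former is at least the frozen value minus half of \<open>side_error\<close>, the latter at most the frozen value
  plus half of it, up to an arbitrarily small term.\<close>

theorem restricted_exploitability_bound:
  "ennreal \<bar>restricted_exploitability M \<theta> PP U - exploitability M PP U\<bar> \<le> total_error M c0 c1 cbar \<zeta> \<eta> \<theta> \<iota> K V"
proof -
  let ?D = "{q :: nat \<Rightarrow> ('x, 'a) mf_policy. \<forall>t\<in>{1..<T}. q t \<in> mf_policies_mod \<theta>}"
  let ?S = "\<lambda>q. score_op M (PP(1 := \<lambda>t. as_policy M 1 (q t))) T U"
  let ?o = "opt_score_op M PP T U"
  have "p 1 \<in> ?D" using p_mod N1 by auto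
  then have ne: "?D \<noteq> {}" by blast
  have low: "?o \<le> ?S q" if "q \<in> ?D" for q using that by (intro opt_le_score_op) auto
  have bdd: "bdd_below (?S ` ?D)" using low by (rule bdd_belowI2)
  have inf_ge: "?o \<le> (INF q\<in>?D. ?S q)" by (rule cINF_greatest[OF ne low])
  have eq: "\<bar>restricted_exploitability M \<theta> PP U - exploitability M PP U\<bar> = (INF q\<in>?D. ?S q) - ?o"
    using inf_ge by (simp add: restricted_exploitability_def exploitability_def)
  have "ennreal ((INF q\<in>?D. ?S q) - ?o) \<le> side_error"
  proof (rule ennreal_le_epsilon)
    fix \<delta> :: real assume \<delta>: "0 < \<delta>"
    define s where "s = 2 * (\<Sum>r=1..T-1. cbar ^ r)"
    have s: "0 \<le> s" unfolding s_def using cbar_pos by (simp add: sum_nonneg)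
    define \<epsilon> where "\<epsilon> = \<delta> / (1 + s)"
    have \<epsilon>: "0 < \<epsilon>" "\<epsilon> * s \<le> \<delta>" using \<delta> s by (auto simp: \<epsilon>_def field_simps)
    obtain q where q: "\<And>t. t \<in> {1..<T} \<Longrightarrow> q t \<in> mf_policies_mod \<theta>"
      and up: "2 * ennreal (?S q - init_score M (\<lambda>x. val 1 (x 1))) \<le> ennreal (\<epsilon> * s) + side_error"
      using upper_value[OF \<epsilon>(1)] unfolding s_def by blast
    have lo: "2 * ennreal (init_score M (\<lambda>x. val 1 (x 1)) - ?o) \<le> ennreal (\<epsilon> * s) + side_error"
      using lower_value[OF \<epsilon>(1)] unfolding s_def .
    have "(INF q\<in>?D. ?S q) \<le> ?S q" by (rule cINF_lower[OF bdd]) (use q in simp)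
    then have "2 * ennreal ((INF q\<in>?D. ?S q) - ?o) \<le> 2 * ennreal (?S q - ?o)" by (intro mult_left_mono ennreal_leI) auto
    also have "\<dots> \<le> 2 * (ennreal (?S q - init_score M (\<lambda>x. val 1 (x 1))) + ennreal (init_score M (\<lambda>x. val 1 (x 1)) - ?o))"
      by (intro mult_left_mono ennreal_diff_triangle) simp
    also have "\<dots> \<le> (ennreal (\<epsilon> * s) + side_error) + (ennreal (\<epsilon> * s) + side_error)" unfolding distrib_left by (rule add_mono[OF up lo])
    also have "\<dots> = 2 * (ennreal (\<epsilon> * s) + side_error)" by (simp add: mult_2)
    finally have "ennreal ((INF q\<in>?D. ?S q) - ?o) \<le> ennreal (\<epsilon> * s) + side_error"
      by (subst (asm) ennreal_mult_le_mult_iff) auto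
    also have "\<dots> \<le> side_error + ennreal \<delta>" using ennreal_leI[OF \<epsilon>(2)] by (simp add: add.commute add_left_mono)
    finally show "ennreal ((INF q\<in>?D. ?S q) - ?o) \<le> side_error + ennreal \<delta>" .
  qed
  also have "side_error \<le> total_error M c0 c1 cbar \<zeta> \<eta> \<theta> \<iota> K V"
    unfolding side_error_def total_error_def Let_def
    by (intro add_mono sum_mono mult_left_mono order_refl) auto
  finally show ?thesis unfolding eq .
qed

end

theorem proposition4p2:
  fixes M :: "('x::polish_space, 'a::polish_space) game"
    and c0 c1 cbar :: real
    and \<zeta> :: "ennreal \<Rightarrow> ennreal"
  assumes "compact (UNIV :: 'a set)"
    and "game_wf M"
    and "monotonicity M"
    and "growth_bound M c0 c1"
    and "score_continuity M c0 c1 \<zeta>"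
  shows
    "(integral_bound M cbar \<longrightarrow>
        (\<forall>\<PP>\<in>profiles M. \<forall>U\<in>bounded_borel (state_tuples M).
           exploitability M \<PP> U \<le> stepwise_exploitability M cbar \<PP> U)) \<and>
     (\<forall>clow. integral_bound M cbar \<and> lower_integral_bound M clow \<longrightarrow>
        (\<forall>\<PP>\<in>profiles M. \<forall>U\<in>bounded_borel (state_tuples M).
           exploitability M \<PP> U
             \<ge> (clow / cbar) ^ (horizon M - 1) * stepwise_exploitability M cbar \<PP> U)) \<and>
     (\<forall>K \<eta> \<theta> \<iota> \<PP> U V.
        uniform_tightness M K \<and> integral_bound M cbar \<and> consistency M \<and> kernel_continuity M \<eta> \<and>
        symmetric_continuity M \<theta> \<iota> \<PP> U V \<longrightarrow>
          ennreal \<bar>restricted_exploitability M \<theta> (as_profile M \<PP>) U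
                   - exploitability M (as_profile M \<PP>) U\<bar>
            \<le> total_error M c0 c1 cbar \<zeta> \<eta> \<theta> \<iota> K V)"
proof -
  interpret score_model M c0 c1 \<zeta>
    by unfold_locales (use assms in auto)
  have "ennreal \<bar>restricted_exploitability M \<theta> (as_profile M \<PP>) U - exploitability M (as_profile M \<PP>) U\<bar>
      \<le> total_error M c0 c1 cbar \<zeta> \<eta> \<theta> \<iota> K V"
    if "uniform_tightness M K" "integral_bound M cbar" "consistency M" "kernel_continuity M \<eta>"
      "symmetric_continuity M \<theta> \<iota> \<PP> U V" for K \<eta> \<theta> \<iota> \<PP> U V
  proof -
    interpret mf_model M c0 c1 \<zeta> cbar K \<eta> \<theta> \<iota> \<PP> U V
      by unfold_locales (use that in auto)
    show ?thesis by (rule restricted_exploitability_bound)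
  qed
  then show ?thesis using exploitability_le_stepwise exploitability_ge_stepwise by blast
qed

end
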